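(* Let $\mathcal{C}$ be a class of finite $L$-structures. (i) (One variable criterion) If all $L$-formulas $\phi(x,\bar y)$ with $x$ a single variable satisfy the defining condition of an m.a.c. (respectively m.e.c.) for $\mathcal{C}$, then so do all $L$-formulas $\phi(\bar x,\bar y)$ with $\bar{x}$ an arbitrary tuple of variables; that is, $\mathcal{C}$ is an m.a.c. (respectively m.e.c.). (ii) (Interpretability) If the class $\mathcal{D}$ (of finite structures in a language $L'$) is uniformly interpretable in $\mathcal{C}$ and $\mathcal{C}$ is an m.a.c. (respectively m.e.c.), then $\mathcal{D}$ is a weak m.a.c. (respectively weak m.e.c.). (iii) (Bi-interpretability) In (ii), the word "weak" can be dropped if $\mathcal{C}$ and $\mathcal{D}$ are uniformly bi-interpretable.
   Context: Definition of m.a.c. and m.e.c. Let $\mathcal{C}$ be a class of finite $L$-structures. For a tuple $\bar y$ of variables, $(\mathcal{C},\bar y)$ denotes the set of pairs $(M,\bar a)$ with $M\in\mathcal{C}$, $\bar a\in M^{|\bar y|}$. A partition $\Pi$ of $(\mathcal{C},\bar y)$ is $\emptyset$-definable if for each $\pi\in\Pi$ there is a parameter-free $L$-formula $\phi_\pi(\bar y)$ with $\phi_\pi(M^{|\bar y|})=\{\bar b\in M^{|\bar{y}|}:(M,\bar b)\in\pi\}$ for all $M\in\mathcal{C}$. Let $R$ be a set of functions $\mathcal{C}\to\mathbb{R}^{\ge 0}$. $\mathcal{C}$ is an $R$-multidimensional asymptotic class ($R$-m.a.c.) if for every $L$-formula $\phi(\bar x;\bar y)$ there is a finite $\emptyset$-definable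 partition $\Pi$ of $(\mathcal{C},\bar y)$ and functions $h_\pi\in R$ ($\pi\in\Pi$) such that for each $\pi\in\Pi$, for $(M,\bar b)\in\pi$, $\big||\phi(M^{|\bar x|};\bar b)|-h_\pi(M)\big|=o(h_\pi(M))$ as $|M|\to\infty$; that is, for every $\epsilon>0$ there is $Q\in\mathbb{N}$ such that for all $(M,\bar b)\in\pi$ with $|M|>Q$, $\big||\phi(M^{|\bar x|};\bar b)|-h_\pi(M)\big|\le\epsilon h_\pi(M)$. $\mathcal{C}$ is an $R$-m.e.c. (multidimensional exact class) if instead $|\phi(M^{|\bar x|};\bar b)|=h_\pi(M)$ for all $(M,\bar b)\in\pi$. "Weak" means that the requirement that $\Pi$ is $\emptyset$-definable is dropped. When no $R$ is mentioned, the notion is meant for some $R$. Interpretability. An $L'$-structure $N$ is $A$-interpretable in an $L$-structure $M$ if $N$ is isomorphic to a structure whose domain is a quotient, by an $A$-definable equivalence relation, of an $A$-definable subset of a cartesian power of $M$, with relations induced by $A$-definable relations of $M$. $\mathcal{D}$ is uniformly interpretable in $\mathcal{C}$ if there is an injection $\alpha:\mathcal{D}\to\mathcal{C}$ such that each $N\in\mathcal{D}$ is interpretable (parameters allowed) in $\alpha(N)$ through fixed formulas not depending on $N$. Structures $M,N$ are bi-interpretable if $N$ is $\emptyset$-interpretable in $M$ via an isomorphism $f:N\to N^*$ ($N^*$ living on a quotient in a power of $M$), $M$ is $\emptyset$-interpretable in $N$ via an isomorphism $g:M\to M^*$, and, where $f^*:M^*\to M^{**}$ is the isomorphism induced by $f$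 ($M^{**}$ interpreted in $N^*$) and $g^*:N^*\to N^{**}$ is that induced by $g$, the isomorphisms $f^*\circ g:M\to M^{**}$ and $g^*\circ f:N\to N^{**}$ are $\emptyset$-definable in $M$ and $N$ respectively. $\mathcal{C}$ and $\mathcal{D}$ are uniformly bi-interpretable if there is a bijection $\alpha:\mathcal{D}\to\mathcal{C}$ such that each $N\in\mathcal{D}$ is bi-interpretable with $\alpha(N)$, without parameters and through fixed formulas. *)

theory Defs
  imports Complex_Main "HOL-Library.FuncSet" "HOL-Library.Disjoint_Sets"
begin

section \<open>First-order languages, structures and formulas\<close>

text \<open>Symbols are explicit sets, so that a language may have no function or no relation
  symbols although HOL types are nonempty. Constants are function symbols of arity 0.\<close>

record ('f, 'r) lang =
  fun_syms :: "'f set"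
  rel_syms :: "'r set"
  fun_ar :: "'f \<Rightarrow> nat"
  rel_ar :: "'r \<Rightarrow> nat"

datatype 'f tm = Var nat | Fn 'f "'f tm list"

datatype ('f, 'r) fm =
    Equal "'f tm" "'f tm"
  | Pred 'r "'f tm list"
  | Neg "('f, 'r) fm"
  | Conj "('f, 'r) fm" "('f, 'r) fm"
  | Exists nat "('f, 'r) fm"

fun tm_vars :: "'f tm \<Rightarrow> nat set" where
  "tm_vars (Var v) = {v}"
| "tm_vars (Fn f ts) = (\<Union>t\<in>set ts. tm_vars t)"

primrec fv :: "('f, 'r) fm \<Rightarrow> nat set" where
  "fv (Equal s t) = tm_vars s \<union> tm_vars t"
| "fv (Pred r ts) = (\<Union>t\<in>set ts. tm_vars t)"
| "fv (Neg \<phi>) = fv \<phi>"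
| "fv (Conj \<phi> \<psi>) = fv \<phi> \<union> fv \<psi>"
| "fv (Exists v \<phi>) = fv \<phi> - {v}"

fun lang_tm :: "('f, 'r) lang \<Rightarrow> 'f tm \<Rightarrow> bool" where
  "lang_tm L (Var v) \<longleftrightarrow> True"
| "lang_tm L (Fn f ts) \<longleftrightarrow>
     f \<in> fun_syms L \<and> length ts = fun_ar L f \<and> (\<forall>t\<in>set ts. lang_tm L t)"

primrec lang_fm :: "('f, 'r) lang \<Rightarrow> ('f, 'r) fm \<Rightarrow> bool" where
  "lang_fm L (Equal s t) \<longleftrightarrow> lang_tm L s \<and> lang_tm L t"
| "lang_fm L (Pred r ts) \<longleftrightarrow>
     r \<in> rel_syms L \<and> length ts = rel_ar L r \<and> (\<forall>t\<in>set ts. lang_tm L t)"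
| "lang_fm L (Neg \<phi>) \<longleftrightarrow> lang_fm L \<phi>"
| "lang_fm L (Conj \<phi> \<psi>) \<longleftrightarrow> lang_fm L \<phi> \<and> lang_fm L \<psi>"
| "lang_fm L (Exists v \<phi>) \<longleftrightarrow> lang_fm L \<phi>"

text \<open>\<open>\<phi>(vs)\<close> is a parameter-free \<open>L\<close>-formula in the tuple \<open>vs\<close> of distinct variables.\<close>

definition formula_in :: "('f, 'r) lang \<Rightarrow> ('f, 'r) fm \<Rightarrow> nat list \<Rightarrow> bool" where
  "formula_in L \<phi> vs \<longleftrightarrow> lang_fm L \<phi> \<and> distinct vs \<and> fv \<phi> \<subseteq> set vs"

definition tuples :: "'a set \<Rightarrow> nat \<Rightarrow> 'a list set" where
  "tuples U n = {as. set as \<subseteq> U \<and> length as = n}"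

record ('u, 'f, 'r) struct =
  univ :: "'u set"
  fun_int :: "'f \<Rightarrow> 'u list \<Rightarrow> 'u"
  rel_int :: "'r \<Rightarrow> 'u list set"

text \<open>Outside the symbols of \<open>L\<close> and outside the universe the components are pinned to default
  values, so that records satisfying \<open>is_structure L\<close> correspond one-to-one to \<open>L\<close>-structures
  and equality of records is equality of structures.\<close>

definition is_structure :: "('f, 'r) lang \<Rightarrow> ('u, 'f, 'r) struct \<Rightarrow> bool" where
  "is_structure L M \<longleftrightarrow>
     univ M \<noteq> {} \<and>
     (\<forall>f\<in>fun_syms L. fun_int M f \<in> tuples (univ M) (fun_ar L f) \<rightarrow>\<^sub>E univ M) \<and>
     (\<forall>f. f \<notin> fun_syms L \<longrightarrow> fun_int M f = undefined) \<and>
     (\<forall>r\<in>rel_syms L. rel_int M r \<subseteq> tuples (univ M) (rel_ar L r)) \<and>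
     (\<forall>r. r \<notin> rel_syms L \<longrightarrow> rel_int M r = {})"

definition finite_structures :: "('f, 'r) lang \<Rightarrow> ('u, 'f, 'r) struct set \<Rightarrow> bool" where
  "finite_structures L C \<longleftrightarrow> (\<forall>M\<in>C. is_structure L M \<and> finite (univ M))"

primrec tm_val :: "('u, 'f, 'r) struct \<Rightarrow> (nat \<Rightarrow> 'u) \<Rightarrow> 'f tm \<Rightarrow> 'u" where
  "tm_val M e (Var v) = e v"
| "tm_val M e (Fn f ts) = fun_int M f (map (tm_val M e) ts)"

primrec sat :: "('u, 'f, 'r) struct \<Rightarrow> (nat \<Rightarrow> 'u) \<Rightarrow> ('f, 'r) fm \<Rightarrow> bool" where
  "sat M e (Equal s t) \<longleftrightarrow> tm_val M e s = tm_val M e t"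
| "sat M e (Pred r ts) \<longleftrightarrow> map (tm_val M e) ts \<in> rel_int M r"
| "sat M e (Neg \<phi>) \<longleftrightarrow> \<not> sat M e \<phi>"
| "sat M e (Conj \<phi> \<psi>) \<longleftrightarrow> sat M e \<phi> \<and> sat M e \<psi>"
| "sat M e (Exists v \<phi>) \<longleftrightarrow> (\<exists>a\<in>univ M. sat M (e(v := a)) \<phi>)"

text \<open>\<open>holds M \<phi> vs as\<close> is \<open>M \<Turnstile> \<phi>(as)\<close>, the tuple \<open>as\<close> being substituted for the variables \<open>vs\<close>.
  It is only used when \<open>vs\<close> contains all free variables of \<open>\<phi>\<close>, so the value \<open>undefined\<close> of the
  remaining variables plays no role.\<close>

definition holds :: "('u, 'f, 'r) struct \<Rightarrow> ('f, 'r) fm \<Rightarrow> nat list \<Rightarrow> 'u list \<Rightarrow> bool" where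
  "holds M \<phi> vs as \<longleftrightarrow>
     sat M (\<lambda>v. case map_of (zip vs as) v of Some a \<Rightarrow> a | None \<Rightarrow> undefined) \<phi>"

text \<open>The set \<open>\<phi>(M; b)\<close> for the partitioned formula \<open>\<phi>(xs; ys)\<close>.\<close>

definition solutions ::
  "('u, 'f, 'r) struct \<Rightarrow> ('f, 'r) fm \<Rightarrow> nat list \<Rightarrow> nat list \<Rightarrow> 'u list \<Rightarrow> 'u list set" where
  "solutions M \<phi> xs ys b = {a \<in> tuples (univ M) (length xs). holds M \<phi> (xs @ ys) (a @ b)}"


section \<open>Multidimensional asymptotic and exact classes\<close>

definition class_pairs ::
  "('u, 'f, 'r) struct set \<Rightarrow> nat list \<Rightarrow> (('u, 'f, 'r) struct \<times> 'u list) set" where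
  "class_pairs C ys = {(M, a). M \<in> C \<and> a \<in> tuples (univ M) (length ys)}"

definition definable_partition ::
  "('f, 'r) lang \<Rightarrow> ('u, 'f, 'r) struct set \<Rightarrow> nat list
    \<Rightarrow> (('u, 'f, 'r) struct \<times> 'u list) set set \<Rightarrow> bool" where
  "definable_partition L C ys P \<longleftrightarrow>
     (\<forall>\<pi>\<in>P. \<exists>\<psi>. formula_in L \<psi> ys \<and>
        (\<forall>M\<in>C. solutions M \<psi> ys [] [] = {b \<in> tuples (univ M) (length ys). (M, b) \<in> \<pi>}))"

definition asymptotic_on ::
  "(('u, 'f, 'r) struct \<times> 'u list) set \<Rightarrow> ('f, 'r) fm \<Rightarrow> nat list \<Rightarrow> nat list
    \<Rightarrow> (('u, 'f, 'r) struct \<Rightarrow> real) \<Rightarrow> bool" where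
  "asymptotic_on \<pi> \<phi> xs ys h \<longleftrightarrow>
     (\<forall>\<epsilon>>0. \<exists>Q::nat. \<forall>(M, b)\<in>\<pi>. card (univ M) > Q \<longrightarrow>
        \<bar>real (card (solutions M \<phi> xs ys b)) - h M\<bar> \<le> \<epsilon> * h M)"

definition exact_on ::
  "(('u, 'f, 'r) struct \<times> 'u list) set \<Rightarrow> ('f, 'r) fm \<Rightarrow> nat list \<Rightarrow> nat list
    \<Rightarrow> (('u, 'f, 'r) struct \<Rightarrow> real) \<Rightarrow> bool" where
  "exact_on \<pi> \<phi> xs ys h \<longleftrightarrow> (\<forall>(M, b)\<in>\<pi>. real (card (solutions M \<phi> xs ys b)) = h M)"

text \<open>The defining conditions for a single partitioned formula \<open>\<phi>(xs; ys)\<close>.\<close>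

definition mac_condition ::
  "('f, 'r) lang \<Rightarrow> (('u, 'f, 'r) struct \<Rightarrow> real) set \<Rightarrow> ('u, 'f, 'r) struct set
    \<Rightarrow> ('f, 'r) fm \<Rightarrow> nat list \<Rightarrow> nat list \<Rightarrow> bool" where
  "mac_condition L R C \<phi> xs ys \<longleftrightarrow>
     (\<exists>P h. finite P \<and> partition_on (class_pairs C ys) P \<and> definable_partition L C ys P \<and>
        (\<forall>\<pi>\<in>P. h \<pi> \<in> R \<and> asymptotic_on \<pi> \<phi> xs ys (h \<pi>)))"

definition mec_condition ::
  "('f, 'r) lang \<Rightarrow> (('u, 'f, 'r) struct \<Rightarrow> real) set \<Rightarrow> ('u, 'f, 'r) struct set
    \<Rightarrow> ('f, 'r) fm \<Rightarrow> nat list \<Rightarrow> nat list \<Rightarrow> bool" where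
  "mec_condition L R C \<phi> xs ys \<longleftrightarrow>
     (\<exists>P h. finite P \<and> partition_on (class_pairs C ys) P \<and> definable_partition L C ys P \<and>
        (\<forall>\<pi>\<in>P. h \<pi> \<in> R \<and> exact_on \<pi> \<phi> xs ys (h \<pi>)))"

definition weak_mac_condition ::
  "(('u, 'f, 'r) struct \<Rightarrow> real) set \<Rightarrow> ('u, 'f, 'r) struct set
    \<Rightarrow> ('f, 'r) fm \<Rightarrow> nat list \<Rightarrow> nat list \<Rightarrow> bool" where
  "weak_mac_condition R C \<phi> xs ys \<longleftrightarrow>
     (\<exists>P h. finite P \<and> partition_on (class_pairs C ys) P \<and>
        (\<forall>\<pi>\<in>P. h \<pi> \<in> R \<and> asymptotic_on \<pi> \<phi> xs ys (h \<pi>)))"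

definition weak_mec_condition ::
  "(('u, 'f, 'r) struct \<Rightarrow> real) set \<Rightarrow> ('u, 'f, 'r) struct set
    \<Rightarrow> ('f, 'r) fm \<Rightarrow> nat list \<Rightarrow> nat list \<Rightarrow> bool" where
  "weak_mec_condition R C \<phi> xs ys \<longleftrightarrow>
     (\<exists>P h. finite P \<and> partition_on (class_pairs C ys) P \<and>
        (\<forall>\<pi>\<in>P. h \<pi> \<in> R \<and> exact_on \<pi> \<phi> xs ys (h \<pi>)))"

definition R_mac ::
  "('f, 'r) lang \<Rightarrow> (('u, 'f, 'r) struct \<Rightarrow> real) set \<Rightarrow> ('u, 'f, 'r) struct set \<Rightarrow> bool" where
  "R_mac L R C \<longleftrightarrow> R \<subseteq> (C \<rightarrow> {0..}) \<and>
     (\<forall>\<phi> xs ys. formula_in L \<phi> (xs @ ys) \<longrightarrow> mac_condition L R C \<phi> xs ys)"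

definition R_mec ::
  "('f, 'r) lang \<Rightarrow> (('u, 'f, 'r) struct \<Rightarrow> real) set \<Rightarrow> ('u, 'f, 'r) struct set \<Rightarrow> bool" where
  "R_mec L R C \<longleftrightarrow> R \<subseteq> (C \<rightarrow> {0..}) \<and>
     (\<forall>\<phi> xs ys. formula_in L \<phi> (xs @ ys) \<longrightarrow> mec_condition L R C \<phi> xs ys)"

definition weak_R_mac ::
  "('f, 'r) lang \<Rightarrow> (('u, 'f, 'r) struct \<Rightarrow> real) set \<Rightarrow> ('u, 'f, 'r) struct set \<Rightarrow> bool" where
  "weak_R_mac L R C \<longleftrightarrow> R \<subseteq> (C \<rightarrow> {0..}) \<and>
     (\<forall>\<phi> xs ys. formula_in L \<phi> (xs @ ys) \<longrightarrow> weak_mac_condition R C \<phi> xs ys)"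

definition weak_R_mec ::
  "('f, 'r) lang \<Rightarrow> (('u, 'f, 'r) struct \<Rightarrow> real) set \<Rightarrow> ('u, 'f, 'r) struct set \<Rightarrow> bool" where
  "weak_R_mec L R C \<longleftrightarrow> R \<subseteq> (C \<rightarrow> {0..}) \<and>
     (\<forall>\<phi> xs ys. formula_in L \<phi> (xs @ ys) \<longrightarrow> weak_mec_condition R C \<phi> xs ys)"

definition mac :: "('f, 'r) lang \<Rightarrow> ('u, 'f, 'r) struct set \<Rightarrow> bool" where
  "mac L C \<longleftrightarrow> (\<exists>R. R_mac L R C)"

definition mec :: "('f, 'r) lang \<Rightarrow> ('u, 'f, 'r) struct set \<Rightarrow> bool" where
  "mec L C \<longleftrightarrow> (\<exists>R. R_mec L R C)"

definition weak_mac :: "('f, 'r) lang \<Rightarrow> ('u, 'f, 'r) struct set \<Rightarrow> bool" where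
  "weak_mac L C \<longleftrightarrow> (\<exists>R. weak_R_mac L R C)"

definition weak_mec :: "('f, 'r) lang \<Rightarrow> ('u, 'f, 'r) struct set \<Rightarrow> bool" where
  "weak_mec L C \<longleftrightarrow> (\<exists>R. weak_R_mec L R C)"


section \<open>Interpretations\<close>

definition isomorphism ::
  "('f, 'r) lang \<Rightarrow> ('u \<Rightarrow> 'v) \<Rightarrow> ('u, 'f, 'r) struct \<Rightarrow> ('v, 'f, 'r) struct \<Rightarrow> bool" where
  "isomorphism L h M N \<longleftrightarrow>
     bij_betw h (univ M) (univ N) \<and>
     (\<forall>f\<in>fun_syms L. \<forall>as\<in>tuples (univ M) (fun_ar L f).
        h (fun_int M f as) = fun_int N f (map h as)) \<and>
     (\<forall>r\<in>rel_syms L. \<forall>as\<in>tuples (univ M) (rel_ar L r).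
        as \<in> rel_int M r \<longleftrightarrow> map h as \<in> rel_int N r)"

text \<open>The formulas over \<open>('f, 'r)\<close> interpreting a structure with symbols \<open>('g, 's)\<close> on a quotient
  of a subset of the cartesian power with exponent \<open>dim\<close>. In all of them the variables
  \<open>0, \<dots>, p - 1\<close> stand for the parameters, followed by one block of \<open>dim\<close> variables for each
  argument; function symbols are given by the formulas for their graphs (value last).\<close>

record ('f, 'r, 'g, 's) interp =
  dim :: nat
  dom_fm :: "('f, 'r) fm"
  eq_fm :: "('f, 'r) fm"
  fun_fm :: "'g \<Rightarrow> ('f, 'r) fm"
  rel_fm :: "'s \<Rightarrow> ('f, 'r) fm"

definition interp_formulas ::
  "('f, 'r) lang \<Rightarrow> ('g, 's) lang \<Rightarrow> nat \<Rightarrow> ('f, 'r, 'g, 's) interp \<Rightarrow> bool" where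
  "interp_formulas L L' p I \<longleftrightarrow>
     formula_in L (dom_fm I) [0..<p + dim I] \<and>
     formula_in L (eq_fm I) [0..<p + 2 * dim I] \<and>
     (\<forall>g\<in>fun_syms L'. formula_in L (fun_fm I g) [0..<p + Suc (fun_ar L' g) * dim I]) \<and>
     (\<forall>s\<in>rel_syms L'. formula_in L (rel_fm I s) [0..<p + rel_ar L' s * dim I])"

definition interp_dom ::
  "('f, 'r, 'g, 's) interp \<Rightarrow> ('u, 'f, 'r) struct \<Rightarrow> 'u list \<Rightarrow> 'u list set" where
  "interp_dom I M c =
     {a \<in> tuples (univ M) (dim I). holds M (dom_fm I) [0..<length c + dim I] (c @ a)}"

definition interp_eq ::
  "('f, 'r, 'g, 's) interp \<Rightarrow> ('u, 'f, 'r) struct \<Rightarrow> 'u list \<Rightarrow> ('u list \<times> 'u list) set" where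
  "interp_eq I M c =
     {(a, b) \<in> interp_dom I M c \<times> interp_dom I M c.
        holds M (eq_fm I) [0..<length c + 2 * dim I] (c @ a @ b)}"

abbreviation interp_quot ::
  "('f, 'r, 'g, 's) interp \<Rightarrow> ('u, 'f, 'r) struct \<Rightarrow> 'u list \<Rightarrow> 'u list set set" where
  "interp_quot I M c \<equiv> interp_dom I M c // interp_eq I M c"

definition block_holds ::
  "('f, 'r, 'g, 's) interp \<Rightarrow> ('u, 'f, 'r) struct \<Rightarrow> 'u list \<Rightarrow> ('f, 'r) fm
    \<Rightarrow> 'u list list \<Rightarrow> bool" where
  "block_holds I M c \<phi> as \<longleftrightarrow>
     holds M \<phi> [0..<length c + length as * dim I] (c @ concat as)"

definition induced_rel ::
  "('f, 'r, 'g, 's) interp \<Rightarrow> ('u, 'f, 'r) struct \<Rightarrow> 'u list \<Rightarrow> ('f, 'r) fm \<Rightarrow> nat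
    \<Rightarrow> 'u list set list set" where
  "induced_rel I M c \<phi> n =
     {As \<in> tuples (interp_quot I M c) n. \<exists>as. list_all2 (\<in>) as As \<and> block_holds I M c \<phi> as}"

definition interp_struct ::
  "('g, 's) lang \<Rightarrow> ('f, 'r, 'g, 's) interp \<Rightarrow> ('u, 'f, 'r) struct \<Rightarrow> 'u list
    \<Rightarrow> ('u list set, 'g, 's) struct" where
  "interp_struct L' I M c =
     \<lparr> univ = interp_quot I M c,
       fun_int = (\<lambda>g. if g \<in> fun_syms L'
          then (\<lambda>As\<in>tuples (interp_quot I M c) (fun_ar L' g).
                  THE B. As @ [B] \<in> induced_rel I M c (fun_fm I g) (Suc (fun_ar L' g)))
          else undefined),
       rel_int = (\<lambda>s. if s \<in> rel_syms L'
          then induced_rel I M c (rel_fm I s) (rel_ar L' s) else {}) \<rparr>"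

definition invariant_fm ::
  "('f, 'r, 'g, 's) interp \<Rightarrow> ('u, 'f, 'r) struct \<Rightarrow> 'u list \<Rightarrow> ('f, 'r) fm \<Rightarrow> nat \<Rightarrow> bool" where
  "invariant_fm I M c \<phi> n \<longleftrightarrow>
     (\<forall>as bs. length as = n \<and> list_all2 (\<lambda>a b. (a, b) \<in> interp_eq I M c) as bs \<longrightarrow>
        (block_holds I M c \<phi> as \<longleftrightarrow> block_holds I M c \<phi> bs))"

definition interp_wf ::
  "('g, 's) lang \<Rightarrow> ('f, 'r, 'g, 's) interp \<Rightarrow> ('u, 'f, 'r) struct \<Rightarrow> 'u list \<Rightarrow> bool" where
  "interp_wf L' I M c \<longleftrightarrow>
     equiv (interp_dom I M c) (interp_eq I M c) \<and>
     (\<forall>s\<in>rel_syms L'. invariant_fm I M c (rel_fm I s) (rel_ar L' s)) \<and>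
     (\<forall>g\<in>fun_syms L'. invariant_fm I M c (fun_fm I g) (Suc (fun_ar L' g)) \<and>
        (\<forall>As\<in>tuples (interp_quot I M c) (fun_ar L' g).
           \<exists>!B. As @ [B] \<in> induced_rel I M c (fun_fm I g) (Suc (fun_ar L' g))))"

text \<open>\<open>N\<close> is interpreted in \<open>M\<close> by the formulas \<open>I\<close> with parameters \<open>c\<close>, via the isomorphism \<open>f\<close>
  from \<open>N\<close> onto the structure living on the quotient.\<close>

definition interprets_via ::
  "('g, 's) lang \<Rightarrow> ('f, 'r, 'g, 's) interp \<Rightarrow> ('u, 'f, 'r) struct \<Rightarrow> 'u list
    \<Rightarrow> ('v, 'g, 's) struct \<Rightarrow> ('v \<Rightarrow> 'u list set) \<Rightarrow> bool" where
  "interprets_via L' I M c N f \<longleftrightarrow>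
     interp_wf L' I M c \<and> isomorphism L' f N (interp_struct L' I M c)"

definition uniformly_interpretable ::
  "('g, 's) lang \<Rightarrow> ('v, 'g, 's) struct set \<Rightarrow> ('f, 'r) lang \<Rightarrow> ('u, 'f, 'r) struct set
    \<Rightarrow> bool" where
  "uniformly_interpretable L' D L C \<longleftrightarrow>
     (\<exists>\<alpha> p (I :: ('f, 'r, 'g, 's) interp).
        inj_on \<alpha> D \<and> \<alpha> ` D \<subseteq> C \<and> interp_formulas L L' p I \<and>
        (\<forall>N\<in>D. \<exists>c\<in>tuples (univ (\<alpha> N)) p. \<exists>f. interprets_via L' I (\<alpha> N) c N f))"


subsection \<open>Bi-interpretations\<close>

text \<open>An isomorphism \<open>f\<close> from \<open>N\<close> to \<open>N*\<close> induces an isomorphism between the structures that a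
  fixed interpretation yields in \<open>N\<close> and in \<open>N*\<close>: an equivalence class of tuples of \<open>N\<close> is mapped
  to the class of the images of these tuples.\<close>

definition induced_map :: "('v \<Rightarrow> 'w) \<Rightarrow> 'v list set \<Rightarrow> 'w list set" where
  "induced_map f A = map f ` A"

text \<open>Let \<open>N*\<close> be interpreted in \<open>M\<close> by \<open>I\<close> and \<open>M**\<close> in \<open>N*\<close> by \<open>J\<close>, both without parameters. A map
  \<open>h\<close> from \<open>M\<close> to \<open>M**\<close> is defined in \<open>M\<close> by \<open>\<chi>\<close> if \<open>\<chi>\<close> defines the pullback of its graph to the
  power of \<open>M\<close> with exponent \<open>1 + dim J * dim I\<close>. Elements of \<open>M**\<close> are classes of tuples of
  length \<open>dim J\<close> of elements of \<open>N*\<close>, which in turn are classes of tuples of length \<open>dim I\<close>.\<close>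

definition defines_map ::
  "('f, 'r) lang \<Rightarrow> ('u, 'f, 'r) struct \<Rightarrow> ('f, 'r, 'g, 's) interp \<Rightarrow> ('g, 's, 'f, 'r) interp
    \<Rightarrow> ('f, 'r) fm \<Rightarrow> ('u \<Rightarrow> 'u list set list set) \<Rightarrow> bool" where
  "defines_map L M I J \<chi> h \<longleftrightarrow>
     formula_in L \<chi> [0..<1 + dim J * dim I] \<and>
     solutions M \<chi> [0..<1 + dim J * dim I] [] [] =
       {m # concat as | m as. m \<in> univ M \<and> as \<in> tuples (interp_dom I M []) (dim J) \<and>
          map (\<lambda>a. interp_eq I M [] `` {a}) as \<in> h m}"

definition bi_interpretable_via ::
  "('f, 'r) lang \<Rightarrow> ('u, 'f, 'r) struct \<Rightarrow> ('g, 's) lang \<Rightarrow> ('v, 'g, 's) struct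
    \<Rightarrow> ('f, 'r, 'g, 's) interp \<Rightarrow> ('g, 's, 'f, 'r) interp \<Rightarrow> ('f, 'r) fm \<Rightarrow> ('g, 's) fm \<Rightarrow> bool"
where
  "bi_interpretable_via L M L' N I J \<chi> \<xi> \<longleftrightarrow>
     interp_formulas L L' 0 I \<and> interp_formulas L' L 0 J \<and>
     (\<exists>f g. interprets_via L' I M [] N f \<and> interprets_via L J N [] M g \<and>
        defines_map L M I J \<chi> (induced_map f \<circ> g) \<and>
        defines_map L' N J I \<xi> (induced_map g \<circ> f))"

definition uniformly_bi_interpretable ::
  "('f, 'r) lang \<Rightarrow> ('u, 'f, 'r) struct set \<Rightarrow> ('g, 's) lang \<Rightarrow> ('v, 'g, 's) struct set
    \<Rightarrow> bool" where
  "uniformly_bi_interpretable L C L' D \<longleftrightarrow>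
     (\<exists>\<alpha> I J \<chi> \<xi>. bij_betw \<alpha> D C \<and>
        (\<forall>N\<in>D. bi_interpretable_via L (\<alpha> N) L' N I J \<chi> \<xi>))"

end

theory Submission
  imports Defs
begin

text \<open>
  The theorem says that finitely many growth rates suffice for counting, and the proof keeps the
  functions that have this property closed under the operations by which one counts. A function
  of pairs \<open>(M, b)\<close> is called definably asymptotic if the tuples \<open>b\<close> can be coloured with finitely
  many colours, each definable without parameters uniformly in \<open>M\<close>, such that the value at
  \<open>(M, b)\<close> is asymptotic to a nonnegative function of \<open>M\<close> that depends only on the colour of \<open>b\<close>.
  Since all errors are relative and all values nonnegative, such functions are closed under sums,
  scaling, inverses, and, decisively, under summation over a definable set of tuples, provided
  that the cardinalities of definable sets are definably asymptotic themselves
  (\<open>definably_asymptotic_sum_definable\<close>): the sum splits into its colour classes, on each of which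
  the summand is almost constant, so that only the sizes of these classes matter.

  Exact classes need no separate argument. A bound \<open>\<bar>a - h\<bar> \<le> \<epsilon> * h\<close> for all \<open>\<epsilon> > 0\<close> and all
  structures is the equality \<open>a = h\<close>, so m.e.c. and m.a.c. are the same notion along two
  filters: \<open>top\<close>, for which no structure is negligible, and the filter on which the size of the
  structure tends to infinity.

  (i) The solutions in \<open>k + m\<close> variables are counted by summing, over the values of the last \<open>m\<close>
  variables, the number of values of the first \<open>k\<close>. Closure under definable sums thus gives
  \<open>counts_asymptotic_add\<close>, and the criterion follows by induction.

  (ii) If \<open>N\<close> is interpreted in \<open>M\<close>, a definable subset of a power of \<open>N\<close> lifts to a definable set
  of representing tuples of \<open>M\<close>, on which the interpretation induces a definable equivalence
  relation. The number of elements of the original set is the sum, over all representing tuples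
  \<open>x\<close>, of the reciprocal of the size of the class of \<open>x\<close>; this is definably asymptotic
  (\<open>counting_function\<close>) even though the classes may be spread over several colours. Hence the
  colour of the tuple formed by a representative of \<open>b\<close> and the parameters of the interpretation
  decides the number of solutions of a formula at \<open>b\<close>. When the size of \<open>N\<close> tends to infinity, so does
  that of \<open>M\<close>, since \<open>N\<close> has at most \<open>\<bar>M\<bar>^d\<close> elements for the fixed exponent \<open>d\<close> of the
  interpretation.

  (iii) Colour \<open>b\<close> by the least colour of its representatives. For a bi-interpretation this is
  definable in \<open>N\<close> itself: representatives in \<open>M\<close> are in turn represented by tuples of \<open>N\<close>, the
  colours lift to definable sets of such tuples, and the definability of the isomorphism
  between \<open>N\<close> and its second iterate says precisely that the relation between an element of \<open>N\<close>
  and the tuples coding its representatives is definable (\<open>definable_least_colour\<close>).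
\<close>

section \<open>Uniformly definable predicates\<close>

lemma tm_val_cong: "(\<And>v. v \<in> tm_vars t \<Longrightarrow> e v = e' v) \<Longrightarrow> tm_val M e t = tm_val M e' t"
proof (induction t)
  case (Fn f ts)
  then have "map (tm_val M e) ts = map (tm_val M e') ts" by (intro map_cong) auto
  then show ?case by (simp only: tm_val.simps)
qed simp

lemma sat_cong: "(\<And>v. v \<in> fv \<phi> \<Longrightarrow> e v = e' v) \<Longrightarrow> sat M e \<phi> \<longleftrightarrow> sat M e' \<phi>"
proof (induction \<phi> arbitrary: e e')
  case (Equal s t)
  then show ?case using tm_val_cong[of s e e' M] tm_val_cong[of t e e' M] by simp
next
  case (Pred r ts)
  then have "map (tm_val M e) ts = map (tm_val M e') ts" by (intro map_cong tm_val_cong) auto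
  then show ?case by (simp only: sat.simps)
next
  case (Neg \<phi>)
  then show ?case by (metis fv.simps(3) sat.simps(3))
next
  case (Conj \<phi> \<psi>)
  have "sat M e \<phi> = sat M e' \<phi>" by (rule Conj.IH(1)) (simp add: Conj.prems)
  moreover have "sat M e \<psi> = sat M e' \<psi>" by (rule Conj.IH(2)) (simp add: Conj.prems)
  ultimately show ?case by simp
next
  case (Exists v \<phi>)
  have "sat M (e(v := a)) \<phi> = sat M (e'(v := a)) \<phi>" for a
    by (rule Exists.IH) (use Exists.prems in auto)
  then show ?case by simp
qed

primrec rename_tm :: "(nat \<Rightarrow> nat) \<Rightarrow> 'f tm \<Rightarrow> 'f tm" where
  "rename_tm \<sigma> (Var v) = Var (\<sigma> v)"
| "rename_tm \<sigma> (Fn f ts) = Fn f (map (rename_tm \<sigma>) ts)"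

lemma lang_rename_tm: "lang_tm L t \<Longrightarrow> lang_tm L (rename_tm \<sigma> t)"
  by (induction t) auto

lemma tm_vars_rename_tm: "tm_vars (rename_tm \<sigma> t) = \<sigma> ` tm_vars t"
  by (induction t) auto

lemma tm_val_rename_tm: "tm_val M e (rename_tm \<sigma> t) = tm_val M (e \<circ> \<sigma>) t"
proof (induction t)
  case (Fn f ts)
  then have "map (tm_val M e \<circ> rename_tm \<sigma>) ts = map (tm_val M (e \<circ> \<sigma>)) ts"
    by (intro map_cong) (auto simp: comp_def)
  then show ?case by (simp only: rename_tm.simps tm_val.simps map_map)
qed simp

lemma finite_fv: "finite (fv \<phi>)"
proof -
  have "finite (tm_vars t)" for t :: "'a tm" by (induction t) auto
  then show ?thesis by (induction \<phi>) auto
qed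

text \<open>
  Capture-avoiding substitution of variables for variables. A bound variable is replaced by one
  outside the image of the free variables, which makes arbitrary, possibly non-injective,
  renamings \<open>\<sigma>\<close> possible; these are needed to identify variables.
\<close>

lemma rename_fm_exists:
  assumes "lang_fm L \<phi>"
  shows "\<exists>\<psi>. lang_fm L \<psi> \<and> fv \<psi> \<subseteq> \<sigma> ` fv \<phi> \<and>
    (\<forall>(M :: ('u, 'f, 'r) struct) e. sat M e \<psi> \<longleftrightarrow> sat M (e \<circ> \<sigma>) \<phi>)"
  using assms
proof (induction \<phi> arbitrary: \<sigma>)
  case (Equal s t)
  then show ?case
    by (intro exI[of _ "Equal (rename_tm \<sigma> s) (rename_tm \<sigma> t)"])
      (auto simp: lang_rename_tm tm_vars_rename_tm tm_val_rename_tm comp_def)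
next
  case (Pred r ts)
  have "map (tm_val M e \<circ> rename_tm \<sigma>) ts = map (tm_val M (e \<circ> \<sigma>)) ts"
    for M :: "('u, 'f, 'r) struct" and e
    by (intro map_cong) (auto simp: tm_val_rename_tm)
  then have "sat M e (Pred r (map (rename_tm \<sigma>) ts)) = sat M (e \<circ> \<sigma>) (Pred r ts)"
    for M :: "('u, 'f, 'r) struct" and e by (simp only: sat.simps map_map)
  then show ?case using Pred
    by (intro exI[of _ "Pred r (map (rename_tm \<sigma>) ts)"] conjI allI)
      (auto simp: lang_rename_tm tm_vars_rename_tm comp_def simp del: sat.simps)
next
  case (Neg \<phi>)
  then obtain \<psi> where "lang_fm L \<psi>" "fv \<psi> \<subseteq> \<sigma> ` fv \<phi>"
    "\<forall>(M :: ('u, 'f, 'r) struct) e. sat M e \<psi> \<longleftrightarrow> sat M (e \<circ> \<sigma>) \<phi>"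
    by (metis lang_fm.simps(3))
  then show ?case by (intro exI[of _ "Neg \<psi>"]) (auto simp: comp_def)
next
  case (Conj \<phi>1 \<phi>2)
  then obtain \<psi>1 \<psi>2 where "lang_fm L \<psi>1" "fv \<psi>1 \<subseteq> \<sigma> ` fv \<phi>1"
    "\<forall>(M :: ('u, 'f, 'r) struct) e. sat M e \<psi>1 \<longleftrightarrow> sat M (e \<circ> \<sigma>) \<phi>1"
    "lang_fm L \<psi>2" "fv \<psi>2 \<subseteq> \<sigma> ` fv \<phi>2"
    "\<forall>(M :: ('u, 'f, 'r) struct) e. sat M e \<psi>2 \<longleftrightarrow> sat M (e \<circ> \<sigma>) \<phi>2"
    by (metis lang_fm.simps(4))
  then show ?case by (intro exI[of _ "Conj \<psi>1 \<psi>2"]) (auto simp: comp_def)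
next
  case (Exists v \<phi>)
  obtain w where w: "w \<notin> \<sigma> ` fv \<phi>"
    using ex_new_if_finite[OF infinite_UNIV_nat] finite_fv by blast
  obtain \<psi> where \<psi>: "lang_fm L \<psi>" "fv \<psi> \<subseteq> (\<sigma>(v := w)) ` fv \<phi>"
    "\<And>(M :: ('u, 'f, 'r) struct) e. sat M e \<psi> \<longleftrightarrow> sat M (e \<circ> \<sigma>(v := w)) \<phi>"
    using Exists by (metis lang_fm.simps(5))
  have "sat M (e(w := a) \<circ> \<sigma>(v := w)) \<phi> = sat M ((e \<circ> \<sigma>)(v := a)) \<phi>"
    for M :: "('u, 'f, 'r) struct" and e a
    by (rule sat_cong) (use w in auto)
  then have "sat M e (Exists w \<psi>) = sat M (e \<circ> \<sigma>) (Exists v \<phi>)"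
    for M :: "('u, 'f, 'r) struct" and e by (simp only: sat.simps \<psi>(3))
  moreover have "fv (Exists w \<psi>) \<subseteq> \<sigma> ` fv (Exists v \<phi>)" using \<psi>(2) by auto
  moreover have "lang_fm L (Exists w \<psi>)" using \<psi>(1) by simp
  ultimately show ?case by blast
qed

text \<open>
  Predicates of tuples that are defined by one formula in all structures of the class. Working
  with predicates in place of formulas turns every syntactic construction below into one of the
  closure properties that follow. The class may be the class of all structures, which is used
  for formulas whose meaning matters outside a given class.
\<close>

definition definable ::
  "('f, 'r) lang \<Rightarrow> ('u, 'f, 'r) struct set \<Rightarrow> nat
    \<Rightarrow> (('u, 'f, 'r) struct \<Rightarrow> 'u list \<Rightarrow> bool) \<Rightarrow> bool" where
  "definable L C n P \<longleftrightarrow> (\<exists>\<phi>. lang_fm L \<phi> \<and> fv \<phi> \<subseteq> {..<n} \<and>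
     (\<forall>M\<in>C. \<forall>a\<in>tuples (univ M) n. sat M ((!) a) \<phi> \<longleftrightarrow> P M a))"

lemma definableE:
  assumes "definable L C n P"
  obtains \<phi> where "lang_fm L \<phi>" "fv \<phi> \<subseteq> {..<n}"
    "\<And>M a. M \<in> C \<Longrightarrow> a \<in> tuples (univ M) n \<Longrightarrow> sat M ((!) a) \<phi> \<longleftrightarrow> P M a"
  using assms unfolding definable_def by blast

lemma definableI:
  assumes "lang_fm L \<phi>" "fv \<phi> \<subseteq> {..<n}"
    "\<And>M a. M \<in> C \<Longrightarrow> a \<in> tuples (univ M) n \<Longrightarrow> sat M ((!) a) \<phi> \<longleftrightarrow> P M a"
  shows "definable L C n P"
  using assms unfolding definable_def by blast

lemma definable_cong:
  assumes "definable L C n P" "C' \<subseteq> C"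
    and "\<And>M a. M \<in> C' \<Longrightarrow> a \<in> tuples (univ M) n \<Longrightarrow> P M a \<longleftrightarrow> P' M a"
  shows "definable L C' n P'"
  using assms unfolding definable_def by blast

lemma definable_Not: "definable L C n P \<Longrightarrow> definable L C n (\<lambda>M a. \<not> P M a)"
  by (elim definableE, rule definableI[of _ "Neg _"]) auto

lemma definable_conj:
  assumes "definable L C n P" "definable L C n Q"
  shows "definable L C n (\<lambda>M a. P M a \<and> Q M a)"
proof -
  obtain \<phi> \<psi> where "lang_fm L \<phi>" "fv \<phi> \<subseteq> {..<n}" "lang_fm L \<psi>" "fv \<psi> \<subseteq> {..<n}"
    "\<And>M a. M \<in> C \<Longrightarrow> a \<in> tuples (univ M) n \<Longrightarrow> sat M ((!) a) \<phi> \<longleftrightarrow> P M a"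
    "\<And>M a. M \<in> C \<Longrightarrow> a \<in> tuples (univ M) n \<Longrightarrow> sat M ((!) a) \<psi> \<longleftrightarrow> Q M a"
    using assms unfolding definable_def by blast
  then show ?thesis by (intro definableI[of _ "Conj \<phi> \<psi>"]) auto
qed

lemma definable_True: "definable L C n (\<lambda>M a. True)"
proof -
  let ?\<phi> = "Exists 0 (Equal (Var 0) (Var 0))"
  show ?thesis by (rule definableI[of _ "Neg (Conj ?\<phi> (Neg ?\<phi>))"]) auto
qed

lemma definable_const: "definable L C n (\<lambda>M a. B)"
  using definable_True[of L C n] definable_Not[OF definable_True[of L C n]] by (cases B) auto

lemma definable_all_less:
  fixes k :: nat
  assumes "\<And>i. i < k \<Longrightarrow> definable L C n (P i)"
  shows "definable L C n (\<lambda>M a. \<forall>i<k. P i M a)"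
  using assms
proof (induction k)
  case 0
  then show ?case using definable_True by simp
next
  case (Suc k)
  then show ?case using definable_conj[of L C n "\<lambda>M a. \<forall>i<k. P i M a" "P k"]
    by (simp add: All_less_Suc conj_commute)
qed

lemma tuples_append: "a \<in> tuples U m \<Longrightarrow> b \<in> tuples U n \<Longrightarrow> a @ b \<in> tuples U (m + n)"
  by (auto simp: tuples_def)

lemma tuples_zero [simp]: "tuples U 0 = {[]}"
  by (auto simp: tuples_def)

lemma tuples_length: "a \<in> tuples U n \<Longrightarrow> length a = n"
  by (simp add: tuples_def)

lemma tuples_nth: "a \<in> tuples U n \<Longrightarrow> i < n \<Longrightarrow> a ! i \<in> U"
  by (auto simp: tuples_def)

lemma tuples_add:
  "a \<in> tuples U (m + n) \<longleftrightarrow> (\<exists>b\<in>tuples U m. \<exists>c\<in>tuples U n. a = b @ c)"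
proof
  assume a: "a \<in> tuples U (m + n)"
  then have "take m a \<in> tuples U m" "drop m a \<in> tuples U n"
    by (auto simp: tuples_def dest: in_set_takeD in_set_dropD)
  then show "\<exists>b\<in>tuples U m. \<exists>c\<in>tuples U n. a = b @ c" by (metis append_take_drop_id)
qed (auto intro: tuples_append)

lemma tuples_1: "a \<in> tuples U (Suc 0) \<longleftrightarrow> (\<exists>x\<in>U. a = [x])"
  by (auto simp: tuples_def length_Suc_conv)

lemma bex_tuples_Suc: "(\<exists>b\<in>tuples U (Suc m). Q b) \<longleftrightarrow> (\<exists>b\<in>tuples U m. \<exists>x\<in>U. Q (b @ [x]))"
  using tuples_add[of _ U m 1] by (fastforce simp: tuples_1)

lemma finite_tuples: "finite U \<Longrightarrow> finite (tuples U n)"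
  using finite_lists_length_eq[of U n] by (simp add: tuples_def)

lemma definable_ex_1:
  assumes "definable L C (Suc n) P"
  shows "definable L C n (\<lambda>M a. \<exists>x\<in>univ M. P M (a @ [x]))"
proof -
  obtain \<phi> where \<phi>: "lang_fm L \<phi>" "fv \<phi> \<subseteq> {..<Suc n}"
    "\<And>M a. M \<in> C \<Longrightarrow> a \<in> tuples (univ M) (Suc n) \<Longrightarrow> sat M ((!) a) \<phi> \<longleftrightarrow> P M a"
    using assms by (rule definableE) blast
  have "sat M (((!) a)(n := x)) \<phi> \<longleftrightarrow> P M (a @ [x])"
    if "M \<in> C" "a \<in> tuples (univ M) n" "x \<in> univ M" for M a x
  proof -
    have "sat M (((!) a)(n := x)) \<phi> = sat M ((!) (a @ [x])) \<phi>"
      by (rule sat_cong) (use \<phi>(2) that in \<open>force simp: nth_append tuples_def\<close>)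
    moreover have "a @ [x] \<in> tuples (univ M) (Suc n)" using that by (simp add: tuples_def)
    ultimately show ?thesis using \<phi>(3) that(1) by simp
  qed
  then show ?thesis using \<phi>(1,2) by (intro definableI[of _ "Exists n \<phi>"]) (auto simp: less_Suc_eq)
qed

lemma definable_ex:
  assumes "definable L C (n + m) P"
  shows "definable L C n (\<lambda>M a. \<exists>b\<in>tuples (univ M) m. P M (a @ b))"
  using assms
proof (induction m arbitrary: P)
  case (Suc m)
  have "definable L C n (\<lambda>M a. \<exists>b\<in>tuples (univ M) m. \<exists>x\<in>univ M. P M ((a @ b) @ [x]))"
    by (rule Suc.IH, rule definable_ex_1) (use Suc.prems in simp)
  then show ?case by (simp add: bex_tuples_Suc)
qed simp

text \<open>
  The maps on tuples that are composed of projections to coordinates, such as taking, dropping,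
  permuting and repeating blocks. Definability is invariant under substituting them.
\<close>

definition selection :: "nat \<Rightarrow> nat \<Rightarrow> ('a list \<Rightarrow> 'a list) \<Rightarrow> bool" where
  "selection m n s \<longleftrightarrow> (\<exists>\<sigma>. (\<forall>i<n. \<sigma> i < m) \<and>
     (\<forall>a. length a = m \<longrightarrow> s a = map (\<lambda>i. a ! \<sigma> i) [0..<n]))"

lemma selection_tuples: "selection m n s \<Longrightarrow> a \<in> tuples U m \<Longrightarrow> s a \<in> tuples U n"
  by (fastforce simp: selection_def tuples_def)

lemma definable_select:
  fixes L :: "('f, 'r) lang" and C :: "('u, 'f, 'r) struct set"
  assumes "definable L C n P" "selection m n s"
  shows "definable L C m (\<lambda>M a. P M (s a))"
proof -
  obtain \<phi> where \<phi>: "lang_fm L \<phi>" "fv \<phi> \<subseteq> {..<n}"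
    "\<And>M a. M \<in> C \<Longrightarrow> a \<in> tuples (univ M) n \<Longrightarrow> sat M ((!) a) \<phi> \<longleftrightarrow> P M a"
    using assms(1) by (rule definableE) blast
  obtain \<sigma> where \<sigma>: "\<And>i. i < n \<Longrightarrow> \<sigma> i < m"
    "\<And>a. length a = m \<Longrightarrow> s a = map (\<lambda>i. a ! \<sigma> i) [0..<n]"
    using assms(2) unfolding selection_def by blast
  obtain \<psi> where \<psi>: "lang_fm L \<psi>" "fv \<psi> \<subseteq> \<sigma> ` fv \<phi>"
    "\<And>(M :: ('u, 'f, 'r) struct) e. sat M e \<psi> \<longleftrightarrow> sat M (e \<circ> \<sigma>) \<phi>"
    using rename_fm_exists[OF \<phi>(1), where \<sigma> = \<sigma> and ?'u = 'u] by blast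
  show ?thesis
  proof (rule definableI[OF \<psi>(1)])
    show "fv \<psi> \<subseteq> {..<m}" using \<psi>(2) \<phi>(2) \<sigma>(1) by fastforce
    fix M a assume M: "M \<in> C" and a: "a \<in> tuples (univ M) m"
    have "sat M ((!) a \<circ> \<sigma>) \<phi> = sat M ((!) (s a)) \<phi>"
      by (rule sat_cong) (use \<phi>(2) \<sigma>(2)[of a] a in \<open>auto simp: tuples_def\<close>)
    then show "sat M ((!) a) \<psi> \<longleftrightarrow> P M (s a)"
      using \<psi>(3) \<phi>(3)[OF M selection_tuples[OF assms(2) a]] by simp
  qed
qed

lemma selection_slice: "k + n \<le> m \<Longrightarrow> selection m n (\<lambda>a. take n (drop k a))"
  unfolding selection_def
  by (rule exI[of _ "\<lambda>i. k + i"]) (auto intro!: nth_equalityI)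

lemma selection_take: "n \<le> m \<Longrightarrow> selection m n (take n)"
  using selection_slice[of 0 n m] by simp

lemma selection_drop: "k \<le> m \<Longrightarrow> selection m (m - k) (drop k)"
  unfolding selection_def
  by (rule exI[of _ "\<lambda>i. k + i"]) (auto intro!: nth_equalityI)

lemma selection_nth: "i < m \<Longrightarrow> selection m (Suc 0) (\<lambda>a. [a ! i])"
  unfolding selection_def by (rule exI[of _ "\<lambda>_. i"]) auto

lemma selection_append:
  assumes "selection m n s" "selection m k t" "l = n + k"
  shows "selection m l (\<lambda>a. s a @ t a)"
proof -
  obtain \<sigma> where \<sigma>: "\<forall>i<n. \<sigma> i < m" "\<forall>a. length a = m \<longrightarrow> s a = map (\<lambda>i. a ! \<sigma> i) [0..<n]"
    using assms(1) unfolding selection_def by blast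
  obtain \<tau> where \<tau>: "\<forall>i<k. \<tau> i < m" "\<forall>a. length a = m \<longrightarrow> t a = map (\<lambda>i. a ! \<tau> i) [0..<k]"
    using assms(2) unfolding selection_def by blast
  let ?\<rho> = "\<lambda>i. if i < n then \<sigma> i else \<tau> (i - n)"
  have "s a @ t a = map (\<lambda>i. a ! ?\<rho> i) [0..<n + k]" if "length a = m" for a
    by (rule nth_equalityI)
      (auto simp: \<sigma>(2)[rule_format, OF that] \<tau>(2)[rule_format, OF that] nth_append less_diff_conv2)
  then show ?thesis unfolding selection_def assms(3)
    by (intro exI[of _ ?\<rho>]) (use \<sigma>(1) \<tau>(1) in simp)
qed

lemma selection_concat:
  assumes "\<And>i. i < n \<Longrightarrow> selection m d (s i)"
  shows "selection m (n * d) (\<lambda>a. concat (map (\<lambda>i. s i a) [0..<n]))"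
  using assms
proof (induction n)
  case 0
  show ?case by (auto simp: selection_def)
next
  case (Suc n)
  show ?case using selection_append[OF Suc.IH Suc.prems, of n "Suc n * d"] Suc.prems
    by (simp add: add.commute)
qed

text \<open>Formulas in arbitrary distinct variables instead of an initial segment.\<close>

lemma holds_iff_sat:
  assumes "distinct vs" "length a = length vs" "fv \<phi> \<subseteq> set vs"
    and "\<And>i. i < length vs \<Longrightarrow> \<rho> (vs ! i) = i"
  shows "holds M \<phi> vs a \<longleftrightarrow> sat M (\<lambda>v. a ! \<rho> v) \<phi>"
  unfolding holds_def
proof (rule sat_cong)
  fix v assume "v \<in> fv \<phi>"
  then obtain i where "i < length vs" "v = vs ! i" using assms(3) by (metis in_set_conv_nth subsetD)
  then show "(case map_of (zip vs a) v of None \<Rightarrow> undefined | Some a \<Rightarrow> a) = a ! \<rho> v"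
    using assms(4) map_of_zip_nth[OF assms(2)[symmetric] assms(1)] assms(2) by simp
qed

lemma index_exists:
  assumes "distinct vs"
  obtains \<rho> :: "'a \<Rightarrow> nat" where "\<And>i. i < length vs \<Longrightarrow> \<rho> (vs ! i) = i"
    "\<And>v. v \<in> set vs \<Longrightarrow> \<rho> v < length vs"
proof
  let ?\<rho> = "\<lambda>v. THE i. i < length vs \<and> vs ! i = v"
  show 1: "?\<rho> (vs ! i) = i" if "i < length vs" for i
    by (rule the_equality) (use that assms in \<open>auto simp: nth_eq_iff_index_eq\<close>)
  show "?\<rho> v < length vs" if v: "v \<in> set vs" for v
  proof -
    obtain i where "i < length vs" "v = vs ! i" using v by (metis in_set_conv_nth)
    then show ?thesis using 1[of i] by simp
  qed
qed

lemma definable_holds: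
  fixes L :: "('f, 'r) lang" and C :: "('u, 'f, 'r) struct set"
  assumes "formula_in L \<phi> vs"
  shows "definable L C (length vs) (\<lambda>M. holds M \<phi> vs)"
proof -
  have vs: "distinct vs" "fv \<phi> \<subseteq> set vs" "lang_fm L \<phi>" using assms by (auto simp: formula_in_def)
  obtain \<rho> where \<rho>: "\<And>i. i < length vs \<Longrightarrow> \<rho> (vs ! i) = i"
    "\<And>v. v \<in> set vs \<Longrightarrow> \<rho> v < length vs" using index_exists[OF vs(1)] by blast
  obtain \<psi> where \<psi>: "lang_fm L \<psi>" "fv \<psi> \<subseteq> \<rho> ` fv \<phi>"
    "\<And>(M :: ('u, 'f, 'r) struct) e. sat M e \<psi> \<longleftrightarrow> sat M (e \<circ> \<rho>) \<phi>"
    using rename_fm_exists[OF vs(3), where \<sigma> = \<rho> and ?'u = 'u] by blast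
  show ?thesis
  proof (rule definableI[OF \<psi>(1)])
    show "fv \<psi> \<subseteq> {..<length vs}" using \<psi>(2) vs(2) \<rho>(2) by fastforce
    fix M :: "('u, 'f, 'r) struct" and a assume "a \<in> tuples (univ M) (length vs)"
    then show "sat M ((!) a) \<psi> \<longleftrightarrow> holds M \<phi> vs a"
      using \<psi>(3) holds_iff_sat[OF vs(1) _ vs(2) \<rho>(1), of a M] by (simp add: tuples_def comp_def)
  qed
qed

lemma definable_formula:
  fixes L :: "('f, 'r) lang" and C :: "('u, 'f, 'r) struct set"
  assumes "definable L C (length vs) P" "distinct vs"
  obtains \<phi> where "formula_in L \<phi> vs"
    "\<And>M a. M \<in> C \<Longrightarrow> a \<in> tuples (univ M) (length vs) \<Longrightarrow> holds M \<phi> vs a \<longleftrightarrow> P M a"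
proof -
  obtain \<phi> where \<phi>: "lang_fm L \<phi>" "fv \<phi> \<subseteq> {..<length vs}"
    "\<And>M a. M \<in> C \<Longrightarrow> a \<in> tuples (univ M) (length vs) \<Longrightarrow> sat M ((!) a) \<phi> \<longleftrightarrow> P M a"
    using assms(1) by (rule definableE) blast
  obtain \<rho> where \<rho>: "\<And>i. i < length vs \<Longrightarrow> \<rho> (vs ! i) = i" using index_exists[OF assms(2)] by blast
  obtain \<psi> where \<psi>: "lang_fm L \<psi>" "fv \<psi> \<subseteq> (!) vs ` fv \<phi>"
    "\<And>(M :: ('u, 'f, 'r) struct) e. sat M e \<psi> \<longleftrightarrow> sat M (e \<circ> (!) vs) \<phi>"
    using rename_fm_exists[OF \<phi>(1), where \<sigma> = "(!) vs" and ?'u = 'u] by blast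
  have fv: "fv \<psi> \<subseteq> set vs" using \<psi>(2) \<phi>(2) by fastforce
  show ?thesis
  proof (rule that)
    show "formula_in L \<psi> vs" using fv \<psi>(1) assms(2) by (simp add: formula_in_def)
    fix M a assume M: "M \<in> C" and a: "a \<in> tuples (univ M) (length vs)"
    have "holds M \<psi> vs a = sat M (\<lambda>v. a ! \<rho> v) \<psi>"
      by (rule holds_iff_sat[OF assms(2) _ fv \<rho>]) (use a in \<open>simp_all add: tuples_def\<close>)
    also have "\<dots> = sat M ((\<lambda>v. a ! \<rho> v) \<circ> (!) vs) \<phi>" by (rule \<psi>(3))
    also have "\<dots> = sat M ((!) a) \<phi>" by (rule sat_cong) (use \<phi>(2) \<rho> in auto)
    finally show "holds M \<psi> vs a \<longleftrightarrow> P M a" using \<phi>(3)[OF M a] by simp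
  qed
qed

section \<open>Definably asymptotic functions\<close>

text \<open>
  The colouring \<open>q\<close> of \<open>n\<close>-tuples reduces the asymptotic behaviour of \<open>f\<close> along the filter to a
  function \<open>h i\<close> of the structure for each colour \<open>i\<close>. A colouring encodes a finite partition, but
  unlike a partition it may have empty cells, so that colourings can be paired.
\<close>

definition asymptotic_colouring ::
  "('u, 'f, 'r) struct filter \<Rightarrow> ('u, 'f, 'r) struct set \<Rightarrow> nat
    \<Rightarrow> (('u, 'f, 'r) struct \<Rightarrow> 'u list \<Rightarrow> real) \<Rightarrow> (('u, 'f, 'r) struct \<Rightarrow> 'u list \<Rightarrow> 'c)
    \<Rightarrow> 'c set \<Rightarrow> ('c \<Rightarrow> ('u, 'f, 'r) struct \<Rightarrow> real) \<Rightarrow> bool" where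
  "asymptotic_colouring Fil C n f q K h \<longleftrightarrow>
     finite K \<and>
     (\<forall>M\<in>C. \<forall>a\<in>tuples (univ M) n. q M a \<in> K) \<and>
     (\<forall>i\<in>K. \<forall>M\<in>C. 0 \<le> h i M) \<and>
     (\<forall>\<epsilon>>0. \<forall>\<^sub>F M in Fil. M \<in> C \<longrightarrow>
        (\<forall>a\<in>tuples (univ M) n. \<bar>f M a - h (q M a) M\<bar> \<le> \<epsilon> * h (q M a) M))"

definition definably_asymptotic ::
  "('f, 'r) lang \<Rightarrow> ('u, 'f, 'r) struct filter \<Rightarrow> ('u, 'f, 'r) struct set \<Rightarrow> nat
    \<Rightarrow> (('u, 'f, 'r) struct \<Rightarrow> 'u list \<Rightarrow> real) \<Rightarrow> bool" where
  "definably_asymptotic L Fil C n f \<longleftrightarrow> (\<exists>(q :: _ \<Rightarrow> _ \<Rightarrow> nat) K h. asymptotic_colouring Fil C n f q K h \<and>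
     (\<forall>i\<in>K. definable L C n (\<lambda>M a. q M a = i)))"

text \<open>
  Colours may come from any type; they are numbered afterwards.
\<close>

lemma definably_asymptoticI:
  fixes q :: "('u, 'f, 'r) struct \<Rightarrow> 'u list \<Rightarrow> 'c"
  assumes col: "asymptotic_colouring Fil C n f q K h"
    and def: "\<And>c. c \<in> K \<Longrightarrow> definable L C n (\<lambda>M a. q M a = c)"
  shows "definably_asymptotic L Fil C n f"
proof -
  obtain g :: "'c \<Rightarrow> nat" where g: "inj_on g K"
    using col finite_imp_inj_to_nat_seg unfolding asymptotic_colouring_def by metis
  let ?q = "\<lambda>M a. g (q M a)" and ?h = "\<lambda>i. h (inv_into K g i)"
  have "asymptotic_colouring Fil C n f ?q (g ` K) ?h"
  proof -
    have "q M a \<in> K" if "M \<in> C" "a \<in> tuples (univ M) n" for M a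
      using col that unfolding asymptotic_colouring_def by blast
    then show ?thesis using col g unfolding asymptotic_colouring_def by (simp cong: ball_cong)
  qed
  moreover have "definable L C n (\<lambda>M a. ?q M a = i)" if "i \<in> g ` K" for i
  proof -
    obtain c where c: "c \<in> K" "i = g c" using \<open>i \<in> g ` K\<close> by blast
    show ?thesis
      by (rule definable_cong[OF def[OF c(1)] order_refl])
        (use col g c in \<open>auto simp: asymptotic_colouring_def inj_on_eq_iff\<close>)
  qed
  ultimately show ?thesis unfolding definably_asymptotic_def by blast
qed

lemma asymptotic_colouringD:
  assumes "asymptotic_colouring Fil C n f q K h"
  shows "finite K"
    "\<And>M a. M \<in> C \<Longrightarrow> a \<in> tuples (univ M) n \<Longrightarrow> q M a \<in> K"
    "\<And>i M. i \<in> K \<Longrightarrow> M \<in> C \<Longrightarrow> 0 \<le> h i M"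
    "\<And>\<epsilon>. \<epsilon> > 0 \<Longrightarrow> \<forall>\<^sub>F M in Fil. M \<in> C \<longrightarrow>
        (\<forall>a\<in>tuples (univ M) n. \<bar>f M a - h (q M a) M\<bar> \<le> \<epsilon> * h (q M a) M)"
  using assms unfolding asymptotic_colouring_def by blast+

lemma definably_asymptotic_cong:
  assumes "definably_asymptotic L Fil C n f"
    and "\<And>M a. M \<in> C \<Longrightarrow> a \<in> tuples (univ M) n \<Longrightarrow> f M a = g M a"
  shows "definably_asymptotic L Fil C n g"
proof -
  obtain q :: "_ \<Rightarrow> _ \<Rightarrow> nat" and K h where col: "asymptotic_colouring Fil C n f q K h"
    and def: "\<And>i. i \<in> K \<Longrightarrow> definable L C n (\<lambda>M a. q M a = i)"
    using assms(1) unfolding definably_asymptotic_def by blast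
  have "asymptotic_colouring Fil C n g q K h"
    using col assms(2) unfolding asymptotic_colouring_def by (simp cong: ball_cong imp_cong)
  then show ?thesis using def by (rule definably_asymptoticI)
qed

lemma definably_asymptotic_add:
  assumes "definably_asymptotic L Fil C n f" "definably_asymptotic L Fil C n g"
  shows "definably_asymptotic L Fil C n (\<lambda>M a. f M a + g M a)"
proof -
  obtain q :: "_ \<Rightarrow> _ \<Rightarrow> nat" and K h where
    q_col: "asymptotic_colouring Fil C n f q K h"
    and q_def: "\<And>i. i \<in> K \<Longrightarrow> definable L C n (\<lambda>M a. q M a = i)"
    using assms(1) unfolding definably_asymptotic_def by blast
  note q = asymptotic_colouringD[OF q_col] q_def
  obtain r :: "_ \<Rightarrow> _ \<Rightarrow> nat" and J l where
    r_col: "asymptotic_colouring Fil C n g r J l"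
    and r_def: "\<And>i. i \<in> J \<Longrightarrow> definable L C n (\<lambda>M a. r M a = i)"
    using assms(2) unfolding definably_asymptotic_def by blast
  note r = asymptotic_colouringD[OF r_col] r_def
  show ?thesis
  proof (rule definably_asymptoticI)
    show "asymptotic_colouring Fil C n (\<lambda>M a. f M a + g M a) (\<lambda>M a. (q M a, r M a)) (K \<times> J)
      (\<lambda>(i, j) M. h i M + l j M)"
      unfolding asymptotic_colouring_def
    proof (intro conjI allI impI)
      fix \<epsilon> :: real assume "\<epsilon> > 0"
      show "\<forall>\<^sub>F M in Fil. M \<in> C \<longrightarrow> (\<forall>a\<in>tuples (univ M) n.
        \<bar>f M a + g M a - (case (q M a, r M a) of (i, j) \<Rightarrow> \<lambda>M. h i M + l j M) M\<bar>
          \<le> \<epsilon> * (case (q M a, r M a) of (i, j) \<Rightarrow> \<lambda>M. h i M + l j M) M)"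
        using q(4)[OF \<open>\<epsilon> > 0\<close>] r(4)[OF \<open>\<epsilon> > 0\<close>]
      proof eventually_elim
        case (elim M)
        show ?case
        proof (intro impI ballI)
          fix a assume "M \<in> C" "a \<in> tuples (univ M) n"
          then have "\<bar>f M a - h (q M a) M\<bar> \<le> \<epsilon> * h (q M a) M"
            "\<bar>g M a - l (r M a) M\<bar> \<le> \<epsilon> * l (r M a) M" using elim by blast+
          then show "\<bar>f M a + g M a - (case (q M a, r M a) of (i, j) \<Rightarrow> \<lambda>M. h i M + l j M) M\<bar>
              \<le> \<epsilon> * (case (q M a, r M a) of (i, j) \<Rightarrow> \<lambda>M. h i M + l j M) M"
            unfolding prod.case distrib_left by linarith
        qed
      qed
    qed (use q r in \<open>auto intro: add_nonneg_nonneg\<close>)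
    show "definable L C n (\<lambda>M a. (q M a, r M a) = c)" if "c \<in> K \<times> J" for c
      using that definable_conj[OF q(5)[of "fst c"] r(5)[of "snd c"]]
      by (cases c) (auto simp: conj_commute)
  qed
qed

lemma definably_asymptotic_of_bool:
  assumes "definable L C n P"
  shows "definably_asymptotic L Fil C n (\<lambda>M a. of_bool (P M a))"
proof (rule definably_asymptoticI)
  show "asymptotic_colouring Fil C n (\<lambda>M a. of_bool (P M a)) P UNIV (\<lambda>B M. of_bool B)"
    unfolding asymptotic_colouring_def by auto
  show "definable L C n (\<lambda>M a. P M a = B)" for B
    using assms definable_Not[OF assms] by (cases B) auto
qed

lemma definably_asymptotic_scale:
  assumes "definably_asymptotic L Fil C n f" and c: "\<And>M. M \<in> C \<Longrightarrow> 0 \<le> c M"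
  shows "definably_asymptotic L Fil C n (\<lambda>M a. c M * f M a)"
proof -
  obtain q :: "_ \<Rightarrow> _ \<Rightarrow> nat" and K h where
    q_col: "asymptotic_colouring Fil C n f q K h"
    and q_def: "\<And>i. i \<in> K \<Longrightarrow> definable L C n (\<lambda>M a. q M a = i)"
    using assms(1) unfolding definably_asymptotic_def by blast
  note q = asymptotic_colouringD[OF q_col] q_def
  show ?thesis
  proof (rule definably_asymptoticI[OF _ q(5)])
    show "asymptotic_colouring Fil C n (\<lambda>M a. c M * f M a) q K (\<lambda>i M. c M * h i M)"
      unfolding asymptotic_colouring_def
    proof (intro conjI allI impI)
      fix \<epsilon> :: real assume "\<epsilon> > 0"
      show "\<forall>\<^sub>F M in Fil. M \<in> C \<longrightarrow> (\<forall>a\<in>tuples (univ M) n.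
        \<bar>c M * f M a - c M * h (q M a) M\<bar> \<le> \<epsilon> * (c M * h (q M a) M))"
        using q(4)[OF \<open>\<epsilon> > 0\<close>]
      proof eventually_elim
        case (elim M)
        show ?case
        proof (intro impI ballI)
          fix a assume "M \<in> C" "a \<in> tuples (univ M) n"
          then have "c M * \<bar>f M a - h (q M a) M\<bar> \<le> c M * (\<epsilon> * h (q M a) M)"
            using elim c by (intro mult_left_mono) blast+
          then show "\<bar>c M * f M a - c M * h (q M a) M\<bar> \<le> \<epsilon> * (c M * h (q M a) M)"
            using c[OF \<open>M \<in> C\<close>] by (simp add: abs_mult mult.left_commute flip: right_diff_distrib)
        qed
      qed
    qed (use q c in auto)
  qed
qed

lemma definably_asymptotic_sum:
  assumes "finite I" "\<And>i. i \<in> I \<Longrightarrow> definably_asymptotic L Fil C n (f i)"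
  shows "definably_asymptotic L Fil C n (\<lambda>M a. \<Sum>i\<in>I. f i M a)"
  using assms
proof (induction I)
  case empty
  show ?case using definably_asymptotic_of_bool[OF definable_const[of L C n False]] by simp
next
  case (insert i I)
  then show ?case using definably_asymptotic_add[of L Fil C n "f i" "\<lambda>M a. \<Sum>i\<in>I. f i M a"] by simp
qed

text \<open>
  If \<open>g\<close> is within \<open>\<delta> * h\<close> of \<open>h\<close> and \<open>f\<close> within \<open>\<delta> * g\<close> of \<open>g\<close>, where \<open>\<delta> \<le> 1\<close>, then \<open>g \<le> 2 * h\<close>
  and \<open>f\<close> is within \<open>3 * \<delta> * h\<close> of \<open>h\<close>.
\<close>

lemma definably_asymptotic_trans:
  assumes "definably_asymptotic L Fil C n g"
    and close: "\<And>\<epsilon>. \<epsilon> > 0 \<Longrightarrow> \<forall>\<^sub>F M in Fil. M \<in> C \<longrightarrow>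
      (\<forall>a\<in>tuples (univ M) n. \<bar>f M a - g M a\<bar> \<le> \<epsilon> * g M a)"
  shows "definably_asymptotic L Fil C n f"
proof -
  obtain q :: "_ \<Rightarrow> _ \<Rightarrow> nat" and K h where
    q_col: "asymptotic_colouring Fil C n g q K h"
    and q_def: "\<And>i. i \<in> K \<Longrightarrow> definable L C n (\<lambda>M a. q M a = i)"
    using assms(1) unfolding definably_asymptotic_def by blast
  note q = asymptotic_colouringD[OF q_col] q_def
  show ?thesis
  proof (rule definably_asymptoticI[OF _ q(5)])
    show "asymptotic_colouring Fil C n f q K h"
      unfolding asymptotic_colouring_def
    proof (intro conjI allI impI)
      fix \<epsilon> :: real assume "\<epsilon> > 0"
      define \<delta> where "\<delta> = min 1 (\<epsilon> / 3)"
      have \<delta>: "\<delta> > 0" "\<delta> \<le> 1" "3 * \<delta> \<le> \<epsilon>" using \<open>\<epsilon> > 0\<close> by (auto simp: \<delta>_def)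
      show "\<forall>\<^sub>F M in Fil. M \<in> C \<longrightarrow> (\<forall>a\<in>tuples (univ M) n.
        \<bar>f M a - h (q M a) M\<bar> \<le> \<epsilon> * h (q M a) M)"
        using q(4)[OF \<delta>(1)] close[OF \<delta>(1)]
      proof eventually_elim
        case (elim M)
        show ?case
        proof (intro impI ballI)
          fix a assume a: "M \<in> C" "a \<in> tuples (univ M) n"
          define H where "H = h (q M a) M"
          have H: "0 \<le> H" using q a by (simp add: H_def)
          have 1: "\<bar>g M a - H\<bar> \<le> \<delta> * H" and 2: "\<bar>f M a - g M a\<bar> \<le> \<delta> * g M a"
            using elim a unfolding H_def by blast+
          have "\<delta> * H \<le> H" using \<delta> H by (simp add: mult_left_le_one_le)
          then have "g M a \<le> 2 * H" using 1 by linarith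
          then have "\<delta> * g M a \<le> \<delta> * (2 * H)" using \<delta>(1) by (intro mult_left_mono) auto
          then have "\<bar>f M a - H\<bar> \<le> (3 * \<delta>) * H" using 1 2 by linarith
          also have "\<dots> \<le> \<epsilon> * H" using \<delta>(3) H by (rule mult_right_mono)
          finally show "\<bar>f M a - h (q M a) M\<bar> \<le> \<epsilon> * h (q M a) M" by (simp add: H_def)
        qed
      qed
    qed (use q in auto)
  qed
qed

text \<open>
  The case \<open>h = 0\<close> is consistent with \<open>inverse 0 = 0\<close>, because a relative error bound then forces
  the function to vanish as well.
\<close>

lemma definably_asymptotic_inverse:
  assumes "definably_asymptotic L Fil C n f"
  shows "definably_asymptotic L Fil C n (\<lambda>M a. inverse (f M a))"
proof -
  obtain q :: "_ \<Rightarrow> _ \<Rightarrow> nat" and K h where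
    q_col: "asymptotic_colouring Fil C n f q K h"
    and q_def: "\<And>i. i \<in> K \<Longrightarrow> definable L C n (\<lambda>M a. q M a = i)"
    using assms(1) unfolding definably_asymptotic_def by blast
  note q = asymptotic_colouringD[OF q_col] q_def
  have inv: "\<bar>inverse x - inverse H\<bar> \<le> \<epsilon> * inverse H"
    if x: "\<bar>x - H\<bar> \<le> \<delta> * H" and H: "0 \<le> H" and \<delta>: "\<delta> \<le> 1 / 2" "2 * \<delta> \<le> \<epsilon>" for x H \<delta> \<epsilon> :: real
  proof (cases "H = 0")
    case False
    then have "H > 0" using H by simp
    have "\<delta> * H \<le> 1 / 2 * H" using \<delta>(1) H by (rule mult_right_mono)
    then have "H / 2 \<le> x" using x by linarith
    then have "x > 0" using \<open>H > 0\<close> by linarith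
    have "\<bar>x - H\<bar> \<le> (\<epsilon> / 2) * H" using x mult_right_mono[of \<delta> "\<epsilon> / 2" H] \<delta>(2) H by linarith
    also have "\<dots> \<le> \<epsilon> * x"
      using \<open>H / 2 \<le> x\<close> mult_left_mono[of "H / 2" x \<epsilon>] x \<delta>(2) \<open>H > 0\<close>
      by (smt (verit) mult_less_0_iff times_divide_eq_left times_divide_eq_right)
    finally have "\<bar>H - x\<bar> / (x * H) \<le> \<epsilon> * x / (x * H)"
      using \<open>x > 0\<close> \<open>H > 0\<close> by (intro divide_right_mono) (auto simp: abs_minus_commute)
    moreover have "\<bar>inverse x - inverse H\<bar> = \<bar>H - x\<bar> / (x * H)"
      using \<open>x > 0\<close> \<open>H > 0\<close> by (simp add: inverse_eq_divide diff_frac_eq abs_mult)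
    moreover have "\<epsilon> * x / (x * H) = \<epsilon> * inverse H"
      using \<open>x > 0\<close> by (simp add: inverse_eq_divide)
    ultimately show ?thesis by simp
  qed (use x in simp)
  show ?thesis
  proof (rule definably_asymptoticI[OF _ q(5)])
    show "asymptotic_colouring Fil C n (\<lambda>M a. inverse (f M a)) q K (\<lambda>i M. inverse (h i M))"
      unfolding asymptotic_colouring_def
    proof (intro conjI allI impI)
      fix \<epsilon> :: real assume "\<epsilon> > 0"
      \<comment> \<open>With \<open>\<delta> \<le> 1 / 2\<close> the function stays above half of \<open>h\<close>.\<close>
      define \<delta> where "\<delta> = min (1 / 2) (\<epsilon> / 2)"
      have \<delta>: "\<delta> > 0" "\<delta> \<le> 1 / 2" "2 * \<delta> \<le> \<epsilon>" using \<open>\<epsilon> > 0\<close> by (auto simp: \<delta>_def)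
      show "\<forall>\<^sub>F M in Fil. M \<in> C \<longrightarrow> (\<forall>a\<in>tuples (univ M) n.
        \<bar>inverse (f M a) - inverse (h (q M a) M)\<bar> \<le> \<epsilon> * inverse (h (q M a) M))"
        using q(4)[OF \<delta>(1)] by eventually_elim (use inv \<delta> q in blast)
    qed (use q in auto)
  qed
qed

section \<open>Counting solutions\<close>

text \<open>
  The defining condition of the class, freed from formulas and partitions: \<open>m\<close> is the number of
  variables that are counted, and any number \<open>n\<close> of parameters is allowed.
\<close>

definition counts_asymptotic ::
  "('f, 'r) lang \<Rightarrow> ('u, 'f, 'r) struct filter \<Rightarrow> ('u, 'f, 'r) struct set \<Rightarrow> nat \<Rightarrow> bool" where
  "counts_asymptotic L Fil C m \<longleftrightarrow> (\<forall>n P. definable L C (m + n) P \<longrightarrow>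
     definably_asymptotic L Fil C n (\<lambda>M b. real (card {a \<in> tuples (univ M) m. P M (a @ b)})))"

text \<open>
  Splitting the domain of summation by the colours \<open>i\<close> of the summand, the sum is compared with
  the sum over \<open>i\<close> of \<open>h i M\<close> times the number of summands of colour \<open>i\<close>, which is definably
  asymptotic by the hypothesis on counting. The relative error of each summand is at most \<open>\<epsilon>\<close>, and
  since all approximations are nonnegative, so is that of the sum.
\<close>

lemma definably_asymptotic_sum_definable:
  assumes fin: "\<And>M. M \<in> C \<Longrightarrow> finite (univ M)"
    and counts: "counts_asymptotic L Fil C m"
    and f: "definably_asymptotic L Fil C (m + n) f" and X: "definable L C (m + n) X"
  shows "definably_asymptotic L Fil C n (\<lambda>M b. \<Sum>a | a \<in> tuples (univ M) m \<and> X M (a @ b). f M (a @ b))"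
proof -
  obtain q :: "_ \<Rightarrow> _ \<Rightarrow> nat" and K h where
    q_col: "asymptotic_colouring Fil C (m + n) f q K h"
    and q_def: "\<And>i. i \<in> K \<Longrightarrow> definable L C (m + n) (\<lambda>M a. q M a = i)"
    using f unfolding definably_asymptotic_def by blast
  note q = asymptotic_colouringD[OF q_col] q_def
  let ?X = "\<lambda>M b. {a \<in> tuples (univ M) m. X M (a @ b)}"
  let ?Y = "\<lambda>i M b. {a \<in> tuples (univ M) m. X M (a @ b) \<and> q M (a @ b) = i}"
  let ?g = "\<lambda>M b. \<Sum>i\<in>K. h i M * real (card (?Y i M b))"
  have g: "?g M b = (\<Sum>a\<in>?X M b. h (q M (a @ b)) M)"
    if M: "M \<in> C" and b: "b \<in> tuples (univ M) n" for M b
  proof -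
    have "(\<Sum>a\<in>?X M b. h (q M (a @ b)) M) = (\<Sum>i\<in>K. \<Sum>a\<in>{a \<in> ?X M b. q M (a @ b) = i}. h (q M (a @ b)) M)"
      using sum.group[OF _ q(1), of "?X M b" "\<lambda>a. q M (a @ b)" "\<lambda>a. h (q M (a @ b)) M"]
        finite_tuples[OF fin[OF M], of m] q(2)[OF M] tuples_append[OF _ b]
      by (simp add: image_subset_iff)
    also have "\<dots> = (\<Sum>i\<in>K. \<Sum>a\<in>?Y i M b. h i M)"
      by (intro sum.cong refl) auto
    also have "\<dots> = ?g M b" by (simp add: mult.commute)
    finally show ?thesis by simp
  qed
  show ?thesis
  proof (rule definably_asymptotic_trans)
    show "definably_asymptotic L Fil C n ?g"
    proof (intro definably_asymptotic_sum[OF q(1)] definably_asymptotic_scale q(3))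
      fix i assume "i \<in> K"
      then have "definable L C (m + n) (\<lambda>M a. X M a \<and> q M a = i)"
        by (intro definable_conj X q(5))
      then show "definably_asymptotic L Fil C n (\<lambda>M b. real (card (?Y i M b)))"
        using counts unfolding counts_asymptotic_def by blast
    qed
    fix \<epsilon> :: real assume "\<epsilon> > 0"
    show "\<forall>\<^sub>F M in Fil. M \<in> C \<longrightarrow> (\<forall>b\<in>tuples (univ M) n.
       \<bar>(\<Sum>a\<in>?X M b. f M (a @ b)) - ?g M b\<bar> \<le> \<epsilon> * ?g M b)"
      using q(4)[OF \<open>\<epsilon> > 0\<close>]
    proof eventually_elim
      case (elim M)
      show ?case
      proof (intro impI ballI)
        fix b assume M: "M \<in> C" and b: "b \<in> tuples (univ M) n"
        have "\<bar>(\<Sum>a\<in>?X M b. f M (a @ b)) - ?g M b\<bar>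
            = \<bar>\<Sum>a\<in>?X M b. f M (a @ b) - h (q M (a @ b)) M\<bar>"
          unfolding g[OF M b] by (simp add: sum_subtractf)
        also have "\<dots> \<le> (\<Sum>a\<in>?X M b. \<bar>f M (a @ b) - h (q M (a @ b)) M\<bar>)" by (rule sum_abs)
        also have "\<dots> \<le> (\<Sum>a\<in>?X M b. \<epsilon> * h (q M (a @ b)) M)"
          using elim M tuples_append[OF _ b] by (intro sum_mono) auto
        also have "\<dots> = \<epsilon> * ?g M b" unfolding g[OF M b] by (simp add: sum_distrib_left)
        finally show "\<bar>(\<Sum>a\<in>?X M b. f M (a @ b)) - ?g M b\<bar> \<le> \<epsilon> * ?g M b" .
      qed
    qed
  qed
qed

lemma counts_asymptotic_0: "counts_asymptotic L Fil C 0"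
  unfolding counts_asymptotic_def
proof (intro allI impI)
  fix n P assume "definable L C (0 + n) P"
  then have "definably_asymptotic L Fil C n (\<lambda>M b. of_bool (P M b))" by (intro definably_asymptotic_of_bool) simp
  then show "definably_asymptotic L Fil C n (\<lambda>M b. real (card {a \<in> tuples (univ M) 0. P M (a @ b)}))"
    by (rule definably_asymptotic_cong) (auto simp: Collect_conv_if)
qed

lemma card_tuples_add:
  assumes "finite U"
  shows "card {a \<in> tuples U (k + m). Q a}
    = (\<Sum>a\<in>tuples U m. card {x \<in> tuples U k. Q (x @ a)})"
proof -
  let ?S = "SIGMA a : tuples U m. {x \<in> tuples U k. Q (x @ a)}"
  have "bij_betw (\<lambda>(a, x). x @ a) ?S {a \<in> tuples U (k + m). Q a}"
    unfolding bij_betw_def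
  proof
    show "inj_on (\<lambda>(a, x). x @ a) ?S" by (auto simp: inj_on_def tuples_def)
    show "(\<lambda>(a, x). x @ a) ` ?S = {a \<in> tuples U (k + m). Q a}"
      by (force simp: tuples_add image_iff)
  qed
  then have "card {a \<in> tuples U (k + m). Q a} = card ?S" by (simp add: bij_betw_same_card)
  also have "\<dots> = (\<Sum>a\<in>tuples U m. card {x \<in> tuples U k. Q (x @ a)})"
    using finite_tuples[OF assms] by (intro card_SigmaI) auto
  finally show ?thesis .
qed

text \<open>
  The number of solutions in \<open>k + m\<close> variables is a sum of numbers of solutions in \<open>k\<close> variables,
  where the remaining \<open>m\<close> variables have become parameters.
\<close>

lemma counts_asymptotic_add:
  assumes fin: "\<And>M. M \<in> C \<Longrightarrow> finite (univ M)"
    and counts: "counts_asymptotic L Fil C k" "counts_asymptotic L Fil C m"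
  shows "counts_asymptotic L Fil C (k + m)"
  unfolding counts_asymptotic_def
proof (intro allI impI)
  fix n P assume P: "definable L C (k + m + n) P"
  then have "definably_asymptotic L Fil C (m + n) (\<lambda>M b. real (card {x \<in> tuples (univ M) k. P M (x @ b)}))"
    using counts(1) unfolding counts_asymptotic_def by (simp add: add.assoc)
  from definably_asymptotic_sum_definable[OF fin counts(2) this definable_True]
  have "definably_asymptotic L Fil C n (\<lambda>M b. \<Sum>a\<in>tuples (univ M) m.
      real (card {x \<in> tuples (univ M) k. P M (x @ a @ b)}))" by simp
  then show "definably_asymptotic L Fil C n (\<lambda>M b. real (card {a \<in> tuples (univ M) (k + m). P M (a @ b)}))"
    by (rule definably_asymptotic_cong) (simp add: card_tuples_add[OF fin])
qed

lemma counts_asymptotic_all: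
  assumes fin: "\<And>M. M \<in> C \<Longrightarrow> finite (univ M)" and "counts_asymptotic L Fil C 1"
  shows "counts_asymptotic L Fil C m"
proof (induction m)
  case (Suc m)
  show ?case using counts_asymptotic_add[OF fin assms(2) Suc.IH] by simp
qed (rule counts_asymptotic_0)

section \<open>Asymptotic and exact classes along a filter\<close>

definition asymptotic_along ::
  "('u, 'f, 'r) struct filter \<Rightarrow> (('u, 'f, 'r) struct \<times> 'u list) set \<Rightarrow> ('f, 'r) fm
    \<Rightarrow> nat list \<Rightarrow> nat list \<Rightarrow> (('u, 'f, 'r) struct \<Rightarrow> real) \<Rightarrow> bool" where
  "asymptotic_along Fil \<pi> \<phi> xs ys h \<longleftrightarrow> (\<forall>\<epsilon>>0. \<forall>\<^sub>F M in Fil. \<forall>b. (M, b) \<in> \<pi> \<longrightarrow>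
     \<bar>real (card (solutions M \<phi> xs ys b)) - h M\<bar> \<le> \<epsilon> * h M)"

abbreviation size_filter :: "('u, 'f, 'r) struct filter" where
  "size_filter \<equiv> filtercomap (\<lambda>M. card (univ M)) at_top"

lemma asymptotic_on_iff:
  "asymptotic_on \<pi> \<phi> xs ys h \<longleftrightarrow> asymptotic_along size_filter \<pi> \<phi> xs ys h"
  unfolding asymptotic_on_def asymptotic_along_def eventually_filtercomap_at_top_dense
  by (auto 4 4)

text \<open>
  Along \<open>top\<close> the bound holds for every structure and every \<open>\<epsilon>\<close>; letting \<open>\<epsilon>\<close> tend to \<open>0\<close>
  gives equality.
\<close>

lemma exact_on_iff: "exact_on \<pi> \<phi> xs ys h \<longleftrightarrow> asymptotic_along top \<pi> \<phi> xs ys h"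
proof
  assume l: "exact_on \<pi> \<phi> xs ys h"
  show "asymptotic_along top \<pi> \<phi> xs ys h"
    unfolding asymptotic_along_def eventually_top
  proof (intro allI impI)
    fix \<epsilon> :: real and M b assume "0 < \<epsilon>" "(M, b) \<in> \<pi>"
    then have "real (card (solutions M \<phi> xs ys b)) = h M" using l by (auto simp: exact_on_def)
    then show "\<bar>real (card (solutions M \<phi> xs ys b)) - h M\<bar> \<le> \<epsilon> * h M"
      using \<open>0 < \<epsilon>\<close> by (metis abs_zero diff_self less_imp_le mult_nonneg_nonneg of_nat_0_le_iff)
  qed
next
  assume r: "asymptotic_along top \<pi> \<phi> xs ys h"
  show "exact_on \<pi> \<phi> xs ys h"
    unfolding exact_on_def
  proof clarify
    fix M b assume \<pi>: "(M, b) \<in> \<pi>"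
    have *: "\<bar>real (card (solutions M \<phi> xs ys b)) - h M\<bar> \<le> \<epsilon> * h M" if "\<epsilon> > 0" for \<epsilon>
      using r \<pi> that unfolding asymptotic_along_def eventually_top by blast
    have "\<bar>real (card (solutions M \<phi> xs ys b)) - h M\<bar> \<le> 0 + e" if "e > 0" for e
    proof (cases "h M > 0")
      case True
      then show ?thesis using *[of "e / h M"] that by simp
    next
      case False
      then show ?thesis using *[of 1] that by linarith
    qed
    then show "real (card (solutions M \<phi> xs ys b)) = h M"
      using field_le_epsilon[of "\<bar>real (card (solutions M \<phi> xs ys b)) - h M\<bar>" 0] by simp
  qed
qed

text \<open>
  The common form of the four conditions on a partitioned formula. The predicate \<open>D\<close> on
  partitions is definability, or trivial for the weak notions.
\<close>

definition class_condition ::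
  "((('u, 'f, 'r) struct \<times> 'u list) set set \<Rightarrow> bool) \<Rightarrow> ('u, 'f, 'r) struct filter
    \<Rightarrow> (('u, 'f, 'r) struct \<Rightarrow> real) set \<Rightarrow> ('u, 'f, 'r) struct set
    \<Rightarrow> ('f, 'r) fm \<Rightarrow> nat list \<Rightarrow> nat list \<Rightarrow> bool" where
  "class_condition D Fil R C \<phi> xs ys \<longleftrightarrow>
     (\<exists>P h. finite P \<and> partition_on (class_pairs C ys) P \<and> D P \<and>
        (\<forall>\<pi>\<in>P. h \<pi> \<in> R \<and> asymptotic_along Fil \<pi> \<phi> xs ys (h \<pi>)))"

text \<open>
  The truth value distinguishes the asymptotic notions from the exact ones.
\<close>

definition condition_filter :: "bool \<Rightarrow> ('u, 'f, 'r) struct filter" where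
  "condition_filter asymptotic = (if asymptotic then size_filter else top)"

lemma mac_condition_iff:
  "mac_condition L R C \<phi> xs ys \<longleftrightarrow>
     class_condition (definable_partition L C ys) (condition_filter True) R C \<phi> xs ys"
  unfolding mac_condition_def class_condition_def asymptotic_on_iff condition_filter_def by simp

lemma mec_condition_iff:
  "mec_condition L R C \<phi> xs ys \<longleftrightarrow>
     class_condition (definable_partition L C ys) (condition_filter False) R C \<phi> xs ys"
  unfolding mec_condition_def class_condition_def exact_on_iff condition_filter_def by simp

lemma weak_mac_condition_iff:
  "weak_mac_condition R C \<phi> xs ys \<longleftrightarrow>
     class_condition (\<lambda>_. True) (condition_filter True) R C \<phi> xs ys"
  unfolding weak_mac_condition_def class_condition_def asymptotic_on_iff condition_filter_def
  by simp

lemma weak_mec_condition_iff: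
  "weak_mec_condition R C \<phi> xs ys \<longleftrightarrow>
     class_condition (\<lambda>_. True) (condition_filter False) R C \<phi> xs ys"
  unfolding weak_mec_condition_def class_condition_def exact_on_iff condition_filter_def by simp

lemma solutions_empty_params:
  assumes "\<And>b. b \<in> tuples (univ M) (length ys) \<Longrightarrow> holds M \<psi> ys b \<longleftrightarrow> (M, b) \<in> \<pi>"
  shows "solutions M \<psi> ys [] [] = {b \<in> tuples (univ M) (length ys). (M, b) \<in> \<pi>}"
  using assms by (auto simp: solutions_def)

text \<open>
  The cells of a partition serve as the colours.
\<close>

lemma definably_asymptotic_of_class_condition:
  assumes cond: "class_condition (definable_partition L C ys) Fil R C \<phi> xs ys"
    and R: "R \<subseteq> C \<rightarrow> {0..}"
  shows "definably_asymptotic L Fil C (length ys) (\<lambda>M b. real (card (solutions M \<phi> xs ys b)))"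
proof -
  obtain P h where P: "finite P" "partition_on (class_pairs C ys) P" "definable_partition L C ys P"
    "\<And>\<pi>. \<pi> \<in> P \<Longrightarrow> h \<pi> \<in> R" "\<And>\<pi>. \<pi> \<in> P \<Longrightarrow> asymptotic_along Fil \<pi> \<phi> xs ys (h \<pi>)"
    using cond unfolding class_condition_def by blast
  define q where "q M b = (THE \<pi>. \<pi> \<in> P \<and> (M, b) \<in> \<pi>)" for M b
  have ex1: "\<exists>!\<pi>. \<pi> \<in> P \<and> (M, b) \<in> \<pi>" if "M \<in> C" "b \<in> tuples (univ M) (length ys)" for M b
  proof -
    have "(M, b) \<in> \<Union>P" using P(2) that by (auto simp: partition_on_def class_pairs_def)
    then show ?thesis using P(2) by (auto simp: partition_on_def disjoint_def)
  qed
  have q: "q M b \<in> P" "(M, b) \<in> q M b" if "M \<in> C" "b \<in> tuples (univ M) (length ys)" for M b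
    using theI'[OF ex1[OF that]] by (auto simp: q_def)
  have q_eq: "q M b = \<pi> \<longleftrightarrow> (M, b) \<in> \<pi>"
    if "M \<in> C" "b \<in> tuples (univ M) (length ys)" "\<pi> \<in> P" for M b \<pi>
    using ex1[OF that(1,2)] q[OF that(1,2)] that(3) by blast
  show ?thesis
  proof (rule definably_asymptoticI)
    show "asymptotic_colouring Fil C (length ys) (\<lambda>M b. real (card (solutions M \<phi> xs ys b))) q P h"
      unfolding asymptotic_colouring_def
    proof (intro conjI allI impI)
      show "\<forall>\<pi>\<in>P. \<forall>M\<in>C. 0 \<le> h \<pi> M" using P(4) R by (fastforce simp: Pi_def)
      fix \<epsilon> :: real assume "\<epsilon> > 0"
      then have "\<forall>\<^sub>F M in Fil. \<forall>\<pi>\<in>P. \<forall>b. (M, b) \<in> \<pi> \<longrightarrow>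
          \<bar>real (card (solutions M \<phi> xs ys b)) - h \<pi> M\<bar> \<le> \<epsilon> * h \<pi> M"
        using P(5) unfolding asymptotic_along_def by (intro eventually_ball_finite[OF P(1)]) blast
      then show "\<forall>\<^sub>F M in Fil. M \<in> C \<longrightarrow> (\<forall>b\<in>tuples (univ M) (length ys).
          \<bar>real (card (solutions M \<phi> xs ys b)) - h (q M b) M\<bar> \<le> \<epsilon> * h (q M b) M)"
        by eventually_elim (use q in blast)
    qed (use P(1) q(1) in \<open>blast+\<close>)
    fix \<pi> assume \<pi>: "\<pi> \<in> P"
    obtain \<psi> where \<psi>: "formula_in L \<psi> ys"
      "\<forall>M\<in>C. solutions M \<psi> ys [] [] = {b \<in> tuples (univ M) (length ys). (M, b) \<in> \<pi>}"
      using bspec[OF P(3)[unfolded definable_partition_def] \<pi>] by (elim exE conjE)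
    show "definable L C (length ys) (\<lambda>M b. q M b = \<pi>)"
    proof (rule definable_cong[OF definable_holds[OF \<psi>(1)] order_refl])
      fix M b assume M: "M \<in> C" and b: "b \<in> tuples (univ M) (length ys)"
      have "holds M \<psi> ys b \<longleftrightarrow> b \<in> solutions M \<psi> ys [] []" using b by (simp add: solutions_def)
      then show "holds M \<psi> ys b \<longleftrightarrow> q M b = \<pi>" using bspec[OF \<psi>(2) M] b q_eq[OF M b \<pi>] by simp
    qed
  qed
qed

text \<open>
  The cells of a partition are nonempty, so the empty colour classes have to be discarded.
\<close>

lemma class_condition_of_colouring:
  assumes col: "asymptotic_colouring Fil C (length ys)
      (\<lambda>M b. real (card (solutions M \<phi> xs ys b))) q K h"
    and D: "\<And>P. (\<And>\<pi>. \<pi> \<in> P \<Longrightarrow> \<exists>i\<in>K. \<pi> = {(M, b) \<in> class_pairs C ys. q M b = i}) \<Longrightarrow> D P"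
  shows "class_condition D Fil (C \<rightarrow> {0..}) C \<phi> xs ys"
proof -
  let ?cell = "\<lambda>i. {(M, b) \<in> class_pairs C ys. q M b = i}"
  let ?P = "?cell ` K - {{}}"
  define c where "c \<pi> = (SOME i. i \<in> K \<and> \<pi> = ?cell i)" for \<pi>
  have c: "c \<pi> \<in> K \<and> \<pi> = ?cell (c \<pi>)" if "\<pi> \<in> ?P" for \<pi>
    unfolding c_def by (rule someI_ex) (use that in blast)
  have "partition_on (class_pairs C ys) ?P"
    using col unfolding asymptotic_colouring_def
    by (intro partition_onI) (auto simp: class_pairs_def disjnt_def)
  moreover have "D ?P" by (rule D) blast
  moreover have "h (c \<pi>) \<in> C \<rightarrow> {0..} \<and> asymptotic_along Fil \<pi> \<phi> xs ys (h (c \<pi>))"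
    if \<pi>: "\<pi> \<in> ?P" for \<pi>
  proof
    show "h (c \<pi>) \<in> C \<rightarrow> {0..}" using col c[OF \<pi>] unfolding asymptotic_colouring_def by auto
    show "asymptotic_along Fil \<pi> \<phi> xs ys (h (c \<pi>))"
      unfolding asymptotic_along_def
    proof (intro allI impI)
      fix \<epsilon> :: real assume "\<epsilon> > 0"
      then have "\<forall>\<^sub>F M in Fil. M \<in> C \<longrightarrow> (\<forall>b\<in>tuples (univ M) (length ys).
          \<bar>real (card (solutions M \<phi> xs ys b)) - h (q M b) M\<bar> \<le> \<epsilon> * h (q M b) M)"
        using col unfolding asymptotic_colouring_def by blast
      then show "\<forall>\<^sub>F M in Fil. \<forall>b. (M, b) \<in> \<pi> \<longrightarrow>
          \<bar>real (card (solutions M \<phi> xs ys b)) - h (c \<pi>) M\<bar> \<le> \<epsilon> * h (c \<pi>) M"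
      proof eventually_elim
        case (elim M)
        show ?case
        proof (intro allI impI)
          fix b assume "(M, b) \<in> \<pi>"
          then have "M \<in> C" "b \<in> tuples (univ M) (length ys)" "q M b = c \<pi>"
            using c[OF \<pi>] by (auto simp: class_pairs_def)
          then show "\<bar>real (card (solutions M \<phi> xs ys b)) - h (c \<pi>) M\<bar> \<le> \<epsilon> * h (c \<pi>) M"
            using elim by metis
        qed
      qed
    qed
  qed
  moreover have "finite ?P" using asymptotic_colouringD(1)[OF col] by simp
  ultimately show ?thesis unfolding class_condition_def
    by (intro exI[of _ ?P] exI[of _ "\<lambda>\<pi>. h (c \<pi>)"]) (intro conjI ballI; simp only:)
qed

lemma definable_partition_of_colouring:
  assumes "\<And>\<pi>. \<pi> \<in> P \<Longrightarrow> \<exists>i\<in>K. \<pi> = {(M, b) \<in> class_pairs C ys. q M b = i}"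
    and "\<And>i. i \<in> K \<Longrightarrow> definable L C (length ys) (\<lambda>M b. q M b = i)" and "distinct ys"
  shows "definable_partition L C ys P"
  unfolding definable_partition_def
proof
  fix \<pi> assume "\<pi> \<in> P"
  then obtain i where i: "i \<in> K" "\<pi> = {(M, b) \<in> class_pairs C ys. q M b = i}"
    using assms(1) by blast
  obtain \<psi> where \<psi>: "formula_in L \<psi> ys"
    "\<And>M b. M \<in> C \<Longrightarrow> b \<in> tuples (univ M) (length ys) \<Longrightarrow> holds M \<psi> ys b \<longleftrightarrow> q M b = i"
    using definable_formula[OF assms(2)[OF i(1)] assms(3)] by blast
  have "solutions M \<psi> ys [] [] = {b \<in> tuples (univ M) (length ys). (M, b) \<in> \<pi>}" if "M \<in> C" for M
    by (rule solutions_empty_params) (use \<psi>(2) i(2) that in \<open>auto simp: class_pairs_def\<close>)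
  then show "\<exists>\<psi>. formula_in L \<psi> ys \<and> (\<forall>M\<in>C. solutions M \<psi> ys [] []
      = {b \<in> tuples (univ M) (length ys). (M, b) \<in> \<pi>})" using \<psi>(1) by blast
qed

lemma counts_asymptotic_of_class_condition:
  assumes cond: "\<And>\<phi> ys. formula_in L \<phi> (xs @ ys) \<Longrightarrow>
      class_condition (definable_partition L C ys) Fil R C \<phi> xs ys"
    and R: "R \<subseteq> C \<rightarrow> {0..}" and xs: "xs = [0..<m]"
  shows "counts_asymptotic L Fil C m"
  unfolding counts_asymptotic_def
proof (intro allI impI)
  fix n P assume P: "definable L C (m + n) P"
  define ys where "ys = [m..<m + n]"
  have len: "length xs = m" "length ys = n" and dist: "distinct (xs @ ys)"
    by (auto simp: xs ys_def)
  obtain \<phi> where \<phi>: "formula_in L \<phi> (xs @ ys)"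
    "\<And>M a. M \<in> C \<Longrightarrow> a \<in> tuples (univ M) (m + n) \<Longrightarrow> holds M \<phi> (xs @ ys) a \<longleftrightarrow> P M a"
    using definable_formula[OF _ dist, of L C P] P len by auto
  have "definably_asymptotic L Fil C n (\<lambda>M b. real (card (solutions M \<phi> xs ys b)))"
    using definably_asymptotic_of_class_condition[OF cond[OF \<phi>(1)] R] len by simp
  then show "definably_asymptotic L Fil C n (\<lambda>M b. real (card {a \<in> tuples (univ M) m. P M (a @ b)}))"
  proof (rule definably_asymptotic_cong)
    fix M b assume "M \<in> C" "b \<in> tuples (univ M) n"
    then have "solutions M \<phi> xs ys b = {a \<in> tuples (univ M) m. P M (a @ b)}"
      using \<phi>(2) tuples_append[of _ "univ M" m b n] unfolding solutions_def len by blast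
    then show "real (card (solutions M \<phi> xs ys b)) = real (card {a \<in> tuples (univ M) m. P M (a @ b)})"
      by simp
  qed
qed

lemma class_condition_of_counts_asymptotic:
  assumes "\<And>m. counts_asymptotic L Fil C m" and \<phi>: "formula_in L \<phi> (xs @ ys)"
  shows "class_condition (definable_partition L C ys) Fil (C \<rightarrow> {0..}) C \<phi> xs ys"
proof -
  have "definably_asymptotic L Fil C (length ys) (\<lambda>M b. real (card (solutions M \<phi> xs ys b)))"
    using assms(1)[of "length xs"] definable_holds[OF \<phi>, of C]
    unfolding counts_asymptotic_def solutions_def length_append by blast
  then obtain q :: "_ \<Rightarrow> _ \<Rightarrow> nat" and K h where
    q: "asymptotic_colouring Fil C (length ys) (\<lambda>M b. real (card (solutions M \<phi> xs ys b))) q K h"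
    "\<forall>i\<in>K. definable L C (length ys) (\<lambda>M b. q M b = i)" unfolding definably_asymptotic_def by blast
  show ?thesis
    by (rule class_condition_of_colouring[OF q(1)], rule definable_partition_of_colouring[of _ K _ _ q])
      (use q(2) \<phi> in \<open>auto simp: formula_in_def\<close>)
qed

theorem one_variable_criterion:
  assumes fin: "\<And>M. M \<in> C \<Longrightarrow> finite (univ M)" and R: "R \<subseteq> C \<rightarrow> {0..}"
    and "\<And>\<phi> x ys. formula_in L \<phi> (x # ys) \<Longrightarrow>
      class_condition (definable_partition L C ys) Fil R C \<phi> [x] ys"
    and "formula_in L \<phi> (xs @ ys)"
  shows "class_condition (definable_partition L C ys) Fil (C \<rightarrow> {0..}) C \<phi> xs ys"
proof -
  have "counts_asymptotic L Fil C 1"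
    by (rule counts_asymptotic_of_class_condition[OF _ R, where xs = "[0]"]) (use assms(3) in auto)
  then show ?thesis
    using class_condition_of_counts_asymptotic[OF counts_asymptotic_all[OF fin]] assms(4) by blast
qed

section \<open>Interpretations as representations by tuples\<close>

text \<open>
  If \<open>\<rho> x\<close> is the set of tuples representing the element \<open>x\<close>, then a tuple of elements is
  represented by the concatenations of representatives of its entries.
\<close>

primrec tuple_reps :: "('v \<Rightarrow> 'u list set) \<Rightarrow> 'v list \<Rightarrow> 'u list set" where
  "tuple_reps \<rho> [] = {[]}"
| "tuple_reps \<rho> (x # b) = {w @ z | w z. w \<in> \<rho> x \<and> z \<in> tuple_reps \<rho> b}"

lemma tuple_reps_iff_concat:
  "z \<in> tuple_reps \<rho> b \<longleftrightarrow> (\<exists>as. z = concat as \<and> list_all2 (\<lambda>a x. a \<in> \<rho> x) as b)"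
proof (induction b arbitrary: z)
  case (Cons x b)
  have "(\<exists>as. z = concat as \<and> list_all2 (\<lambda>a x. a \<in> \<rho> x) as (x # b)) \<longleftrightarrow>
      (\<exists>w as. z = w @ concat as \<and> w \<in> \<rho> x \<and> list_all2 (\<lambda>a x. a \<in> \<rho> x) as b)"
    unfolding list_all2_Cons2 by (metis concat.simps(2))
  also have "\<dots> \<longleftrightarrow> z \<in> tuple_reps \<rho> (x # b)"
    unfolding tuple_reps.simps mem_Collect_eq Cons.IH by blast
  finally show ?case ..
qed auto

lemma tuple_reps_append:
  "tuple_reps \<rho> (b @ b') = {z @ z' | z z'. z \<in> tuple_reps \<rho> b \<and> z' \<in> tuple_reps \<rho> b'}"
proof (induction b)
  case (Cons x b)
  show ?case
  proof (rule set_eqI)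
    fix u
    have "u \<in> tuple_reps \<rho> ((x # b) @ b') \<longleftrightarrow> (\<exists>w z z'. u = (w @ z) @ z' \<and>
        w \<in> \<rho> x \<and> z \<in> tuple_reps \<rho> b \<and> z' \<in> tuple_reps \<rho> b')"
      unfolding append_Cons tuple_reps.simps Cons.IH mem_Collect_eq append_assoc by blast
    also have "\<dots> \<longleftrightarrow> u \<in> {z @ z' | z z'. z \<in> tuple_reps \<rho> (x # b) \<and> z' \<in> tuple_reps \<rho> b'}"
      unfolding tuple_reps.simps mem_Collect_eq by blast
    finally show "u \<in> tuple_reps \<rho> ((x # b) @ b') \<longleftrightarrow>
      u \<in> {z @ z' | z z'. z \<in> tuple_reps \<rho> (x # b) \<and> z' \<in> tuple_reps \<rho> b'}" .
  qed
qed simp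

lemma tuple_reps_single [simp]: "tuple_reps \<rho> [x] = \<rho> x"
  by simp

lemma tuple_reps_in_tuples:
  "z \<in> tuple_reps \<rho> b \<Longrightarrow> (\<And>x. x \<in> set b \<Longrightarrow> \<rho> x \<subseteq> tuples U d) \<Longrightarrow> z \<in> tuples U (length b * d)"
proof (induction b arbitrary: z)
  case (Cons x b)
  then obtain w z' where "z = w @ z'" "w \<in> \<rho> x" "z' \<in> tuple_reps \<rho> b" by auto
  then show ?case using Cons by (auto intro!: tuples_append)
qed simp

lemma tuple_reps_nonempty: "(\<And>x. x \<in> set b \<Longrightarrow> \<rho> x \<noteq> {}) \<Longrightarrow> tuple_reps \<rho> b \<noteq> {}"
proof (induction b)
  case (Cons x b)
  then have "\<rho> x \<noteq> {}" "tuple_reps \<rho> b \<noteq> {}" by auto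
  then show ?case by auto
qed simp

lemma tuple_reps_block:
  assumes "z \<in> tuple_reps \<rho> b" "\<And>x. x \<in> set b \<Longrightarrow> \<rho> x \<subseteq> tuples U d" "i < length b"
  shows "take d (drop (i * d) z) \<in> \<rho> (b ! i)"
  using assms
proof (induction b arbitrary: z i)
  case (Cons x b)
  then obtain w z' where z: "z = w @ z'" "w \<in> \<rho> x" "z' \<in> tuple_reps \<rho> b" by auto
  then have w: "length w = d" using Cons.prems(2) by (auto simp: tuples_def)
  show ?case
  proof (cases i)
    case 0
    then show ?thesis using z w by simp
  next
    case (Suc j)
    then show ?thesis using Cons.IH[OF z(3)] Cons.prems(2,3) z(1) w by simp
  qed
qed simp

lemma tuple_reps_concat:
  "(\<And>i. i < n \<Longrightarrow> B i \<in> \<rho> (g i)) \<Longrightarrow>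
    concat (map B [0..<n]) \<in> tuple_reps \<rho> (map g [0..<n])"
  by (induction n) (auto simp: tuple_reps_append)

text \<open>
  A family of structures \<open>N k\<close> whose elements are represented by \<open>d\<close>-tuples of \<open>M k\<close>, with
  parameters \<open>c k\<close>. Distinct elements have disjoint nonempty sets of representatives; these
  sets are the classes of an interpretation. The family is indexed because the interpreted
  structure and the interpreting one vary together, and in a bi-interpretation each of the two
  plays both roles over the same index set.
\<close>

locale representation =
  fixes L :: "('f, 'r) lang" and K :: "'k set"
    and N :: "'k \<Rightarrow> ('v, 'g, 's) struct" and M :: "'k \<Rightarrow> ('u, 'f, 'r) struct"
    and c :: "'k \<Rightarrow> 'u list" and rep :: "'k \<Rightarrow> 'v \<Rightarrow> 'u list set" and p d :: nat
  assumes param: "k \<in> K \<Longrightarrow> c k \<in> tuples (univ (M k)) p"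
    and rep_tuples: "k \<in> K \<Longrightarrow> x \<in> univ (N k) \<Longrightarrow> rep k x \<subseteq> tuples (univ (M k)) d"
    and rep_nonempty: "k \<in> K \<Longrightarrow> x \<in> univ (N k) \<Longrightarrow> rep k x \<noteq> {}"
    and rep_unique: "k \<in> K \<Longrightarrow> x \<in> univ (N k) \<Longrightarrow> y \<in> univ (N k) \<Longrightarrow> w \<in> rep k x \<Longrightarrow> w \<in> rep k y
      \<Longrightarrow> x = y"
    and rep_definable: "\<exists>Q. definable L UNIV (p + d) Q \<and>
      (\<forall>k\<in>K. \<forall>w\<in>tuples (univ (M k)) d. Q (M k) (c k @ w) \<longleftrightarrow> (\<exists>x\<in>univ (N k). w \<in> rep k x))"
begin

abbreviation reps :: "'k \<Rightarrow> 'v list \<Rightarrow> 'u list set" where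
  "reps k \<equiv> tuple_reps (rep k)"

text \<open>
  The predicate \<open>P\<close> on \<open>N k\<close> is translated by one formula about \<open>M k\<close>. Correctness is demanded
  only on representatives, which makes closure under negation and substitution immediate; where
  it matters whether a tuple is a representative at all, \<open>reps_definable\<close> is used in addition.
\<close>

definition representable :: "nat \<Rightarrow> ('k \<Rightarrow> 'v list \<Rightarrow> bool) \<Rightarrow> bool" where
  "representable n P \<longleftrightarrow> (\<exists>Q. definable L UNIV (p + n * d) Q \<and>
     (\<forall>k\<in>K. \<forall>b\<in>tuples (univ (N k)) n. \<forall>z\<in>reps k b. Q (M k) (c k @ z) \<longleftrightarrow> P k b))"

lemma rep_tuples': "k \<in> K \<Longrightarrow> b \<in> tuples (univ (N k)) n \<Longrightarrow> x \<in> set b \<Longrightarrow> rep k x \<subseteq> tuples (univ (M k)) d"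
  by (rule rep_tuples) (auto simp: tuples_def)

lemma reps_tuples:
  assumes "k \<in> K" "b \<in> tuples (univ (N k)) n" "z \<in> reps k b"
  shows "z \<in> tuples (univ (M k)) (n * d)"
  using tuple_reps_in_tuples[OF assms(3) rep_tuples'[OF assms(1,2)]] assms(2)
  by (simp add: tuples_def)

lemma reps_nonempty: "k \<in> K \<Longrightarrow> b \<in> tuples (univ (N k)) n \<Longrightarrow> reps k b \<noteq> {}"
  using tuple_reps_nonempty[of b "rep k"] rep_nonempty[of k] by (auto simp: tuples_def)

lemma reps_unique:
  assumes "k \<in> K" "b \<in> tuples (univ (N k)) n" "b' \<in> tuples (univ (N k)) n" "z \<in> reps k b" "z \<in> reps k b'"
  shows "b = b'"
proof (rule nth_equalityI)
  show "length b = length b'" using assms by (simp add: tuples_def)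
  fix i assume i: "i < length b"
  then have i': "i < length b'" using assms(2,3) by (simp add: tuples_def)
  have "take d (drop (i * d) z) \<in> rep k (b ! i)" "take d (drop (i * d) z) \<in> rep k (b' ! i)"
    using tuple_reps_block[OF assms(4) rep_tuples'[OF assms(1,2)] i]
      tuple_reps_block[OF assms(5) rep_tuples'[OF assms(1,3)] i'] by auto
  then show "b ! i = b' ! i"
    using rep_unique[OF assms(1)] i i' assms(2,3) by (metis tuples_length tuples_nth)
qed

lemma representable_cong:
  assumes "representable n P" "\<And>k b. k \<in> K \<Longrightarrow> b \<in> tuples (univ (N k)) n \<Longrightarrow> P k b \<longleftrightarrow> P' k b"
  shows "representable n P'"
  using assms unfolding representable_def by (metis (no_types, lifting))

lemma representable_Not: "representable n P \<Longrightarrow> representable n (\<lambda>k b. \<not> P k b)"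
  unfolding representable_def using definable_Not by (metis (no_types, lifting))

lemma representable_True: "representable n (\<lambda>k b. True)"
  unfolding representable_def using definable_True by blast

lemma representable_conj:
  assumes "representable n P" "representable n P'"
  shows "representable n (\<lambda>k b. P k b \<and> P' k b)"
proof -
  obtain Q Q' where "definable L UNIV (p + n * d) Q" "definable L UNIV (p + n * d) Q'"
    "\<forall>k\<in>K. \<forall>b\<in>tuples (univ (N k)) n. \<forall>z\<in>reps k b. Q (M k) (c k @ z) \<longleftrightarrow> P k b"
    "\<forall>k\<in>K. \<forall>b\<in>tuples (univ (N k)) n. \<forall>z\<in>reps k b. Q' (M k) (c k @ z) \<longleftrightarrow> P' k b"
    using assms unfolding representable_def by (elim exE conjE)
  then show ?thesis unfolding representable_def
    by (intro exI[of _ "\<lambda>M a. Q M a \<and> Q' M a"]) (simp add: definable_conj)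
qed

lemma representable_all_less:
  fixes m :: nat
  assumes "\<And>i. i < m \<Longrightarrow> representable n (P i)"
  shows "representable n (\<lambda>k b. \<forall>i<m. P i k b)"
  using assms
proof (induction m)
  case 0
  then show ?case using representable_True by simp
next
  case (Suc m)
  then show ?case using representable_conj[of n "\<lambda>k b. \<forall>i<m. P i k b" "P m"]
    by (simp add: All_less_Suc conj_commute)
qed

text \<open>
  Selecting coordinates \<open>\<sigma> i\<close> of a tuple means selecting blocks of length \<open>d\<close> of a representative,
  behind the \<open>p\<close> parameters.
\<close>

lemma representable_select:
  assumes "representable n P" "selection m n s"
  shows "representable m (\<lambda>k b. P k (s b))"
proof -
  obtain Q where Q: "definable L UNIV (p + n * d) Q"
    "\<forall>k\<in>K. \<forall>b\<in>tuples (univ (N k)) n. \<forall>z\<in>reps k b. Q (M k) (c k @ z) \<longleftrightarrow> P k b"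
    using assms(1) unfolding representable_def by (elim exE conjE)
  obtain \<sigma> where \<sigma>: "\<And>i. i < n \<Longrightarrow> \<sigma> i < m" "\<And>a. length a = m \<Longrightarrow> s a = map (\<lambda>i. a ! \<sigma> i) [0..<n]"
    using assms(2) unfolding selection_def by blast
  let ?blocks = "\<lambda>a. concat (map (\<lambda>i. take d (drop (p + \<sigma> i * d) a)) [0..<n])"
  have sel: "selection (p + m * d) (p + n * d) (\<lambda>a. take p a @ ?blocks a)"
  proof (rule selection_append[OF selection_take selection_concat[OF selection_slice]])
    fix i assume "i < n"
    then have "Suc (\<sigma> i) * d \<le> m * d" using \<sigma>(1) by (intro mult_right_mono) (auto simp: Suc_le_eq)
    then show "p + \<sigma> i * d + d \<le> p + m * d" by simp
  qed simp_all
  show ?thesis unfolding representable_def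
  proof (intro exI[of _ "\<lambda>M a. Q M (take p a @ ?blocks a)"] conjI ballI)
    show "definable L UNIV (p + m * d) (\<lambda>M a. Q M (take p a @ ?blocks a))"
      by (rule definable_select[OF Q(1) sel])
    fix k b z assume k: "k \<in> K" and b: "b \<in> tuples (univ (N k)) m" and z: "z \<in> reps k b"
    have c: "length (c k) = p" using param[OF k] by (simp add: tuples_def)
    have "?blocks (c k @ z) \<in> reps k (map (\<lambda>i. b ! \<sigma> i) [0..<n])"
    proof (rule tuple_reps_concat)
      fix i assume i: "i < n"
      have "take d (drop (\<sigma> i * d) z) \<in> rep k (b ! \<sigma> i)"
        by (rule tuple_reps_block[OF z rep_tuples'[OF k b]]) (use \<sigma>(1)[OF i] b in \<open>auto simp: tuples_def\<close>)
      then show "take d (drop (p + \<sigma> i * d) (c k @ z)) \<in> rep k (b ! \<sigma> i)" using c by simp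
    qed
    moreover have "s b = map (\<lambda>i. b ! \<sigma> i) [0..<n]" using \<sigma>(2) b by (simp add: tuples_def)
    moreover have "s b \<in> tuples (univ (N k)) n" by (rule selection_tuples[OF assms(2) b])
    ultimately show "Q (M k) (take p (c k @ z) @ ?blocks (c k @ z)) \<longleftrightarrow> P k (s b)"
      using Q(2) k c by simp
  qed
qed

lemma representable_ex_1:
  assumes "representable (Suc n) P"
  shows "representable n (\<lambda>k b. \<exists>x\<in>univ (N k). P k (b @ [x]))"
proof -
  obtain Q where Q: "definable L UNIV (p + Suc n * d) Q"
    "\<forall>k\<in>K. \<forall>b\<in>tuples (univ (N k)) (Suc n). \<forall>z\<in>reps k b. Q (M k) (c k @ z) \<longleftrightarrow> P k b"
    using assms(1) unfolding representable_def by (elim exE conjE)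
  obtain R where R: "definable L UNIV (p + d) R"
    "\<forall>k\<in>K. \<forall>w\<in>tuples (univ (M k)) d. R (M k) (c k @ w) \<longleftrightarrow> (\<exists>x\<in>univ (N k). w \<in> rep k x)"
    using rep_definable by (elim exE conjE)
  have len: "p + Suc n * d = (p + n * d) + d" by simp
  have "definable L UNIV ((p + n * d) + d) (\<lambda>M a. Q M a \<and> R M (take p a @ drop (p + n * d) a))"
    by (rule definable_conj[OF Q(1)[unfolded len] definable_select[OF R(1)]])
      (rule selection_append[OF selection_take selection_drop]; simp)
  from definable_ex[OF this] have "definable L UNIV (p + n * d) (\<lambda>M a. \<exists>w\<in>tuples (univ M) d.
     Q M (a @ w) \<and> R M (take p (a @ w) @ drop (p + n * d) (a @ w)))" .
  moreover have "(\<exists>w\<in>tuples (univ (M k)) d. Q (M k) ((c k @ z) @ w) \<and>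
      R (M k) (take p ((c k @ z) @ w) @ drop (p + n * d) ((c k @ z) @ w)))
    \<longleftrightarrow> (\<exists>x\<in>univ (N k). P k (b @ [x]))" (is "?lhs \<longleftrightarrow> ?rhs")
    if k: "k \<in> K" and b: "b \<in> tuples (univ (N k)) n" and z: "z \<in> reps k b" for k b z
  proof -
    have c: "length (c k) = p" using param[OF k] by (simp add: tuples_def)
    have lz: "length z = n * d" using reps_tuples[OF k b z] by (simp add: tuples_def)
    have 1: "take p ((c k @ z) @ w) @ drop (p + n * d) ((c k @ z) @ w) = c k @ w" for w
      using c lz by simp
    have 2: "Q (M k) ((c k @ z) @ w) \<longleftrightarrow> P k (b @ [x])" if "x \<in> univ (N k)" "w \<in> rep k x" for x w
    proof -
      have "b @ [x] \<in> tuples (univ (N k)) (Suc n)" using b that by (simp add: tuples_def)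
      moreover have "z @ w \<in> reps k (b @ [x])" using z that(2) by (auto simp: tuple_reps_append)
      ultimately show ?thesis using Q(2) k by simp
    qed
    show ?thesis
    proof
      assume ?lhs
      then obtain w where w: "w \<in> tuples (univ (M k)) d" "Q (M k) ((c k @ z) @ w)" "R (M k) (c k @ w)"
        unfolding 1 by blast
      then obtain x where "x \<in> univ (N k)" "w \<in> rep k x" using R(2) k by blast
      then show ?rhs using 2 w(2) by blast
    next
      assume ?rhs
      then obtain x where x: "x \<in> univ (N k)" "P k (b @ [x])" by blast
      then obtain w where w: "w \<in> rep k x" "w \<in> tuples (univ (M k)) d"
        using rep_nonempty[OF k x(1)] rep_tuples[OF k x(1)] by blast
      then have "R (M k) (c k @ w)" using R(2) k x(1) by blast
      then show ?lhs unfolding 1 using w 2[OF x(1) w(1)] x(2) by blast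
    qed
  qed
  ultimately show ?thesis unfolding representable_def by blast
qed

lemma representable_ex:
  assumes "representable (n + m) P"
  shows "representable n (\<lambda>k b. \<exists>w\<in>tuples (univ (N k)) m. P k (b @ w))"
  using assms
proof (induction m arbitrary: P)
  case (Suc m)
  have "representable n (\<lambda>k b. \<exists>w\<in>tuples (univ (N k)) m. \<exists>x\<in>univ (N k). P k ((b @ w) @ [x]))"
    by (rule Suc.IH, rule representable_ex_1) (use Suc.prems in simp)
  then show ?case by (simp add: bex_tuples_Suc)
qed simp

lemma reps_definable:
  "\<exists>Q. definable L UNIV (p + n * d) Q \<and> (\<forall>k\<in>K. \<forall>z\<in>tuples (univ (M k)) (n * d).
     Q (M k) (c k @ z) \<longleftrightarrow> (\<exists>b\<in>tuples (univ (N k)) n. z \<in> reps k b))"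
proof (induction n)
  case 0
  show ?case by (rule exI[of _ "\<lambda>_ _. True"]) (simp add: definable_True)
next
  case (Suc n)
  then obtain Q where Q: "definable L UNIV (p + n * d) Q" "\<forall>k\<in>K. \<forall>z\<in>tuples (univ (M k)) (n * d).
     Q (M k) (c k @ z) \<longleftrightarrow> (\<exists>b\<in>tuples (univ (N k)) n. z \<in> reps k b)" by (elim exE conjE)
  obtain R where R: "definable L UNIV (p + d) R"
    "\<forall>k\<in>K. \<forall>w\<in>tuples (univ (M k)) d. R (M k) (c k @ w) \<longleftrightarrow> (\<exists>x\<in>univ (N k). w \<in> rep k x)"
    using rep_definable by (elim exE conjE)
  show ?case
  proof (intro exI[of _ "\<lambda>M a. Q M (take (p + n * d) a) \<and> R M (take p a @ drop (p + n * d) a)"] conjI ballI)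
    show "definable L UNIV (p + Suc n * d)
        (\<lambda>M a. Q M (take (p + n * d) a) \<and> R M (take p a @ drop (p + n * d) a))"
      by (intro definable_conj definable_select[OF Q(1) selection_take]
          definable_select[OF R(1) selection_append[OF selection_take selection_drop]]) simp_all
    fix k z assume k: "k \<in> K" and "z \<in> tuples (univ (M k)) (Suc n * d)"
    then obtain y w where z: "z = y @ w" "y \<in> tuples (univ (M k)) (n * d)" "w \<in> tuples (univ (M k)) d"
      using tuples_add[of z "univ (M k)" "n * d" d] by (auto simp: add.commute)
    have len: "length (c k) = p" "length y = n * d" using param[OF k] z by (auto simp: tuples_def)
    have "(\<exists>b\<in>tuples (univ (N k)) (Suc n). z \<in> reps k b) \<longleftrightarrow>
      (\<exists>b\<in>tuples (univ (N k)) n. \<exists>x\<in>univ (N k). z \<in> reps k (b @ [x]))"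
      by (rule bex_tuples_Suc)
    also have "\<dots> \<longleftrightarrow> (\<exists>b\<in>tuples (univ (N k)) n. \<exists>x\<in>univ (N k). y \<in> reps k b \<and> w \<in> rep k x)"
    proof (intro bex_cong refl)
      fix b x assume b: "b \<in> tuples (univ (N k)) n"
      show "z \<in> reps k (b @ [x]) \<longleftrightarrow> y \<in> reps k b \<and> w \<in> rep k x"
        using reps_tuples[OF k b] len(2) by (auto simp: tuple_reps_append z(1) tuples_def)
    qed
    also have "\<dots> \<longleftrightarrow> Q (M k) (c k @ y) \<and> R (M k) (c k @ w)" using Q(2) R(2) k z by blast
    finally show "Q (M k) (take (p + n * d) (c k @ z)) \<and>
        R (M k) (take p (c k @ z) @ drop (p + n * d) (c k @ z)) \<longleftrightarrow>
      (\<exists>b\<in>tuples (univ (N k)) (Suc n). z \<in> reps k b)" using len z(1) by simp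
  qed
qed

end

text \<open>
  In an interpretation equality, the relations and the graphs of the functions are representable;
  by induction on formulas every definable predicate is
  (\<open>structure_interpretation.representable_definable\<close>).
\<close>

locale structure_interpretation = representation L K N M c rep p d
  for L :: "('f, 'r) lang" and K :: "'k set"
    and N :: "'k \<Rightarrow> ('v, 'g, 's) struct" and M :: "'k \<Rightarrow> ('u, 'f, 'r) struct"
    and c :: "'k \<Rightarrow> 'u list" and rep :: "'k \<Rightarrow> 'v \<Rightarrow> 'u list set" and p d :: nat +
  fixes L' :: "('g, 's) lang"
  assumes structs: "k \<in> K \<Longrightarrow> is_structure L' (N k)"
    and eq: "representable 2 (\<lambda>k b. b ! 0 = b ! 1)"
    and rel: "r \<in> rel_syms L' \<Longrightarrow> representable (rel_ar L' r) (\<lambda>k b. b \<in> rel_int (N k) r)"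
    and fn: "g \<in> fun_syms L' \<Longrightarrow>
      representable (Suc (fun_ar L' g)) (\<lambda>k b. fun_int (N k) g (butlast b) = last b)"
begin

lemma representable_nth_eq:
  assumes "i < n" "j < n"
  shows "representable n (\<lambda>k b. b ! i = b ! j)"
proof -
  have "selection n 2 (\<lambda>b. [b ! i] @ [b ! j])"
    by (rule selection_append selection_nth assms)+ simp
  from representable_select[OF eq this] show ?thesis by simp
qed

lemma tm_val_in_univ:
  assumes "is_structure L' S" "lang_tm L' t" "\<And>v. v \<in> tm_vars t \<Longrightarrow> e v \<in> univ S"
  shows "tm_val S e t \<in> univ S"
  using assms(2,3)
proof (induction t)
  case (Fn g ts)
  then have "map (tm_val S e) ts \<in> tuples (univ S) (fun_ar L' g)" by (auto simp: tuples_def)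
  moreover have "fun_int S g \<in> tuples (univ S) (fun_ar L' g) \<rightarrow>\<^sub>E univ S"
    using assms(1) Fn.prems(1) by (simp add: is_structure_def)
  ultimately show ?case by (auto simp del: map_map)
qed simp

text \<open>
  Nested terms are eliminated by quantifying over their values: \<open>P\<close> holds at the values of the
  terms if there are elements satisfying \<open>P\<close> that are equal to these values. The tuple \<open>b\<close> may be
  longer than the \<open>n\<close> entries that occur in the terms.
\<close>

lemma representable_subst_tms:
  assumes P: "representable (m + length ts) P" and "n \<le> m"
    and lang: "\<And>t. t \<in> set ts \<Longrightarrow> lang_tm L' t"
    and vars: "\<And>t v. t \<in> set ts \<Longrightarrow> v \<in> tm_vars t \<Longrightarrow> \<rho> v < n"
    and graph: "\<And>t. t \<in> set ts \<Longrightarrow>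
      representable (Suc n) (\<lambda>k b. tm_val (N k) (\<lambda>v. b ! \<rho> v) t = b ! n)"
  shows "representable m (\<lambda>k b. P k (b @ map (tm_val (N k) (\<lambda>v. b ! \<rho> v)) ts))"
proof -
  let ?q = "length ts"
  let ?val = "\<lambda>k b. tm_val (N k) (\<lambda>v. b ! \<rho> v)"
  have args: "representable (m + ?q) (\<lambda>k b. \<forall>i<?q. ?val k b (ts ! i) = b ! (m + i))"
  proof (rule representable_all_less)
    fix i assume i: "i < ?q"
    then have mem: "ts ! i \<in> set ts" by simp
    have "selection (m + ?q) (Suc n) (\<lambda>b. take n b @ [b ! (m + i)])"
      by (rule selection_append[OF selection_take selection_nth]) (use i \<open>n \<le> m\<close> in auto)
    from representable_select[OF graph[OF mem] this]
    show "representable (m + ?q) (\<lambda>k b. ?val k b (ts ! i) = b ! (m + i))"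
    proof (rule representable_cong)
      fix k b assume "b \<in> tuples (univ (N k)) (m + ?q)"
      then have b: "length b = m + ?q" by (rule tuples_length)
      have "?val k (take n b @ [b ! (m + i)]) (ts ! i) = ?val k b (ts ! i)"
        by (rule tm_val_cong) (use vars[OF mem] b \<open>n \<le> m\<close> in \<open>force simp: nth_append\<close>)
      then show "(?val k (take n b @ [b ! (m + i)]) (ts ! i) = (take n b @ [b ! (m + i)]) ! n)
          \<longleftrightarrow> ?val k b (ts ! i) = b ! (m + i)" using b \<open>n \<le> m\<close> by (simp add: nth_append)
    qed
  qed
  from representable_ex[OF representable_conj[OF args P]]
  show ?thesis
  proof (rule representable_cong)
    fix k b assume k: "k \<in> K" and b: "b \<in> tuples (univ (N k)) m"
    have lb: "length b = m" using b by (rule tuples_length)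
    have val: "?val k (b @ w) t = ?val k b t" if "t \<in> set ts" for w t
      by (rule tm_val_cong) (use vars[OF that] lb \<open>n \<le> m\<close> in \<open>force simp: nth_append\<close>)
    have iff: "(\<forall>i<?q. ?val k (b @ w) (ts ! i) = (b @ w) ! (m + i)) \<longleftrightarrow> w = map (?val k b) ts"
      if "length w = ?q" for w
      using that val lb by (auto simp: list_eq_iff_nth_eq nth_append)
    have "?val k b t \<in> univ (N k)" if "t \<in> set ts" for t
    proof (rule tm_val_in_univ[OF structs[OF k] lang[OF that]])
      fix v assume "v \<in> tm_vars t"
      then have "\<rho> v < m" using vars[OF that] \<open>n \<le> m\<close> by fastforce
      then show "b ! \<rho> v \<in> univ (N k)" by (rule tuples_nth[OF b])
    qed
    then have "map (?val k b) ts \<in> tuples (univ (N k)) ?q" by (auto simp: tuples_def)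
    then show "(\<exists>w\<in>tuples (univ (N k)) ?q. (\<forall>i<?q. ?val k (b @ w) (ts ! i) = (b @ w) ! (m + i)) \<and>
        P k (b @ w)) \<longleftrightarrow> P k (b @ map (?val k b) ts)"
      using iff by (auto simp: tuples_length)
  qed
qed

lemma representable_tm:
  assumes "lang_tm L' t" "\<And>v. v \<in> tm_vars t \<Longrightarrow> \<rho> v < n"
  shows "representable (Suc n) (\<lambda>k b. tm_val (N k) (\<lambda>v. b ! \<rho> v) t = b ! n)"
  using assms
proof (induction t)
  case (Var v)
  then show ?case by (simp add: representable_nth_eq less_Suc_eq)
next
  case (Fn g ts)
  have g: "g \<in> fun_syms L'" "length ts = fun_ar L' g" using Fn.prems(1) by auto
  have "selection (Suc n + length ts) (Suc (length ts)) (\<lambda>b. drop (Suc n) b @ [b ! n])"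
    by (rule selection_append[OF selection_drop selection_nth]) auto
  from representable_select[OF fn[OF g(1), folded g(2)] this]
  have "representable (Suc n + length ts) (\<lambda>k b. fun_int (N k) g (drop (Suc n) b) = b ! n)" by simp
  then have "representable (Suc n) (\<lambda>k b. fun_int (N k) g
      (drop (Suc n) (b @ map (tm_val (N k) (\<lambda>v. b ! \<rho> v)) ts))
        = (b @ map (tm_val (N k) (\<lambda>v. b ! \<rho> v)) ts) ! n)"
    by (rule representable_subst_tms[where n = n and P = "\<lambda>k b. fun_int (N k) g (drop (Suc n) b) = b ! n"])
      (use Fn in auto)
  then show ?case by (rule representable_cong) (simp add: nth_append tuples_length)
qed

text \<open>
  Variables are allotted to entries of the tuple by \<open>\<rho>\<close>, so that a quantifier always adds a new
  last entry, whichever variable it binds.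
\<close>

lemma representable_sat:
  assumes "lang_fm L' \<phi>" "\<And>v. v \<in> fv \<phi> \<Longrightarrow> \<rho> v < n"
  shows "representable n (\<lambda>k b. sat (N k) (\<lambda>v. b ! \<rho> v) \<phi>)"
  using assms
proof (induction \<phi> arbitrary: \<rho> n)
  case (Equal s t)
  let ?ts = "[s, t]"
  have "representable (n + length ?ts) (\<lambda>k b. b ! n = b ! Suc n)"
    by (rule representable_nth_eq) auto
  then have "representable n (\<lambda>k b. (b @ map (tm_val (N k) (\<lambda>v. b ! \<rho> v)) ?ts) ! n
      = (b @ map (tm_val (N k) (\<lambda>v. b ! \<rho> v)) ?ts) ! Suc n)"
    by (rule representable_subst_tms[where n = n and P = "\<lambda>k b. b ! n = b ! Suc n"])
      (use Equal.prems representable_tm[of s \<rho> n] representable_tm[of t \<rho> n] in auto)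
  then show ?case by (rule representable_cong) (simp add: nth_append tuples_length)
next
  case (Pred r ts)
  have r: "r \<in> rel_syms L'" "length ts = rel_ar L' r" using Pred.prems(1) by auto
  have "selection (n + length ts) (length ts) (drop n)"
    using selection_drop[of n "n + length ts"] by simp
  from representable_select[OF rel[OF r(1), folded r(2)] this]
  have "representable (n + length ts) (\<lambda>k b. drop n b \<in> rel_int (N k) r)" .
  then have "representable n (\<lambda>k b. drop n (b @ map (tm_val (N k) (\<lambda>v. b ! \<rho> v)) ts) \<in> rel_int (N k) r)"
    by (rule representable_subst_tms[where n = n and P = "\<lambda>k b. drop n b \<in> rel_int (N k) r"])
      (use Pred.prems in \<open>auto intro: representable_tm\<close>)
  then show ?case by (rule representable_cong) (simp add: tuples_length)
next
  case (Neg \<phi>)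
  then show ?case using representable_Not by simp
next
  case (Conj \<phi> \<psi>)
  then show ?case using representable_conj by simp
next
  case (Exists v \<phi>)
  have "representable (Suc n) (\<lambda>k b. sat (N k) (\<lambda>u. b ! (\<rho>(v := n)) u) \<phi>)"
    by (rule Exists.IH) (use Exists.prems in \<open>auto simp: less_Suc_eq\<close>)
  from representable_ex_1[OF this] show ?case
  proof (rule representable_cong)
    fix k b assume b: "b \<in> tuples (univ (N k)) n"
    have "sat (N k) (\<lambda>u. (b @ [x]) ! (\<rho>(v := n)) u) \<phi> \<longleftrightarrow> sat (N k) ((\<lambda>u. b ! \<rho> u)(v := x)) \<phi>" for x
      by (rule sat_cong) (use Exists.prems(2) tuples_length[OF b] in \<open>auto simp: nth_append\<close>)
    then show "(\<exists>x\<in>univ (N k). sat (N k) (\<lambda>u. (b @ [x]) ! (\<rho>(v := n)) u) \<phi>) \<longleftrightarrow>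
        sat (N k) (\<lambda>u. b ! \<rho> u) (Exists v \<phi>)" by simp
  qed
qed

theorem representable_definable:
  assumes "definable L' (N ` K) n P"
  shows "representable n (\<lambda>k. P (N k))"
proof -
  obtain \<phi> where \<phi>: "lang_fm L' \<phi>" "fv \<phi> \<subseteq> {..<n}"
    "\<And>S a. S \<in> N ` K \<Longrightarrow> a \<in> tuples (univ S) n \<Longrightarrow> sat S ((!) a) \<phi> \<longleftrightarrow> P S a"
    using assms by (rule definableE) blast
  have "representable n (\<lambda>k b. sat (N k) (\<lambda>v. b ! (\<lambda>i. i) v) \<phi>)"
    by (rule representable_sat[OF \<phi>(1)]) (use \<phi>(2) in auto)
  then show ?thesis by (rule representable_cong) (use \<phi>(3) in auto)
qed

end

section \<open>Counting through an interpretation\<close>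

context structure_interpretation
begin

text \<open>
  Each element contributes \<open>1\<close> to the sum, spread evenly over its representatives.
\<close>

lemma sum_inverse_card_reps:
  assumes k: "k \<in> K" and fin: "finite (univ (M k))"
    and A: "A \<subseteq> tuples (univ (N k)) m" "finite A"
    and g: "\<And>a x. a \<in> A \<Longrightarrow> x \<in> reps k a \<Longrightarrow> g x = card (reps k a)"
  shows "(\<Sum>x\<in>(\<Union>a\<in>A. reps k a). inverse (real (g x))) = real (card A)"
proof -
  have fin_reps: "finite (reps k a)" if "a \<in> A" for a
    by (rule finite_subset[OF _ finite_tuples[OF fin, of "m * d"]]) (use reps_tuples[OF k] A(1) that in blast)
  have ne: "reps k a \<noteq> {}" if "a \<in> A" for a
    using reps_nonempty[OF k] A(1) that by blast
  have "(\<Sum>x\<in>(\<Union>a\<in>A. reps k a). inverse (real (g x)))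
      = (\<Sum>a\<in>A. \<Sum>x\<in>reps k a. inverse (real (g x)))"
    using A(2) fin_reps reps_unique[OF k] A(1) by (intro sum.UNION_disjoint) blast+
  also have "\<dots> = (\<Sum>a\<in>A. \<Sum>x\<in>reps k a. inverse (real (card (reps k a))))"
    using g by (intro sum.cong refl) auto
  also have "\<dots> = (\<Sum>a\<in>A. 1)" using ne fin_reps by (intro sum.cong refl) auto
  finally show ?thesis by simp
qed

text \<open>
  The number of \<open>a\<close> with \<open>P (a @ b)\<close> is the sum, over the set \<open>X\<close> of all representatives \<open>x\<close> of
  such \<open>a\<close>, of the reciprocal \<open>G\<close> of the number of tuples equivalent to \<open>x\<close>. Both \<open>X\<close> and the
  equivalence \<open>Y\<close> make sense for arbitrary tuples in arbitrary structures of the class, so \<open>F\<close> is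
  definably asymptotic on the whole class, whatever it means outside the interpreted structures.
\<close>

theorem counting_function:
  assumes C: "M ` K \<subseteq> C" and fin: "\<And>S. S \<in> C \<Longrightarrow> finite (univ S)"
    and finN: "\<And>k. k \<in> K \<Longrightarrow> finite (univ (N k))"
    and counts: "\<And>m. counts_asymptotic L Fil C m" and P: "representable (m + n) P"
  obtains F where "definably_asymptotic L Fil C (n * d + p) F"
    "\<And>k b y. k \<in> K \<Longrightarrow> b \<in> tuples (univ (N k)) n \<Longrightarrow> y \<in> reps k b \<Longrightarrow>
      F (M k) (y @ c k) = real (card {a \<in> tuples (univ (N k)) m. P k (a @ b)})"
proof -
  obtain R where R: "definable L UNIV (p + m * d) R" "\<forall>k\<in>K. \<forall>z\<in>tuples (univ (M k)) (m * d).
      R (M k) (c k @ z) \<longleftrightarrow> (\<exists>a\<in>tuples (univ (N k)) m. z \<in> reps k a)"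
    using reps_definable[of m] by (elim exE conjE)
  obtain Q where Q: "definable L UNIV (p + (m + n) * d) Q"
    "\<forall>k\<in>K. \<forall>b\<in>tuples (univ (N k)) (m + n). \<forall>z\<in>reps k b. Q (M k) (c k @ z) \<longleftrightarrow> P k b"
    using P unfolding representable_def by (elim exE conjE)
  \<comment> \<open>Equality of \<open>m\<close>-tuples translates to equivalence of their representatives.\<close>
  have "representable (m + m) (\<lambda>k b. \<forall>i<m. b ! i = b ! (m + i))"
    by (intro representable_all_less representable_nth_eq) auto
  then obtain E where E: "definable L UNIV (p + (m + m) * d) E"
    "\<forall>k\<in>K. \<forall>b\<in>tuples (univ (N k)) (m + m). \<forall>z\<in>reps k b.
        E (M k) (c k @ z) \<longleftrightarrow> (\<forall>i<m. b ! i = b ! (m + i))"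
    unfolding representable_def by (elim exE conjE)
  \<comment> \<open>Translated formulas take the parameters first and \<open>F\<close> takes them last, hence the reordering.\<close>
  define X where "X S a \<longleftrightarrow> R S (drop (m * d + n * d) a @ take (m * d) a) \<and>
      Q S (drop (m * d + n * d) a @ take (m * d + n * d) a)" for S a
  define Y where "Y S a \<longleftrightarrow> R S (drop (m * d + m * d + n * d) a @ take (m * d) a) \<and>
      E S (drop (m * d + m * d + n * d) a @ take (m * d + m * d) a)" for S a
  define G where "G S v = inverse (real (card {x' \<in> tuples (univ S) (m * d). Y S (x' @ v)}))" for S v
  define F where "F S w = (\<Sum>x | x \<in> tuples (univ S) (m * d) \<and> X S (x @ w). G S (x @ w))" for S w
  have X: "definable L C (m * d + (n * d + p)) X"
  proof -
    have "definable L UNIV (m * d + (n * d + p)) X" unfolding X_def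
      by (intro definable_conj
          definable_select[OF R(1) selection_append[OF selection_drop selection_take]]
          definable_select[OF Q(1) selection_append[OF selection_drop selection_take]])
        (simp_all add: add_mult_distrib)
    then show ?thesis by (rule definable_cong) auto
  qed
  have Y: "definable L C (m * d + (m * d + (n * d + p))) Y"
  proof -
    have "definable L UNIV (m * d + (m * d + (n * d + p))) Y" unfolding Y_def
      by (intro definable_conj
          definable_select[OF R(1) selection_append[OF selection_drop selection_take]]
          definable_select[OF E(1) selection_append[OF selection_drop selection_take]])
        (simp_all add: add_mult_distrib)
    then show ?thesis by (rule definable_cong) auto
  qed
  show thesis
  proof (rule that)
    have "definably_asymptotic L Fil C (m * d + (n * d + p)) G"
      unfolding G_def using counts Y by (intro definably_asymptotic_inverse) (simp add: counts_asymptotic_def)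
    from definably_asymptotic_sum_definable[OF fin counts this X]
    show "definably_asymptotic L Fil C (n * d + p) F" unfolding F_def .
    fix k b y assume k: "k \<in> K" and b: "b \<in> tuples (univ (N k)) n" and y: "y \<in> reps k b"
    let ?A = "{a \<in> tuples (univ (N k)) m. P k (a @ b)}"
    have finM: "finite (univ (M k))" using fin C k by blast
    have y': "y \<in> tuples (univ (M k)) (n * d)" by (rule reps_tuples[OF k b y])
    have R': "R (M k) (c k @ x) \<longleftrightarrow> (\<exists>a\<in>tuples (univ (N k)) m. x \<in> reps k a)"
      if "x \<in> tuples (univ (M k)) (m * d)" for x using R(2) k that by blast
    have len: "length y = n * d" "length (c k) = p" "\<And>x. x \<in> tuples (univ (M k)) (m * d) \<Longrightarrow> length x = m * d"
      using y' param[OF k] by (auto simp: tuples_def)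
    have X_iff: "X (M k) (x @ y @ c k) \<longleftrightarrow> (\<exists>a\<in>?A. x \<in> reps k a)"
      if x: "x \<in> tuples (univ (M k)) (m * d)" for x
    proof -
      have "X (M k) (x @ y @ c k) \<longleftrightarrow> R (M k) (c k @ x) \<and> Q (M k) (c k @ x @ y)"
        using len(1,2) len(3)[OF x] by (simp add: X_def)
      also have "\<dots> \<longleftrightarrow> (\<exists>a\<in>tuples (univ (N k)) m. x \<in> reps k a \<and> Q (M k) (c k @ x @ y))"
        using R'[OF x] by blast
      also have "\<dots> \<longleftrightarrow> (\<exists>a\<in>tuples (univ (N k)) m. x \<in> reps k a \<and> P k (a @ b))"
      proof (intro bex_cong refl conj_cong)
        fix a assume a: "a \<in> tuples (univ (N k)) m" "x \<in> reps k a"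
        have "x @ y \<in> reps k (a @ b)" using a(2) y by (auto simp: tuple_reps_append)
        then show "Q (M k) (c k @ x @ y) \<longleftrightarrow> P k (a @ b)"
          using Q(2) k tuples_append[OF a(1) b] by blast
      qed
      finally show ?thesis by blast
    qed
    have Y_iff: "Y (M k) (x' @ x @ y @ c k) \<longleftrightarrow> x' \<in> reps k a"
      if a: "a \<in> tuples (univ (N k)) m" "x \<in> reps k a" and x': "x' \<in> tuples (univ (M k)) (m * d)" for a x x'
    proof -
      have x: "x \<in> tuples (univ (M k)) (m * d)" by (rule reps_tuples[OF k a])
      have E': "E (M k) (c k @ x' @ x) \<longleftrightarrow> a' = a"
        if a': "a' \<in> tuples (univ (N k)) m" "x' \<in> reps k a'" for a'
      proof -
        have "x' @ x \<in> reps k (a' @ a)" using a(2) a'(2) by (auto simp: tuple_reps_append)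
        then have "E (M k) (c k @ x' @ x) \<longleftrightarrow> (\<forall>i<m. (a' @ a) ! i = (a' @ a) ! (m + i))"
          using E(2) k tuples_append[OF a'(1) a(1)] by blast
        also have "\<dots> \<longleftrightarrow> a' = a"
          using a(1) a'(1) by (auto simp: tuples_def nth_append list_eq_iff_nth_eq)
        finally show ?thesis .
      qed
      have "Y (M k) (x' @ x @ y @ c k) \<longleftrightarrow> R (M k) (c k @ x') \<and> E (M k) (c k @ x' @ x)"
        using len(1,2) len(3)[OF x] len(3)[OF x'] by (simp add: Y_def)
      also have "\<dots> \<longleftrightarrow> (\<exists>a'\<in>tuples (univ (N k)) m. x' \<in> reps k a' \<and> a' = a)"
        using R'[OF x'] E' by blast
      finally show ?thesis using a(1) by blast
    qed
    have "{x. x \<in> tuples (univ (M k)) (m * d) \<and> X (M k) (x @ y @ c k)} = (\<Union>a\<in>?A. reps k a)"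
      using X_iff reps_tuples[OF k] by blast
    moreover have "{x' \<in> tuples (univ (M k)) (m * d). Y (M k) (x' @ x @ y @ c k)} = reps k a"
      if "a \<in> ?A" "x \<in> reps k a" for a x
      using Y_iff[of a x] reps_tuples[OF k] that by blast
    ultimately show "F (M k) (y @ c k) = real (card ?A)"
      unfolding F_def G_def
      by (simp only:) (rule sum_inverse_card_reps[OF k finM, where m = m];
        simp add: finite_tuples[OF finN[OF k]] Collect_restrict)
  qed
qed

end

text \<open>
  Any colour taken at some representative of \<open>b\<close> will do. The least one is chosen since it is
  determined by \<open>b\<close> alone, and hence has a chance of being definable. The assumption on the filters
  says that the interpreting structure becomes large when the interpreted one does.
\<close>

theorem interpretable_colouring:
  fixes Fil :: "('u, 'f, 'r) struct filter" and Fil' :: "('v, 'g, 's) struct filter"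
  assumes int: "structure_interpretation L D (\<lambda>S. S) \<alpha> c rep p d L'"
    and \<alpha>: "\<alpha> ` D \<subseteq> C" and fin: "\<And>S. S \<in> C \<Longrightarrow> finite (univ S)" and finD: "\<And>S. S \<in> D \<Longrightarrow> finite (univ S)"
    and counts: "\<And>m. counts_asymptotic L Fil C m"
    and Fil: "\<And>P. eventually P Fil \<Longrightarrow> \<forall>\<^sub>F S in Fil'. S \<in> D \<longrightarrow> P (\<alpha> S)"
    and \<phi>: "formula_in L' \<phi> (xs @ ys)"
  obtains q :: "_ \<Rightarrow> _ \<Rightarrow> nat" and K h where
    "asymptotic_colouring Fil' D (length ys) (\<lambda>S b. real (card (solutions S \<phi> xs ys b)))
      (\<lambda>S b. LEAST i. \<exists>y\<in>tuple_reps (rep S) b. q (\<alpha> S) (y @ c S) = i) K h"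
    "\<And>i. i \<in> K \<Longrightarrow> definable L C (length ys * d + p) (\<lambda>M a. q M a = i)"
    "\<And>M a. M \<in> C \<Longrightarrow> a \<in> tuples (univ M) (length ys * d + p) \<Longrightarrow> q M a \<in> K"
proof -
  interpret structure_interpretation L D "\<lambda>S. S" \<alpha> c rep p d L' by (rule int)
  let ?n = "length ys"
  have "representable (length xs + ?n) (\<lambda>S. holds S \<phi> (xs @ ys))"
    by (rule representable_definable[where P = "\<lambda>S. holds S \<phi> (xs @ ys)"])
      (use definable_holds[OF \<phi>] in simp)
  then obtain F where F: "definably_asymptotic L Fil C (?n * d + p) F"
    "\<And>S b y. S \<in> D \<Longrightarrow> b \<in> tuples (univ S) ?n \<Longrightarrow> y \<in> reps S b \<Longrightarrow>
      F (\<alpha> S) (y @ c S) = real (card {a \<in> tuples (univ S) (length xs). holds S \<phi> (xs @ ys) (a @ b)})"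
    using counting_function[OF \<alpha> fin finD counts] by blast
  obtain q :: "_ \<Rightarrow> _ \<Rightarrow> nat" and K h where
    q_col: "asymptotic_colouring Fil C (?n * d + p) F q K h"
    and q_def: "\<And>i. i \<in> K \<Longrightarrow> definable L C (?n * d + p) (\<lambda>M a. q M a = i)"
    using F(1) unfolding definably_asymptotic_def by blast
  note q = asymptotic_colouringD[OF q_col]
  let ?r = "\<lambda>S b. LEAST i. \<exists>y\<in>reps S b. q (\<alpha> S) (y @ c S) = i"
  have r: "\<exists>y\<in>reps S b. q (\<alpha> S) (y @ c S) = ?r S b"
    if "S \<in> D" "b \<in> tuples (univ S) ?n" for S b
  proof -
    have "\<exists>i. \<exists>y\<in>reps S b. q (\<alpha> S) (y @ c S) = i" using reps_nonempty[OF that] by blast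
    then show ?thesis by (rule LeastI_ex)
  qed
  have arg: "y @ c S \<in> tuples (univ (\<alpha> S)) (?n * d + p)"
    if "S \<in> D" "b \<in> tuples (univ S) ?n" "y \<in> reps S b" for S b y
    by (rule tuples_append[OF reps_tuples[OF that] param[OF that(1)]])
  show thesis
  proof (rule that)
    show "asymptotic_colouring Fil' D ?n (\<lambda>S b. real (card (solutions S \<phi> xs ys b))) ?r K
        (\<lambda>i S. h i (\<alpha> S))"
      unfolding asymptotic_colouring_def
    proof (intro conjI ballI allI impI)
      show "finite K" by (rule q(1))
      show "?r S b \<in> K" if "S \<in> D" "b \<in> tuples (univ S) ?n" for S b
        using r[OF that] q(2) arg[OF that] \<alpha> that(1) by (metis image_subset_iff)
      show "0 \<le> h i (\<alpha> S)" if "i \<in> K" "S \<in> D" for i S using q(3) that \<alpha> by blast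
      fix \<epsilon> :: real assume "\<epsilon> > 0"
      from Fil[OF q(4)[OF this]] show "\<forall>\<^sub>F S in Fil'. S \<in> D \<longrightarrow> (\<forall>b\<in>tuples (univ S) ?n.
          \<bar>real (card (solutions S \<phi> xs ys b)) - h (?r S b) (\<alpha> S)\<bar> \<le> \<epsilon> * h (?r S b) (\<alpha> S))"
      proof eventually_elim
        case (elim S)
        show ?case
        proof (intro impI ballI)
          fix b assume S: "S \<in> D" and b: "b \<in> tuples (univ S) ?n"
          obtain y where y: "y \<in> reps S b" "q (\<alpha> S) (y @ c S) = ?r S b" using r[OF S b] by blast
          have "\<bar>F (\<alpha> S) (y @ c S) - h (?r S b) (\<alpha> S)\<bar> \<le> \<epsilon> * h (?r S b) (\<alpha> S)"
            using elim S \<alpha> arg[OF S b y(1)] unfolding y(2)[symmetric] by blast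
          then show "\<bar>real (card (solutions S \<phi> xs ys b)) - h (?r S b) (\<alpha> S)\<bar> \<le> \<epsilon> * h (?r S b) (\<alpha> S)"
            unfolding F(2)[OF S b y(1)] solutions_def .
        qed
      qed
    qed
    show "definable L C (?n * d + p) (\<lambda>M a. q M a = i)" if "i \<in> K" for i by (rule q_def[OF that])
    show "q M a \<in> K" if "M \<in> C" "a \<in> tuples (univ M) (?n * d + p)" for M a by (rule q(2)[OF that])
  qed
qed

text \<open>
  The elements of \<open>S\<close> are represented in \<open>\<alpha> S\<close>, whose elements are represented in \<open>S\<close> in turn. If
  the relation between single elements of \<open>S\<close> and the tuples of \<open>S\<close> coding their representatives is
  definable by \<open>\<Xi>\<close>, then so is the corresponding relation for tuples of elements.
\<close>

lemma iterated_reps_definable: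
  assumes rep1: "representation L D (\<lambda>S. S) \<alpha> (\<lambda>_. []) rep 0 d"
    and rep2: "representation L' D \<alpha> (\<lambda>S. S) (\<lambda>_. []) rep2 0 e"
    and \<Xi>: "definable L' D (1 + d * e) \<Xi>" "\<And>S x z. S \<in> D \<Longrightarrow> x \<in> univ S \<Longrightarrow> z \<in> tuples (univ S) (d * e) \<Longrightarrow>
        \<Xi> S (x # z) \<longleftrightarrow> (\<exists>y\<in>rep S x. z \<in> tuple_reps (rep2 S) y)"
  shows "\<exists>\<Theta>. definable L' D (n + n * (d * e)) \<Theta> \<and> (\<forall>S\<in>D. \<forall>b\<in>tuples (univ S) n.
    \<forall>z\<in>tuples (univ S) (n * (d * e)). \<Theta> S (b @ z) \<longleftrightarrow>
      (\<exists>y\<in>tuple_reps (rep S) b. z \<in> tuple_reps (rep2 S) y))"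
proof (induction n)
  case 0
  show ?case by (rule exI[of _ "\<lambda>_ _. True"]) (simp add: definable_True)
next
  case (Suc n)
  interpret r1: representation L D "\<lambda>S. S" \<alpha> "\<lambda>_. []" rep 0 d by (rule rep1)
  interpret r2: representation L' D \<alpha> "\<lambda>S. S" "\<lambda>_. []" rep2 0 e by (rule rep2)
  obtain \<Theta> where \<Theta>: "definable L' D (n + n * (d * e)) \<Theta>" "\<forall>S\<in>D. \<forall>b\<in>tuples (univ S) n.
    \<forall>z\<in>tuples (univ S) (n * (d * e)). \<Theta> S (b @ z) \<longleftrightarrow>
      (\<exists>y\<in>tuple_reps (rep S) b. z \<in> tuple_reps (rep2 S) y)"
    using Suc by (elim exE conjE)
  let ?\<Theta> = "\<lambda>S a. \<Theta> S (take n a @ take (n * (d * e)) (drop (Suc n) a)) \<and>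
    \<Xi> S ([a ! n] @ drop (Suc n + n * (d * e)) a)"
  show ?case
  proof (intro exI[of _ ?\<Theta>] conjI ballI)
    show "definable L' D (Suc n + Suc n * (d * e)) ?\<Theta>"
      by (intro definable_conj
          definable_select[OF \<Theta>(1) selection_append[OF selection_take selection_slice]]
          definable_select[OF \<Xi>(1) selection_append[OF selection_nth selection_drop]])
        simp_all
    fix S b' z' assume S: "S \<in> D" and b': "b' \<in> tuples (univ S) (Suc n)"
      and z': "z' \<in> tuples (univ S) (Suc n * (d * e))"
    obtain b x where b: "b \<in> tuples (univ S) n" "x \<in> univ S" "b' = b @ [x]"
      using b' tuples_add[of b' "univ S" n 1] by (auto simp: tuples_1)
    obtain z w where z: "z \<in> tuples (univ S) (n * (d * e))" "w \<in> tuples (univ S) (d * e)" "z' = z @ w"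
      using z' tuples_add[of z' "univ S" "n * (d * e)" "d * e"] by (auto simp: add.commute)
    have len: "length b = n" "length z = n * (d * e)" using b z by (auto simp: tuples_def)
    have split: "z @ w \<in> tuple_reps (rep2 S) (y1 @ y2) \<longleftrightarrow>
        z \<in> tuple_reps (rep2 S) y1 \<and> w \<in> tuple_reps (rep2 S) y2"
      if y1: "y1 \<in> tuple_reps (rep S) b" for y1 y2
    proof -
      have y1': "y1 \<in> tuples (univ (\<alpha> S)) (n * d)" by (rule r1.reps_tuples[OF S b(1) y1])
      have "length u = length z" if "u \<in> tuple_reps (rep2 S) y1" for u
        using r2.reps_tuples[OF S y1' that] len(2) by (simp add: tuples_def mult.assoc)
      then show ?thesis unfolding tuple_reps_append by auto
    qed
    have "(\<exists>y\<in>tuple_reps (rep S) b'. z' \<in> tuple_reps (rep2 S) y) \<longleftrightarrow>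
        (\<exists>y1\<in>tuple_reps (rep S) b. \<exists>y2\<in>rep S x. z @ w \<in> tuple_reps (rep2 S) (y1 @ y2))"
      unfolding b(3) z(3) tuple_reps_append[of _ b] tuple_reps_single by blast
    also have "\<dots> \<longleftrightarrow> \<Theta> S (b @ z) \<and> \<Xi> S (x # w)"
      using \<Theta>(2) \<Xi>(2)[OF S b(2) z(2)] S b(1) z(1) split by blast
    finally show "?\<Theta> S (b' @ z') \<longleftrightarrow> (\<exists>y\<in>tuple_reps (rep S) b'. z' \<in> tuple_reps (rep2 S) y)"
      using len b(3) z(3) by (simp add: nth_append)
  qed
qed

lemma Least_eq_iff:
  fixes P :: "nat \<Rightarrow> bool"
  assumes "\<exists>j. P j"
  shows "(LEAST j. P j) = i \<longleftrightarrow> P i \<and> (\<forall>j<i. \<not> P j)"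
proof
  assume "(LEAST j. P j) = i"
  then show "P i \<and> (\<forall>j<i. \<not> P j)" using LeastI_ex[OF assms] not_less_Least by blast
next
  assume "P i \<and> (\<forall>j<i. \<not> P j)"
  then show "(LEAST j. P j) = i" by (intro Least_equality) (auto simp: not_less[symmetric])
qed

text \<open>
  That some representative \<open>y\<close> of \<open>b\<close> has the colour \<open>i\<close> is expressed in \<open>S\<close> by quantifying over
  the tuples \<open>z\<close> that code such a \<open>y\<close>: this relation between \<open>b\<close> and \<open>z\<close> is definable, and the
  colour of \<open>y\<close> can be read off from \<open>z\<close> by translating its defining formula from \<open>\<alpha> S\<close> to \<open>S\<close>.
\<close>

theorem definable_least_colour:
  fixes q :: "('u, 'f, 'r) struct \<Rightarrow> 'u list \<Rightarrow> nat" and \<alpha> :: "('v, 'g, 's) struct \<Rightarrow> ('u, 'f, 'r) struct"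
  assumes rep1: "representation L D (\<lambda>S. S) \<alpha> (\<lambda>_. []) rep 0 d"
    and int2: "structure_interpretation L' D \<alpha> (\<lambda>S. S) (\<lambda>_. []) rep2 0 e L"
    and \<Xi>: "definable L' D (1 + d * e) \<Xi>" "\<And>S x z. S \<in> D \<Longrightarrow> x \<in> univ S \<Longrightarrow> z \<in> tuples (univ S) (d * e) \<Longrightarrow>
        \<Xi> S (x # z) \<longleftrightarrow> (\<exists>y\<in>rep S x. z \<in> tuple_reps (rep2 S) y)"
    and q: "\<And>i. i \<in> K \<Longrightarrow> definable L (\<alpha> ` D) (n * d) (\<lambda>M a. q M a = i)"
      "\<And>S a. S \<in> D \<Longrightarrow> a \<in> tuples (univ (\<alpha> S)) (n * d) \<Longrightarrow> q (\<alpha> S) a \<in> K"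
  shows "definable L' D n (\<lambda>S b. (LEAST i. \<exists>y\<in>tuple_reps (rep S) b. q (\<alpha> S) y = i) = i)"
proof -
  interpret r1: representation L D "\<lambda>S. S" \<alpha> "\<lambda>_. []" rep 0 d by (rule rep1)
  interpret r2: structure_interpretation L' D \<alpha> "\<lambda>S. S" "\<lambda>_. []" rep2 0 e L by (rule int2)
  obtain \<Theta> where \<Theta>: "definable L' D (n + n * (d * e)) \<Theta>" "\<forall>S\<in>D. \<forall>b\<in>tuples (univ S) n.
    \<forall>z\<in>tuples (univ S) (n * (d * e)). \<Theta> S (b @ z) \<longleftrightarrow>
      (\<exists>y\<in>tuple_reps (rep S) b. z \<in> tuple_reps (rep2 S) y)"
    using iterated_reps_definable[OF rep1 r2.representation_axioms \<Xi>] by blast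
  let ?A = "\<lambda>S b i. \<exists>y\<in>tuple_reps (rep S) b. q (\<alpha> S) y = i"
  have A: "definable L' D n (\<lambda>S b. ?A S b i)" for i
  proof (cases "i \<in> K")
    case False
    \<comment> \<open>No representative has a colour outside \<open>K\<close>.\<close>
    have "definable L' D n (\<lambda>S b. False)" by (rule definable_const)
    then show ?thesis
      by (rule definable_cong[OF _ order_refl]) (use False q(2) r1.reps_tuples in blast)
  next
    case True
    have "r2.representable (n * d) (\<lambda>S a. q (\<alpha> S) a = i)"
      by (rule r2.representable_definable[OF q(1)[OF True]])
    then obtain Q where Q: "definable L' UNIV (n * (d * e)) Q"
      "\<forall>S\<in>D. \<forall>y\<in>tuples (univ (\<alpha> S)) (n * d). \<forall>z\<in>tuple_reps (rep2 S) y. Q S z \<longleftrightarrow> q (\<alpha> S) y = i"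
      unfolding r2.representable_def by (auto simp: mult.assoc)
    have "definable L' D (n + n * (d * e)) (\<lambda>S a. Q S (drop n a))"
      by (rule definable_cong[OF definable_select[OF Q(1)] subset_UNIV])
        (use selection_drop[of n "n + n * (d * e)"] in simp_all)
    from definable_ex[OF definable_conj[OF \<Theta>(1) this]]
    show ?thesis
    proof (rule definable_cong[OF _ order_refl])
      fix S b assume S: "S \<in> D" and b: "b \<in> tuples (univ S) n"
      have lb: "length b = n" using b by (rule tuples_length)
      have ty: "y \<in> tuples (univ (\<alpha> S)) (n * d)" if "y \<in> tuple_reps (rep S) b" for y
        by (rule r1.reps_tuples[OF S b that])
      have tz: "z \<in> tuples (univ S) (n * (d * e))"
        if "y \<in> tuple_reps (rep S) b" "z \<in> tuple_reps (rep2 S) y" for y z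
        using r2.reps_tuples[OF S ty[OF that(1)] that(2)] by (simp add: mult.assoc)
      have "(\<exists>z\<in>tuples (univ S) (n * (d * e)). \<Theta> S (b @ z) \<and> Q S z) \<longleftrightarrow>
          (\<exists>y\<in>tuple_reps (rep S) b. \<exists>z\<in>tuple_reps (rep2 S) y. Q S z)"
        using \<Theta>(2) S b tz by blast
      also have "\<dots> \<longleftrightarrow> ?A S b i"
        using Q(2) S ty r2.reps_nonempty[OF S ty] by blast
      finally show "(\<exists>z\<in>tuples (univ S) (n * (d * e)). \<Theta> S (b @ z) \<and> Q S (drop n (b @ z))) \<longleftrightarrow> ?A S b i"
        using lb by simp
    qed
  qed
  have "definable L' D n (\<lambda>S b. ?A S b i \<and> (\<forall>j<i. \<not> ?A S b j))"
    by (intro definable_conj definable_all_less definable_Not A)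
  then show ?thesis
  proof (rule definable_cong[OF _ order_refl])
    fix S b assume S: "S \<in> D" and b: "b \<in> tuples (univ S) n"
    have "\<exists>j. ?A S b j" using r1.reps_nonempty[OF S b] by blast
    then show "?A S b i \<and> (\<forall>j<i. \<not> ?A S b j) \<longleftrightarrow> (LEAST i. ?A S b i) = i"
      by (simp only: Least_eq_iff)
  qed
qed

section \<open>Quotients of definable sets\<close>

lemma interp_eq_class_iff:
  assumes "equiv X E" "A \<in> X // E" "a \<in> A"
  shows "E `` {b} = A \<and> b \<in> X \<longleftrightarrow> b \<in> A"
proof -
  obtain x where x: "x \<in> X" "A = E `` {x}" using assms(2) by (rule quotientE)
  have EX: "E \<subseteq> X \<times> X" using assms(1) by (auto simp: equiv_def refl_on_def)
  show ?thesis
  proof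
    assume "E `` {b} = A \<and> b \<in> X"
    then show "b \<in> A" using assms(1) equiv_class_self by metis
  next
    assume "b \<in> A"
    then have "(x, b) \<in> E" using x(2) by blast
    then show "E `` {b} = A \<and> b \<in> X"
      using equiv_class_eq[OF assms(1), of x b] x(2) EX by blast
  qed
qed

lemma the_eq_iff:
  assumes "\<exists>!x. P x"
  shows "(THE x. P x) = y \<longleftrightarrow> P y"
proof
  assume "(THE x. P x) = y"
  then show "P y" using theI'[OF assms] by simp
qed (rule the1_equality[OF assms])

text \<open>
  Membership of classes in an induced relation asks for some representatives satisfying the
  formula; by invariance any choice of representatives can be tested.
\<close>

lemma induced_rel_iff_block_holds:
  assumes equiv: "equiv (interp_dom I M c) (interp_eq I M c)" and inv: "invariant_fm I M c \<phi> n"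
    and As: "As \<in> tuples (interp_quot I M c) n" and as: "list_all2 (\<in>) as As"
  shows "As \<in> induced_rel I M c \<phi> n \<longleftrightarrow> block_holds I M c \<phi> as"
proof
  assume "block_holds I M c \<phi> as"
  then show "As \<in> induced_rel I M c \<phi> n" using As as unfolding induced_rel_def by blast
next
  assume "As \<in> induced_rel I M c \<phi> n"
  then obtain bs where bs: "list_all2 (\<in>) bs As" "block_holds I M c \<phi> bs"
    unfolding induced_rel_def by blast
  have len: "length bs = n" "length as = n" "length As = n"
    using bs(1) as As by (auto simp: tuples_def dest: list_all2_lengthD)
  have "list_all2 (\<lambda>a b. (a, b) \<in> interp_eq I M c) bs as"
    unfolding list_all2_conv_all_nth
  proof (intro conjI allI impI)
    fix i assume i: "i < length bs"
    have "As ! i \<in> interp_quot I M c" using As i len by (intro tuples_nth) auto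
    moreover have "bs ! i \<in> As ! i" "as ! i \<in> As ! i"
      using list_all2_nthD[OF bs(1) i] list_all2_nthD2[OF as, of i] i len by auto
    ultimately show "(bs ! i, as ! i) \<in> interp_eq I M c"
      using equiv quotient_eq_iff[OF equiv] by blast
  qed (simp add: len)
  then show "block_holds I M c \<phi> as"
    using inv bs(2) len(1) unfolding invariant_fm_def by blast
qed

context
  fixes L :: "('f, 'r) lang" and L' :: "('g, 's) lang"
    and I :: "('f, 'r, 'g, 's) interp" and K :: "'k set"
    and N :: "'k \<Rightarrow> ('v, 'g, 's) struct" and M :: "'k \<Rightarrow> ('u, 'f, 'r) struct"
    and c :: "'k \<Rightarrow> 'u list" and f :: "'k \<Rightarrow> 'v \<Rightarrow> 'u list set" and p :: nat
  assumes formulas: "interp_formulas L L' p I"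
    and params: "\<And>k. k \<in> K \<Longrightarrow> c k \<in> tuples (univ (M k)) p"
    and via: "\<And>k. k \<in> K \<Longrightarrow> interprets_via L' I (M k) (c k) (N k) (f k)"
    and structs: "\<And>k. k \<in> K \<Longrightarrow> is_structure L' (N k)"
begin

lemma equiv_interp: "k \<in> K \<Longrightarrow> equiv (interp_dom I (M k) (c k)) (interp_eq I (M k) (c k))"
  using via by (simp add: interprets_via_def interp_wf_def)

lemma bij_interp: "k \<in> K \<Longrightarrow> bij_betw (f k) (univ (N k)) (interp_quot I (M k) (c k))"
  using via by (simp add: interprets_via_def isomorphism_def interp_struct_def)

lemma interp_class: "k \<in> K \<Longrightarrow> x \<in> univ (N k) \<Longrightarrow> f k x \<in> interp_quot I (M k) (c k)"
  using bij_interp by (meson bij_betwE)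

lemma interp_class_dom: "k \<in> K \<Longrightarrow> x \<in> univ (N k) \<Longrightarrow> f k x \<subseteq> interp_dom I (M k) (c k)"
  using interp_class equiv_interp
  by (meson equiv_type in_quotient_imp_subset)

lemma interp_representation: "representation L K N M c f p (dim I)"
proof
  fix k x assume k: "k \<in> K" and x: "x \<in> univ (N k)"
  show "f k x \<subseteq> tuples (univ (M k)) (dim I)"
    using interp_class_dom[OF k x] by (auto simp: interp_dom_def)
  show "f k x \<noteq> {}"
    using interp_class[OF k x] equiv_interp[OF k] in_quotient_imp_non_empty by metis
next
  fix k x y w assume k: "k \<in> K" and xy: "x \<in> univ (N k)" "y \<in> univ (N k)" "w \<in> f k x" "w \<in> f k y"
  then have "f k x = f k y"
    using quotient_disj[OF equiv_interp[OF k] interp_class[OF k xy(1)] interp_class[OF k xy(2)]] by blast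
  then show "x = y" using bij_interp[OF k] xy(1,2) by (auto simp: bij_betw_def dest: inj_onD)
next
  let ?Q = "\<lambda>M. holds M (dom_fm I) [0..<p + dim I]"
  show "\<exists>Q. definable L UNIV (p + dim I) Q \<and> (\<forall>k\<in>K. \<forall>w\<in>tuples (univ (M k)) (dim I).
      Q (M k) (c k @ w) \<longleftrightarrow> (\<exists>x\<in>univ (N k). w \<in> f k x))"
  proof (intro exI[of _ ?Q] conjI ballI)
    show "definable L UNIV (p + dim I) ?Q"
      using definable_holds[of L "dom_fm I" "[0..<p + dim I]"] formulas by (simp add: interp_formulas_def)
    fix k w assume k: "k \<in> K" and w: "w \<in> tuples (univ (M k)) (dim I)"
    have "?Q (M k) (c k @ w) \<longleftrightarrow> w \<in> interp_dom I (M k) (c k)"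
      using w params[OF k] by (simp add: interp_dom_def tuples_def)
    also have "\<dots> \<longleftrightarrow> w \<in> \<Union>(interp_quot I (M k) (c k))"
      using Union_quotient[OF equiv_interp[OF k]] by simp
    also have "\<dots> \<longleftrightarrow> (\<exists>x\<in>univ (N k). w \<in> f k x)"
      using bij_interp[OF k] by (auto simp: bij_betw_def)
    finally show "?Q (M k) (c k @ w) \<longleftrightarrow> (\<exists>x\<in>univ (N k). w \<in> f k x)" .
  qed
qed (use params in auto)

lemma induced_rel_iff_reps:
  assumes "k \<in> K" "b \<in> tuples (univ (N k)) n" "z \<in> tuple_reps (f k) b"
    and inv: "invariant_fm I (M k) (c k) \<phi> n"
  shows "map (f k) b \<in> induced_rel I (M k) (c k) \<phi> n \<longleftrightarrow>
    holds (M k) \<phi> [0..<p + n * dim I] (c k @ z)"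
proof -
  obtain as where as: "z = concat as" "list_all2 (\<in>) as (map (f k) b)"
    using assms(3) by (auto simp: tuple_reps_iff_concat list_all2_map2)
  have "map (f k) b \<in> tuples (interp_quot I (M k) (c k)) n"
    using interp_class[OF assms(1)] assms(2) by (auto simp: tuples_def)
  from induced_rel_iff_block_holds[OF equiv_interp[OF assms(1)] inv this as(2)]
  show ?thesis
    using as assms(2) params[OF assms(1)]
    by (auto simp: block_holds_def tuples_def dest: list_all2_lengthD)
qed

theorem interp_structure_interpretation: "structure_interpretation L K N M c f p (dim I) L'"
proof -
  interpret representation L K N M c f p "dim I" by (rule interp_representation)
  show ?thesis
  proof
    show "is_structure L' (N k)" if "k \<in> K" for k by (rule structs[OF that])
    let ?Q = "\<lambda>M. holds M (eq_fm I) [0..<p + 2 * dim I]"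
    show "representable 2 (\<lambda>k b. b ! 0 = b ! 1)"
      unfolding representable_def
    proof (intro exI[of _ ?Q] conjI ballI)
      show "definable L UNIV (p + 2 * dim I) ?Q"
        using definable_holds[of L "eq_fm I" "[0..<p + 2 * dim I]"] formulas
        by (simp add: interp_formulas_def)
      fix k b z assume k: "k \<in> K" and b: "b \<in> tuples (univ (N k)) 2" and z: "z \<in> reps k b"
      obtain x y where xy: "b = [x, y]" "x \<in> univ (N k)" "y \<in> univ (N k)"
        using b by (auto simp: tuples_def length_Suc_conv numeral_2_eq_2)
      obtain w w' where w: "z = w @ w'" "w \<in> f k x" "w' \<in> f k y" using z xy(1) by auto
      have "(w, w') \<in> interp_eq I (M k) (c k) \<longleftrightarrow> f k x = f k y"
        using quotient_eq_iff[OF equiv_interp[OF k] interp_class[OF k xy(2)] interp_class[OF k xy(3)] w(2,3)]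
        by simp
      moreover have "(w, w') \<in> interp_eq I (M k) (c k) \<longleftrightarrow> ?Q (M k) (c k @ z)"
        using w interp_class_dom[OF k] xy params[OF k] by (auto simp: interp_eq_def tuples_def)
      moreover have "f k x = f k y \<longleftrightarrow> x = y"
        using bij_interp[OF k] xy by (auto simp: bij_betw_def dest: inj_onD)
      ultimately show "?Q (M k) (c k @ z) \<longleftrightarrow> b ! 0 = b ! 1" using xy(1) by simp
    qed
  next
    fix r assume r: "r \<in> rel_syms L'"
    let ?n = "rel_ar L' r"
    let ?Q = "\<lambda>M. holds M (rel_fm I r) [0..<p + ?n * dim I]"
    show "representable ?n (\<lambda>k b. b \<in> rel_int (N k) r)"
      unfolding representable_def
    proof (intro exI[of _ ?Q] conjI ballI)
      show "definable L UNIV (p + ?n * dim I) ?Q"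
        using definable_holds[of L "rel_fm I r" "[0..<p + ?n * dim I]"] formulas r
        by (simp add: interp_formulas_def)
      fix k b z assume k: "k \<in> K" and b: "b \<in> tuples (univ (N k)) ?n" and z: "z \<in> reps k b"
      have "b \<in> rel_int (N k) r \<longleftrightarrow> map (f k) b \<in> induced_rel I (M k) (c k) (rel_fm I r) ?n"
        using via[OF k] b r by (simp add: interprets_via_def isomorphism_def interp_struct_def)
      moreover have "invariant_fm I (M k) (c k) (rel_fm I r) ?n"
        using via[OF k] r by (simp add: interprets_via_def interp_wf_def)
      ultimately show "?Q (M k) (c k @ z) \<longleftrightarrow> b \<in> rel_int (N k) r"
        using induced_rel_iff_reps[OF k b z] by simp
    qed
  next
    fix g assume g: "g \<in> fun_syms L'"
    let ?n = "fun_ar L' g"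
    let ?Q = "\<lambda>M. holds M (fun_fm I g) [0..<p + Suc ?n * dim I]"
    show "representable (Suc ?n) (\<lambda>k b. fun_int (N k) g (butlast b) = last b)"
      unfolding representable_def
    proof (intro exI[of _ ?Q] conjI ballI)
      show "definable L UNIV (p + Suc ?n * dim I) ?Q"
        using definable_holds[of L "fun_fm I g" "[0..<p + Suc ?n * dim I]"] formulas g
        by (simp add: interp_formulas_def)
      fix k b z assume k: "k \<in> K" and b: "b \<in> tuples (univ (N k)) (Suc ?n)" and z: "z \<in> reps k b"
      obtain b' y where b': "b = b' @ [y]" "b' \<in> tuples (univ (N k)) ?n" "y \<in> univ (N k)"
        using b tuples_add[of b "univ (N k)" ?n 1] by (auto simp: tuples_1)
      let ?R = "induced_rel I (M k) (c k) (fun_fm I g) (Suc ?n)"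
      have quot: "map (f k) b' \<in> tuples (interp_quot I (M k) (c k)) ?n"
        using interp_class[OF k] b'(2) by (auto simp: tuples_def)
      have ex1: "\<exists>!B. map (f k) b' @ [B] \<in> ?R"
        using via[OF k] g quot by (simp add: interprets_via_def interp_wf_def)
      have "fun_int (N k) g b' \<in> univ (N k)"
        using structs[OF k] g b'(2) by (auto simp: is_structure_def)
      then have "fun_int (N k) g b' = y \<longleftrightarrow> f k (fun_int (N k) g b') = f k y"
        using bij_interp[OF k] b'(3) by (auto simp: bij_betw_def dest: inj_onD)
      also have "f k (fun_int (N k) g b') = (THE B. map (f k) b' @ [B] \<in> ?R)"
        using via[OF k] g b'(2) quot
        by (simp add: interprets_via_def isomorphism_def interp_struct_def)
      also have "\<dots> = f k y \<longleftrightarrow> map (f k) b' @ [f k y] \<in> ?R"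
        by (rule the_eq_iff[OF ex1])
      also have "\<dots> \<longleftrightarrow> ?Q (M k) (c k @ z)"
        using induced_rel_iff_reps[OF k b z, of "fun_fm I g"] via[OF k] g b'(1)
        by (simp add: interprets_via_def interp_wf_def)
      finally show "?Q (M k) (c k @ z) \<longleftrightarrow> fun_int (N k) g (butlast b) = last b"
        using b'(1) by simp
    qed
  qed
qed

end

text \<open>
  The map defined by \<open>\<xi>\<close> sends \<open>x\<close> to the set of the tuples \<open>map g y\<close>, where \<open>y\<close> represents \<open>x\<close>.
  An entry of such a tuple is a class \<open>g u\<close>, whose members are the representatives of \<open>u\<close>; so \<open>\<xi>\<close>
  relates \<open>x\<close> to the codes of its representatives.
\<close>

lemma defines_map_iff:
  assumes via1: "interprets_via L' I M [] N f" and via2: "interprets_via L J N [] M g"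
    and def: "defines_map L' N J I \<xi> (induced_map g \<circ> f)"
    and x: "x \<in> univ N" and z: "z \<in> tuples (univ N) (dim I * dim J)"
  shows "holds N \<xi> [0..<1 + dim I * dim J] (x # z) \<longleftrightarrow> (\<exists>y\<in>f x. z \<in> tuple_reps g y)"
proof -
  let ?X = "interp_dom J N []" and ?E = "interp_eq J N []"
  have equiv: "equiv ?X ?E" using via2 by (simp add: interprets_via_def interp_wf_def)
  have g_class: "g u \<in> ?X // ?E" if "u \<in> univ M" for u
    using via2 that by (auto simp: interprets_via_def isomorphism_def interp_struct_def dest: bij_betwE)
  have f_tuples: "y \<in> tuples (univ M) (dim I)" if "y \<in> f x" for y
  proof -
    have "f x \<in> interp_quot I M []"
      using via1 x by (auto simp: interprets_via_def isomorphism_def interp_struct_def dest: bij_betwE)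
    moreover have "equiv (interp_dom I M []) (interp_eq I M [])"
      using via1 by (simp add: interprets_via_def interp_wf_def)
    ultimately have "y \<in> interp_dom I M []" using that by (meson equiv_type in_quotient_imp_subset subsetD)
    then show ?thesis by (simp add: interp_dom_def)
  qed
  have cls: "b \<in> ?X \<and> ?E `` {b} = g u \<longleftrightarrow> b \<in> g u" if u: "u \<in> univ M" for b u
  proof -
    obtain a where "a \<in> g u" using g_class[OF u] equiv in_quotient_imp_non_empty by blast
    then show ?thesis using interp_eq_class_iff[OF equiv g_class[OF u]] by blast
  qed
  have all2: "as \<in> tuples ?X (dim I) \<and> map (\<lambda>a. ?E `` {a}) as = map g y \<longleftrightarrow>
      list_all2 (\<lambda>a u. a \<in> g u) as y" if "y \<in> f x" for as y
  proof -
    have y: "length y = dim I" "\<And>i. i < dim I \<Longrightarrow> y ! i \<in> univ M"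
      using f_tuples[OF that] tuples_nth by (auto simp: tuples_def)
    have "list_all2 (\<lambda>a u. a \<in> g u) as y \<longleftrightarrow>
        length as = dim I \<and> (\<forall>i<dim I. as ! i \<in> ?X \<and> ?E `` {as ! i} = g (y ! i))"
      using y cls by (auto simp: list_all2_conv_all_nth)
    also have "\<dots> \<longleftrightarrow> as \<in> tuples ?X (dim I) \<and> map (\<lambda>a. ?E `` {a}) as = map g y"
      using y(1) unfolding tuples_def mem_Collect_eq subset_eq all_set_conv_all_nth
        list_eq_iff_nth_eq[of "map (\<lambda>a. ?E `` {a}) as"]
      by (cases "length as = dim I") (simp_all, blast)
    finally show ?thesis by simp
  qed
  have "holds N \<xi> [0..<1 + dim I * dim J] (x # z) \<longleftrightarrow>
      x # z \<in> solutions N \<xi> [0..<1 + dim I * dim J] [] []"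
    using x z by (simp add: solutions_def tuples_def)
  also have "\<dots> \<longleftrightarrow> (\<exists>as. z = concat as \<and> as \<in> tuples ?X (dim I) \<and>
      map (\<lambda>a. ?E `` {a}) as \<in> induced_map g (f x))"
    using def x by (auto simp: defines_map_def)
  also have "\<dots> \<longleftrightarrow> (\<exists>y\<in>f x. \<exists>as. z = concat as \<and>
      as \<in> tuples ?X (dim I) \<and> map (\<lambda>a. ?E `` {a}) as = map g y)"
    by (auto simp: induced_map_def)
  also have "\<dots> \<longleftrightarrow> (\<exists>y\<in>f x. z \<in> tuple_reps g y)"
    unfolding tuple_reps_iff_concat using all2 by (intro bex_cong refl) blast
  finally show ?thesis .
qed

section \<open>Interpretable and bi-interpretable classes\<close>

lemma card_le_of_representation:
  assumes "representation L K N M c rep p d" "k \<in> K" "finite (univ (M k))"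
  shows "card (univ (N k)) \<le> card (univ (M k)) ^ d"
proof -
  interpret representation L K N M c rep p d by (rule assms(1))
  have "card (univ (N k)) \<le> card (tuples (univ (M k)) d)"
  proof (rule card_inj_on_le)
    have some: "(SOME w. w \<in> rep k x) \<in> rep k x" if "x \<in> univ (N k)" for x
      using rep_nonempty[OF assms(2) that] by (simp add: some_in_eq)
    show "inj_on (\<lambda>x. SOME w. w \<in> rep k x) (univ (N k))"
      by (rule inj_onI) (metis some rep_unique[OF assms(2)])
    show "(\<lambda>x. SOME w. w \<in> rep k x) ` univ (N k) \<subseteq> tuples (univ (M k)) d"
      using some rep_tuples[OF assms(2)] by blast
  qed (rule finite_tuples[OF assms(3)])
  also have "\<dots> = card (univ (M k)) ^ d"
    using card_lists_length_eq[OF assms(3)] by (simp add: tuples_def)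
  finally show ?thesis .
qed

text \<open>
  If \<open>\<alpha> S\<close> has at most \<open>Q\<close> elements, then \<open>S\<close> has at most \<open>Q ^ d\<close>.
\<close>

lemma eventually_size_filter_transfer:
  assumes rep: "representation L D (\<lambda>S. S) \<alpha> c rep p d"
    and fin: "\<And>S. S \<in> D \<Longrightarrow> finite (univ (\<alpha> S))"
    and "eventually P size_filter"
  shows "\<forall>\<^sub>F S in size_filter. S \<in> D \<longrightarrow> P (\<alpha> S)"
proof -
  obtain Q where Q: "\<And>M. card (univ M) > Q \<Longrightarrow> P M"
    using assms(3) by (auto simp: eventually_filtercomap_at_top_dense)
  have "P (\<alpha> S)" if "card (univ S) > Q ^ d" "S \<in> D" for S
  proof (rule Q, rule ccontr)
    assume "\<not> card (univ (\<alpha> S)) > Q"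
    then have "card (univ (\<alpha> S)) ^ d \<le> Q ^ d" by (intro power_mono) auto
    then show False using card_le_of_representation[OF rep that(2) fin[OF that(2)]] that(1) by simp
  qed
  then show ?thesis by (auto simp: eventually_filtercomap_at_top_dense)
qed

lemma eventually_transfer:
  assumes "representation L D (\<lambda>S. S) \<alpha> c rep p d" "\<And>S. S \<in> D \<Longrightarrow> finite (univ (\<alpha> S))"
    and "eventually P (condition_filter asymptotic)"
  shows "\<forall>\<^sub>F S in condition_filter asymptotic. S \<in> D \<longrightarrow> P (\<alpha> S)"
  using eventually_size_filter_transfer[OF assms(1,2)] assms(3)
  by (cases asymptotic) (auto simp: condition_filter_def)

lemma interpretable_class_condition:
  fixes L :: "('f, 'r) lang" and C :: "('u, 'f, 'r) struct set"
    and L' :: "('g, 's) lang" and D :: "('v, 'g, 's) struct set"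
  assumes fin: "finite_structures L C" "finite_structures L' D"
    and int: "uniformly_interpretable L' D L C"
    and C: "\<And>\<phi> xs ys. formula_in L \<phi> (xs @ ys) \<Longrightarrow>
      class_condition (definable_partition L C ys) (condition_filter asymptotic) R C \<phi> xs ys"
    and R: "R \<subseteq> C \<rightarrow> {0..}" and \<phi>: "formula_in L' \<phi> (xs @ ys)"
  shows "class_condition (\<lambda>_. True) (condition_filter asymptotic) (D \<rightarrow> {0..}) D \<phi> xs ys"
proof -
  obtain \<alpha> p and I :: "('f, 'r, 'g, 's) interp" where I: "\<alpha> ` D \<subseteq> C" "interp_formulas L L' p I"
    "\<forall>S\<in>D. \<exists>c\<in>tuples (univ (\<alpha> S)) p. \<exists>f. interprets_via L' I (\<alpha> S) c S f"
    using int unfolding uniformly_interpretable_def by blast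
  from I(3) obtain c where c: "\<forall>S\<in>D. c S \<in> tuples (univ (\<alpha> S)) p \<and>
      (\<exists>f. interprets_via L' I (\<alpha> S) (c S) S f)" by metis
  then obtain f where f: "\<forall>S\<in>D. interprets_via L' I (\<alpha> S) (c S) S (f S)" by metis
  have inter: "structure_interpretation L D (\<lambda>S. S) \<alpha> c f p (dim I) L'"
    by (rule interp_structure_interpretation[OF I(2)])
      (use c f fin(2) in \<open>auto simp: finite_structures_def\<close>)
  then have rep: "representation L D (\<lambda>S. S) \<alpha> c f p (dim I)" by (rule structure_interpretation.axioms)
  have finC: "finite (univ S)" if "S \<in> C" for S using fin(1) that by (simp add: finite_structures_def)
  have finD: "finite (univ S)" if "S \<in> D" for S using fin(2) that by (simp add: finite_structures_def)
  have counts: "counts_asymptotic L (condition_filter asymptotic) C m" for m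
    by (rule counts_asymptotic_of_class_condition[OF C R refl])
  obtain q :: "_ \<Rightarrow> _ \<Rightarrow> nat" and K h where
    "asymptotic_colouring (condition_filter asymptotic) D (length ys) (\<lambda>S b. real (card (solutions S \<phi> xs ys b)))
      (\<lambda>S b. LEAST i. \<exists>y\<in>tuple_reps (f S) b. q (\<alpha> S) (y @ c S) = i) K h"
    by (rule interpretable_colouring[OF inter I(1) finC finD counts eventually_transfer[OF rep] \<phi>])
      (use finC I(1) in auto)
  then show ?thesis by (rule class_condition_of_colouring) simp
qed

lemma bi_interpretable_class_condition:
  fixes L :: "('f, 'r) lang" and C :: "('u, 'f, 'r) struct set"
    and L' :: "('g, 's) lang" and D :: "('v, 'g, 's) struct set"
  assumes fin: "finite_structures L C" "finite_structures L' D"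
    and bi: "uniformly_bi_interpretable L C L' D"
    and C: "\<And>\<phi> xs ys. formula_in L \<phi> (xs @ ys) \<Longrightarrow>
      class_condition (definable_partition L C ys) (condition_filter asymptotic) R C \<phi> xs ys"
    and R: "R \<subseteq> C \<rightarrow> {0..}" and \<phi>: "formula_in L' \<phi> (xs @ ys)"
  shows "class_condition (definable_partition L' D ys) (condition_filter asymptotic) (D \<rightarrow> {0..}) D \<phi> xs ys"
proof (cases "D = {}")
  case True
  \<comment> \<open>With no structure in \<open>D\<close> nothing is known about the formulas of the interpretations.\<close>
  then have "partition_on (class_pairs D ys) {}" "definable_partition L' D ys {}"
    by (simp_all add: class_pairs_def definable_partition_def partition_on_def)
  then show ?thesis unfolding class_condition_def by blast
next
  case False
  obtain \<alpha> and I :: "('f, 'r, 'g, 's) interp" and J :: "('g, 's, 'f, 'r) interp" and \<chi> \<xi> where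
    \<alpha>: "bij_betw \<alpha> D C" and bi: "\<forall>S\<in>D. bi_interpretable_via L (\<alpha> S) L' S I J \<chi> \<xi>"
    using bi unfolding uniformly_bi_interpretable_def by blast
  have \<alpha>D: "\<alpha> ` D = C" using \<alpha> by (simp add: bij_betw_def)
  have formulas: "interp_formulas L L' 0 I" "interp_formulas L' L 0 J"
    using False bi unfolding bi_interpretable_via_def by blast+
  have "\<forall>S\<in>D. \<exists>fg. interprets_via L' I (\<alpha> S) [] S (fst fg) \<and> interprets_via L J S [] (\<alpha> S) (snd fg) \<and>
      defines_map L' S J I \<xi> (induced_map (snd fg) \<circ> fst fg)"
    using bi unfolding bi_interpretable_via_def by fastforce
  from bchoice[OF this] obtain fg where
    fg: "\<forall>S\<in>D. interprets_via L' I (\<alpha> S) [] S (fst (fg S)) \<and> interprets_via L J S [] (\<alpha> S) (snd (fg S)) \<and>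
      defines_map L' S J I \<xi> (induced_map (snd (fg S)) \<circ> fst (fg S))" ..
  define f g where "f S = fst (fg S)" and "g S = snd (fg S)" for S
  have via: "interprets_via L' I (\<alpha> S) [] S (f S)" "interprets_via L J S [] (\<alpha> S) (g S)"
    "defines_map L' S J I \<xi> (induced_map (g S) \<circ> f S)" if "S \<in> D" for S
    using fg that by (auto simp: f_def g_def)
  have inter: "structure_interpretation L D (\<lambda>S. S) \<alpha> (\<lambda>_. []) f 0 (dim I) L'"
    by (rule interp_structure_interpretation[OF formulas(1)])
      (use via fin(2) in \<open>auto simp: finite_structures_def\<close>)
  have inter2: "structure_interpretation L' D \<alpha> (\<lambda>S. S) (\<lambda>_. []) g 0 (dim J) L"
    by (rule interp_structure_interpretation[OF formulas(2)])
      (use via fin(1) \<alpha>D in \<open>auto simp: finite_structures_def\<close>)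
  from inter have rep: "representation L D (\<lambda>S. S) \<alpha> (\<lambda>_. []) f 0 (dim I)"
    by (rule structure_interpretation.axioms)
  have finC: "finite (univ S)" if "S \<in> C" for S using fin(1) that by (simp add: finite_structures_def)
  have finD: "finite (univ S)" if "S \<in> D" for S using fin(2) that by (simp add: finite_structures_def)
  have counts: "counts_asymptotic L (condition_filter asymptotic) C m" for m
    by (rule counts_asymptotic_of_class_condition[OF C R refl])
  obtain q :: "_ \<Rightarrow> _ \<Rightarrow> nat" and K h where q:
    "asymptotic_colouring (condition_filter asymptotic) D (length ys) (\<lambda>S b. real (card (solutions S \<phi> xs ys b)))
      (\<lambda>S b. LEAST i. \<exists>y\<in>tuple_reps (f S) b. q (\<alpha> S) (y @ []) = i) K h"
    "\<And>i. i \<in> K \<Longrightarrow> definable L C (length ys * dim I + 0) (\<lambda>M a. q M a = i)"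
    "\<And>M a. M \<in> C \<Longrightarrow> a \<in> tuples (univ M) (length ys * dim I + 0) \<Longrightarrow> q M a \<in> K"
    by (rule interpretable_colouring[OF inter _ finC finD counts eventually_transfer[OF rep] \<phi>])
      (use finC \<alpha>D in auto)
  let ?\<Xi> = "\<lambda>S. holds S \<xi> [0..<1 + dim I * dim J]"
  have "definable L' D (length ys) (\<lambda>S b. (LEAST i. \<exists>y\<in>tuple_reps (f S) b. q (\<alpha> S) y = i) = i)" for i
  proof (rule definable_least_colour[OF rep inter2])
    obtain S where "S \<in> D" using False by blast
    then have "formula_in L' \<xi> [0..<1 + dim I * dim J]" using via(3) by (simp add: defines_map_def)
    from definable_holds[OF this] show "definable L' D (1 + dim I * dim J) ?\<Xi>" by simp
    show "?\<Xi> S (x # z) \<longleftrightarrow> (\<exists>y\<in>f S x. z \<in> tuple_reps (g S) y)"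
      if "S \<in> D" "x \<in> univ S" "z \<in> tuples (univ S) (dim I * dim J)" for S x z
      by (rule defines_map_iff[OF via[OF that(1)] that(2,3)])
    show "definable L (\<alpha> ` D) (length ys * dim I) (\<lambda>M a. q M a = i)" if "i \<in> K" for i
      using q(2)[OF that] \<alpha>D by simp
    show "q (\<alpha> S) a \<in> K" if "S \<in> D" "a \<in> tuples (univ (\<alpha> S)) (length ys * dim I)" for S a
      using q(3) that \<alpha>D by auto
  qed
  then show ?thesis
    by (intro class_condition_of_colouring[OF q(1)] definable_partition_of_colouring[of _ K])
      (use \<phi> in \<open>auto simp: formula_in_def\<close>)
qed

theorem theorem1:
  fixes L :: "('f, 'r) lang" and C :: "('u, 'f, 'r) struct set"
    and L' :: "('g, 's) lang" and D :: "('v, 'g, 's) struct set"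
  assumes "finite_structures L C"
  shows
    "((\<exists>R \<subseteq> C \<rightarrow> {0..}. \<forall>\<phi> x ys. formula_in L \<phi> (x # ys) \<longrightarrow> mac_condition L R C \<phi> [x] ys)
        \<longrightarrow> mac L C) \<and>
     ((\<exists>R \<subseteq> C \<rightarrow> {0..}. \<forall>\<phi> x ys. formula_in L \<phi> (x # ys) \<longrightarrow> mec_condition L R C \<phi> [x] ys)
        \<longrightarrow> mec L C) \<and>
     (finite_structures L' D \<and> uniformly_interpretable L' D L C \<and> mac L C \<longrightarrow> weak_mac L' D) \<and>
     (finite_structures L' D \<and> uniformly_interpretable L' D L C \<and> mec L C \<longrightarrow> weak_mec L' D) \<and>
     (finite_structures L' D \<and> uniformly_bi_interpretable L C L' D \<and> mac L C \<longrightarrow> mac L' D) \<and>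
     (finite_structures L' D \<and> uniformly_bi_interpretable L C L' D \<and> mec L C \<longrightarrow> mec L' D)"
proof -
  have fin: "finite (univ S)" if "S \<in> C" for S using assms that by (simp add: finite_structures_def)
  note iffs = mac_condition_iff mec_condition_iff weak_mac_condition_iff weak_mec_condition_iff
  \<comment> \<open>All nonnegative functions together may serve as \<open>R\<close> in the conclusions.\<close>
  have C: "mac_condition L (C \<rightarrow> {0..}) C \<phi> xs ys"
    if "R \<subseteq> C \<rightarrow> {0..}" "\<forall>\<phi> x ys. formula_in L \<phi> (x # ys) \<longrightarrow> mac_condition L R C \<phi> [x] ys"
      "formula_in L \<phi> (xs @ ys)" for R \<phi> xs ys
    using one_variable_criterion[OF fin that(1) _ that(3)] that(2) unfolding iffs by blast
  have C': "mec_condition L (C \<rightarrow> {0..}) C \<phi> xs ys"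
    if "R \<subseteq> C \<rightarrow> {0..}" "\<forall>\<phi> x ys. formula_in L \<phi> (x # ys) \<longrightarrow> mec_condition L R C \<phi> [x] ys"
      "formula_in L \<phi> (xs @ ys)" for R \<phi> xs ys
    using one_variable_criterion[OF fin that(1) _ that(3)] that(2) unfolding iffs by blast
  have D: "weak_mac_condition (D \<rightarrow> {0..}) D \<phi> xs ys"
    if "finite_structures L' D" "uniformly_interpretable L' D L C" "R_mac L R C"
      "formula_in L' \<phi> (xs @ ys)" for R \<phi> xs ys
    using interpretable_class_condition[OF assms that(1,2) _ _ that(4), of True R] that(3)
    unfolding iffs R_mac_def by blast
  have D': "weak_mec_condition (D \<rightarrow> {0..}) D \<phi> xs ys"
    if "finite_structures L' D" "uniformly_interpretable L' D L C" "R_mec L R C"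
      "formula_in L' \<phi> (xs @ ys)" for R \<phi> xs ys
    using interpretable_class_condition[OF assms that(1,2) _ _ that(4), of False R] that(3)
    unfolding iffs R_mec_def by blast
  have E: "mac_condition L' (D \<rightarrow> {0..}) D \<phi> xs ys"
    if "finite_structures L' D" "uniformly_bi_interpretable L C L' D" "R_mac L R C"
      "formula_in L' \<phi> (xs @ ys)" for R \<phi> xs ys
    using bi_interpretable_class_condition[OF assms that(1,2) _ _ that(4), of True R] that(3)
    unfolding iffs R_mac_def by blast
  have E': "mec_condition L' (D \<rightarrow> {0..}) D \<phi> xs ys"
    if "finite_structures L' D" "uniformly_bi_interpretable L C L' D" "R_mec L R C"
      "formula_in L' \<phi> (xs @ ys)" for R \<phi> xs ys
    using bi_interpretable_class_condition[OF assms that(1,2) _ _ that(4), of False R] that(3)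
    unfolding iffs R_mec_def by blast
  have "mac L C" if "\<exists>R \<subseteq> C \<rightarrow> {0..}. \<forall>\<phi> x ys. formula_in L \<phi> (x # ys) \<longrightarrow> mac_condition L R C \<phi> [x] ys"
    using that C unfolding mac_def R_mac_def by (intro exI[of _ "C \<rightarrow> {0..}"]) blast
  moreover have "mec L C" if "\<exists>R \<subseteq> C \<rightarrow> {0..}. \<forall>\<phi> x ys. formula_in L \<phi> (x # ys) \<longrightarrow> mec_condition L R C \<phi> [x] ys"
    using that C' unfolding mec_def R_mec_def by (intro exI[of _ "C \<rightarrow> {0..}"]) blast
  moreover have "weak_mac L' D" if "finite_structures L' D" "uniformly_interpretable L' D L C" "mac L C"
    using D[OF that(1,2)] that(3) unfolding weak_mac_def weak_R_mac_def mac_def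
    by (intro exI[of _ "D \<rightarrow> {0..}"]) blast
  moreover have "weak_mec L' D" if "finite_structures L' D" "uniformly_interpretable L' D L C" "mec L C"
    using D'[OF that(1,2)] that(3) unfolding weak_mec_def weak_R_mec_def mec_def
    by (intro exI[of _ "D \<rightarrow> {0..}"]) blast
  moreover have "mac L' D" if "finite_structures L' D" "uniformly_bi_interpretable L C L' D" "mac L C"
    using E[OF that(1,2)] that(3) unfolding mac_def R_mac_def[of L']
    by (intro exI[of _ "D \<rightarrow> {0..}"]) blast
  moreover have "mec L' D" if "finite_structures L' D" "uniformly_bi_interpretable L C L' D" "mec L C"
    using E'[OF that(1,2)] that(3) unfolding mec_def R_mec_def[of L']
    by (intro exI[of _ "D \<rightarrow> {0..}"]) blast
  ultimately show ?thesis by (intro conjI impI; (elim conjE)?; simp only:)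
qed

end
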